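(* Let $\mathcal{P}_0$ be an ultra-thin set of primes with weight sequence $(w_n)$, let $\mathcal{N}_0$ be the set of $\mathcal{P}_0$-smooth integers, and let $(a_n)_{n\in\mathcal{N}_0}$ be complex numbers. If $$\sum_{n\in\mathcal{N}_0}|a_n|^2\,w_n\log^2n<\infty,$$ then the random Dirichlet series $f_\omega(s)=\sum_{n\in\mathcal{N}_0}\varepsilon_n(\omega)a_nn^{-s}$ is almost surely in $\mathrm{BMOA}\cap\mathcal{D}$, where $(\varepsilon_n)$ is a standard Rademacher sequence (independent random signs, each equal to $\pm1$ with probability $1/2$).
   Context: For a (finite or infinite) set $\mathcal{P}_0$ of prime numbers, set $\pi_0(x):=\#\{p\in\mathcal{P}_0:p\le x\}$. $\mathcal{P}_0$ is called ultra-thin if $\int_3^\infty\frac{\pi_0(x)\log\log x}{x\log^3x}\,dx<\infty$. Its weight sequence is $w_1=w_2=1$ and $w_n:=\int_n^\infty\frac{\pi_0(x)\log\log x}{x\log^3x}\,dx$ for $n\ge3$. A positive integer is $\mathcal{P}_0$-smooth if all its prime divisors belong to $\mathcal{P}_0$. $\mathcal{D}$ is the class of functions expressible as a convergent Dirichlet series $\sum_{n\ge1}a_nn^{-s}$ in some half-plane $\operatorname{Re}s>\sigma_0$. $\mathrm{BMOA}$ is the space of analytic functions $f$ in $\{\operatorname{Re}s>0\}$ satisfying $\sup_{\sigma>0}\int_{-\infty}^\infty\frac{|f(\sigma+it)|^2}{1+\sigma^2+t^2}\,dt<\infty$ and $\|f\|_{\mathrm{BMO}}:=\sup_I\frac1{|I|}\int_I\big|f(it)-\frac1{|I|}\int_If(i\tau)\,d\tau\big|\,dt<\infty$,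 where the supremum is over all finite intervals $I\subset\mathbb{R}$ and $f(it):=\lim_{\sigma\to0^+}f(\sigma+it)$ (which exists for a.e. $t$). $\mathrm{BMOA}\cap\mathcal{D}$ is the space of functions in $\mathrm{BMOA}$ that are represented by a Dirichlet series convergent in some half-plane. *)

theory Defs
  imports "HOL-Probability.Probability" "HOL-Complex_Analysis.Complex_Analysis"
    "HOL-Computational_Algebra.Primes"
begin

definition prime_count_in :: "nat set \<Rightarrow> real \<Rightarrow> nat" where
  "prime_count_in P x = card {p \<in> P. real p \<le> x}"

definition thin_integrand :: "nat set \<Rightarrow> real \<Rightarrow> real" where
  "thin_integrand P x = real (prime_count_in P x) * ln (ln x) / (x * ln x ^ 3)"

(* The integrand is nonnegative on {3..}, so Lebesgue integrability is the same as
   finiteness of the (improper) integral. *)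
definition ultra_thin :: "nat set \<Rightarrow> bool" where
  "ultra_thin P \<longleftrightarrow> set_integrable lborel {3..} (thin_integrand P)"

(* The value at 0 is a dummy; the sequence is indexed from 1. *)
definition weight_seq :: "nat set \<Rightarrow> nat \<Rightarrow> real" where
  "weight_seq P n = (if n < 3 then 1 else (LINT x:{real n..}|lborel. thin_integrand P x))"

definition smooth_numbers :: "nat set \<Rightarrow> nat set" where
  "smooth_numbers P = {n. n > 0 \<and> prime_factors n \<subseteq> P}"

definition dirichlet_represents :: "(nat \<Rightarrow> complex) \<Rightarrow> (complex \<Rightarrow> complex) \<Rightarrow> bool" where
  "dirichlet_represents a f \<longleftrightarrow>
     (\<exists>\<sigma>0::real. \<forall>s. Re s > \<sigma>0 \<longrightarrow>
        (\<lambda>n. a (Suc n) * of_nat (Suc n) powr (- s)) sums f s)"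

definition Dirichlet_class :: "(complex \<Rightarrow> complex) set" where
  "Dirichlet_class = {f. \<exists>a. dirichlet_represents a f}"

(* The limit exists for almost every t when f satisfies the square-integrability condition
   in BMOA (Fatou); on the exceptional null set the value of Lim is immaterial. *)
definition boundary_fun :: "(complex \<Rightarrow> complex) \<Rightarrow> real \<Rightarrow> complex" where
  "boundary_fun f t = Lim (at_right 0) (\<lambda>\<sigma>. f (Complex \<sigma> t))"

definition interval_mean :: "(real \<Rightarrow> complex) \<Rightarrow> real \<Rightarrow> real \<Rightarrow> complex" where
  "interval_mean g u v = (LINT t:{u..v}|lborel. g t) / of_real (v - u)"

(* Valued in [0, \<infinity>].  If g is Borel but not integrable on {u..v}, the Bochner integral in
   interval_mean is 0 and the oscillation over {u..v} is \<infinity>, so a finite seminorm forces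
   local integrability. *)
definition BMO_seminorm :: "(real \<Rightarrow> complex) \<Rightarrow> ennreal" where
  "BMO_seminorm g =
     (SUP (u, v) \<in> {(u, v). u < v}.
        (\<integral>\<^sup>+ t \<in> {u..v}. ennreal (cmod (g t - interval_mean g u v)) \<partial>lborel) / ennreal (v - u))"

(* Elements are total functions; only their values on the right half-plane matter. *)
definition BMOA :: "(complex \<Rightarrow> complex) set" where
  "BMOA = {f. f holomorphic_on {s. Re s > 0} \<and>
     (SUP \<sigma> \<in> {0<..}. \<integral>\<^sup>+ t. ennreal ((cmod (f (Complex \<sigma> t)))\<^sup>2 / (1 + \<sigma>\<^sup>2 + t\<^sup>2)) \<partial>lborel) < \<infinity> \<and>
     BMO_seminorm (boundary_fun f) < \<infinity>}"

definition rademacher_family :: "'a measure \<Rightarrow> nat set \<Rightarrow> (nat \<Rightarrow> 'a \<Rightarrow> real) \<Rightarrow> bool" where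
  "rademacher_family M I \<epsilon> \<longleftrightarrow>
     prob_space.indep_vars M (\<lambda>_. borel) \<epsilon> I \<and>
     (\<forall>n\<in>I. measure M {\<omega> \<in> space M. \<epsilon> n \<omega> = 1} = 1 / 2 \<and>
            measure M {\<omega> \<in> space M. \<epsilon> n \<omega> = - 1} = 1 / 2)"

definition random_coeff ::
    "nat set \<Rightarrow> (nat \<Rightarrow> complex) \<Rightarrow> (nat \<Rightarrow> 'a \<Rightarrow> real) \<Rightarrow> 'a \<Rightarrow> nat \<Rightarrow> complex" where
  "random_coeff N a \<epsilon> \<omega> n = (if n \<in> N then of_real (\<epsilon> n \<omega>) * a n else 0)"

end

theory Submission
  imports Defs
begin

text \<open>
  For a function $f$ with $|f'(s)| \<le> m_k$ on $\mathrm{Re}\, s \<ge> 2^{-k-1}$ and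
  $\sum_k 4^{-k} m_k^2 < \infty$, Taylor's formula in $\sigma$ applied to $|f(\sigma + it) - c|^2$,
  whose Laplacian is $4|f'|^2$, bounds the mean square of $f - c$ over every interval of a vertical line
  near the boundary; so $f$ is in BMOA as soon as its radial limits exist almost everywhere.

  For the random series take for $m_k$ a bound of $|f_\omega'|$ on all of $\mathrm{Re}\, s \<ge> 2^{-k-1}$.
  The part of $f_\omega'$ with $n \<le> x_j = e^{2^j}$ is a polynomial in the variables $p^{-s}$ with
  $p \<le> x_j$ in $\mathcal{P}_0$, of degree at most $2^{j+1}$ in each of them, hence its supremum is
  controlled by its values on a grid in the torus whose cardinality has logarithm
  $O((j+1)\, \pi_0(x_j))$. The sub-Gaussian maximal inequality over the grid makes the expected square of the
  supremum at most $O((j+1)\, \pi_0(x_j)) \sum |a_n|^2 \log^2 n\; n^{-2\sigma}$, and summing over the scales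
  reproduces $\sum_{k \<ge> J} 4^{-k} (k+1)\, \pi_0(x_k)$ for $n$ of size $x_J$, which is comparable to $w_n$.

  At a fixed point no supremum is needed, and the factor $k+1$ is left over to prove almost everywhere
  convergence of the radial limits: it controls the oscillation of $f(2^{-j} + it)$ for $2^k \<le> j < 2^{k+1}$,
  while along $\sigma = 2^{-2^k}$ the increments are summable.
\<close>

subsection \<open>Boundary values and the square function of a function on the half-plane\<close>

text \<open>Summability of \<open>(m k)\<^sup>2 / 4 ^ k\<close> is the dyadic form of finiteness of
  the integral of \<sigma> sup_t |f'(\<sigma> + it)|^2 over 0 < \<sigma> < 1. Taking the supremum
  over t outright replaces a Carleson condition, which concerns uncountably many intervals at once,
  by countably many random majorants. The price is the logarithm of the grid size. With Q points in
  each of d = \<pi>_0(x_j) variables the grid has Q^d points, and the d-fold product of one-variable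
  losses stays bounded once Q is about 4^j d. Ultra-thinness gives d = O(4^j), so log Q = O(j + 1);
  this j + 1 is the log log of the weight at x_j. The seminorm in \<open>BMOA\<close> is evaluated
  on radial limits, so their existence almost everywhere must be settled separately. Summable
  squares of the increments between dyadic heights do not make the increments themselves summable,
  which is why an extra factor of Rademacher-Menshov type is needed there. That part works at each
  fixed t and is transferred to almost every t by Tonelli.\<close>

lemma tendsto_at_right_0_iff_Cauchy:
  fixes g :: "real \<Rightarrow> complex"
  shows "(\<exists>l. (g \<longlongrightarrow> l) (at_right 0)) \<longleftrightarrow>
    (\<forall>k. \<exists>m. \<forall>x\<in>{0<..<1 / real (Suc m)}. \<forall>y\<in>{0<..<1 / real (Suc m)}. dist (g x) (g y) \<le> 1 / real (Suc k))"
    (is "?L \<longleftrightarrow> ?R")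
proof
  assume ?L
  then obtain l where l: "(g \<longlongrightarrow> l) (at_right 0)" by blast
  show ?R
  proof
    fix k
    have "eventually (\<lambda>x. dist (g x) l < 1 / real (Suc k) / 2) (at_right 0)"
      by (rule tendstoD[OF l]) simp
    then obtain b where b: "b > 0" "\<And>x. 0 < x \<Longrightarrow> x < b \<Longrightarrow> dist (g x) l < 1 / real (Suc k) / 2"
      unfolding eventually_at_right_field by auto
    obtain m where m: "1 / real (Suc m) < b"
      using reals_Archimedean[OF b(1)] by (auto simp: inverse_eq_divide)
    show "\<exists>m. \<forall>x\<in>{0<..<1 / real (Suc m)}. \<forall>y\<in>{0<..<1 / real (Suc m)}. dist (g x) (g y) \<le> 1 / real (Suc k)"
    proof (intro exI[of _ m] ballI)
      fix x y assume "x \<in> {0<..<1 / real (Suc m)}" "y \<in> {0<..<1 / real (Suc m)}"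
      then have "dist (g x) l < 1 / real (Suc k) / 2" "dist (g y) l < 1 / real (Suc k) / 2"
        using b(2)[of x] b(2)[of y] m by auto
      then show "dist (g x) (g y) \<le> 1 / real (Suc k)"
        using dist_triangle_half_l[of "g x" l "1 / real (Suc k)" "g y"] by simp
    qed
  qed
next
  assume R: ?R
  have inv: "1 / real (Suc n) < 1 / real (Suc m)" if "n > m" for n m
    using that by (simp add: frac_less2)
  have "Cauchy (\<lambda>n. g (1 / real (Suc n)))"
  proof (rule metric_CauchyI)
    fix e :: real assume "e > 0"
    then obtain k where k: "1 / real (Suc k) < e"
      using reals_Archimedean by (auto simp: inverse_eq_divide)
    obtain m where m: "\<forall>x\<in>{0<..<1 / real (Suc m)}. \<forall>y\<in>{0<..<1 / real (Suc m)}. dist (g x) (g y) \<le> 1 / real (Suc k)"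
      using R by blast
    show "\<exists>M. \<forall>i\<ge>M. \<forall>n\<ge>M. dist (g (1 / real (Suc i))) (g (1 / real (Suc n))) < e"
    proof (intro exI[of _ "Suc m"] allI impI)
      fix i n assume "Suc m \<le> i" "Suc m \<le> n"
      then have "1 / real (Suc i) \<in> {0<..<1 / real (Suc m)}" "1 / real (Suc n) \<in> {0<..<1 / real (Suc m)}"
        using inv[of m i] inv[of m n] by auto
      then have "dist (g (1 / real (Suc i))) (g (1 / real (Suc n))) \<le> 1 / real (Suc k)"
        using m by blast
      then show "dist (g (1 / real (Suc i))) (g (1 / real (Suc n))) < e" using k by simp
    qed
  qed
  then obtain l where l: "(\<lambda>n. g (1 / real (Suc n))) \<longlonglongrightarrow> l"
    using Cauchy_convergent_iff convergent_def by blast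
  have "(g \<longlongrightarrow> l) (at_right 0)"
  proof (rule tendstoI)
    fix e :: real assume "e > 0"
    then obtain k where k: "1 / real (Suc k) < e / 2"
      using reals_Archimedean[of "e / 2"] by (auto simp: inverse_eq_divide)
    obtain m where m: "\<forall>x\<in>{0<..<1 / real (Suc m)}. \<forall>y\<in>{0<..<1 / real (Suc m)}. dist (g x) (g y) \<le> 1 / real (Suc k)"
      using R by blast
    have ev: "eventually (\<lambda>n. dist (g (1 / real (Suc n))) l < e / 2 \<and> n > m) sequentially"
      using tendstoD[OF l, of "e / 2"] \<open>e > 0\<close> eventually_gt_at_top[of m] by (intro eventually_conj) simp_all
    then obtain n where n: "dist (g (1 / real (Suc n))) l < e / 2" "n > m"
      using eventually_happens'[OF sequentially_bot ev] by blast
    have "dist (g x) l < e" if x: "0 < x" "x < 1 / real (Suc m)" for x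
    proof -
      have "dist (g x) (g (1 / real (Suc n))) \<le> 1 / real (Suc k)"
        using m x inv[OF n(2)] by auto
      then show ?thesis using k n(1) dist_triangle[of "g x" l "g (1 / real (Suc n))"] by simp
    qed
    then show "\<forall>\<^sub>F x in at_right 0. dist (g x) l < e"
      unfolding eventually_at_right_field by (intro exI[of _ "1 / real (Suc m)"]) auto
  qed
  then show ?L by blast
qed

lemma continuous_on_Complex: "continuous_on S (\<lambda>t. Complex \<sigma> t)" "continuous_on S (\<lambda>\<sigma>. Complex \<sigma> t)"
  unfolding Complex_eq by (intro continuous_intros)+

lemma boundary_fun_eq: "((\<lambda>\<sigma>. f (Complex \<sigma> t)) \<longlongrightarrow> l) (at_right 0) \<Longrightarrow> boundary_fun f t = l"
  unfolding boundary_fun_def by (rule tendsto_Lim) auto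

text \<open>Needed because the seminorm integrates \<open>boundary_fun f\<close>. In the Cauchy form
  of convergence only k and m require countable operations; for fixed k and m the intersection over
  the uncountably many x and y is again closed, since each condition is closed in t.\<close>

lemma borel_measurable_boundary_fun:
  assumes "f holomorphic_on {s. Re s > 0}"
  shows "boundary_fun f \<in> borel_measurable borel"
proof -
  have cont: "continuous_on {s. Re s > 0} f"
    using assms by (rule holomorphic_on_imp_continuous_on)
  have ct: "continuous_on UNIV (\<lambda>t. f (Complex \<sigma> t))" if "\<sigma> > 0" for \<sigma>
    by (rule continuous_on_compose2[OF cont continuous_on_Complex(1)]) (use that in auto)
  define C where "C = {t. \<exists>l. ((\<lambda>\<sigma>. f (Complex \<sigma> t)) \<longlongrightarrow> l) (at_right 0)}"
  have C_eq: "C = (\<Inter>k. \<Union>m. \<Inter>x\<in>{0<..<1 / real (Suc m)}. \<Inter>y\<in>{0<..<1 / real (Suc m)}.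
      {t. dist (f (Complex x t)) (f (Complex y t)) \<le> 1 / real (Suc k)})"
    unfolding C_def tendsto_at_right_0_iff_Cauchy by (rule set_eqI) simp
  have "closed {t. dist (f (Complex x t)) (f (Complex y t)) \<le> 1 / real (Suc k)}" if "x > 0" "y > 0" for x y k
    by (intro closed_Collect_le continuous_intros ct that)
  then have C[measurable]: "C \<in> sets borel"
    unfolding C_eq
    by (intro sets.countable_INT' countableI_type image_subsetI sets.countable_UN borel_closed closed_INT ballI UNIV_not_empty)
      (auto simp del: of_nat_Suc)
  define L where "L t = lim (\<lambda>n. f (Complex (1 / real (Suc n)) t))" for t
  have [measurable]: "L \<in> borel_measurable borel"
    unfolding L_def by (intro borel_measurable_lim_metric borel_measurable_continuous_onI ct) simp
  have "boundary_fun f t = (if t \<in> C then L t else (THE x. False))" for t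
  proof (cases "t \<in> C")
    case True
    then obtain l where l: "((\<lambda>\<sigma>. f (Complex \<sigma> t)) \<longlongrightarrow> l) (at_right 0)" by (auto simp: C_def)
    have "filterlim (\<lambda>n. 1 / real (Suc n)) (at_right 0) sequentially"
      unfolding filterlim_at using LIMSEQ_Suc[OF lim_1_over_n] by auto
    from filterlim_compose[OF l this] have "L t = l"
      unfolding L_def by (intro limI)
    with True boundary_fun_eq[OF l] show ?thesis by simp
  next
    case False
    \<comment> \<open>\<open>Lim\<close> is then \<open>THE\<close> of the empty predicate, the same value for all such \<open>t\<close>.\<close>
    then have "((\<lambda>\<sigma>. f (Complex \<sigma> t)) \<longlongrightarrow> l) (at_right 0) = False" for l
      by (auto simp: C_def)
    then show ?thesis using False unfolding boundary_fun_def Topological_Spaces.Lim_def by simp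
  qed
  then show ?thesis by (subst measurable_cong[where g = "\<lambda>t. if t \<in> C then L t else (THE x. False)"]) auto
qed

section \<open>Green's formula for the mean square on vertical segments\<close>

lemma has_vector_derivative_Complex_left:
  assumes "(f has_field_derivative f') (at (Complex \<sigma> t))"
  shows "((\<lambda>\<sigma>. f (Complex \<sigma> t)) has_vector_derivative f') (at \<sigma> within S)"
proof -
  have "((\<lambda>\<sigma>. Complex \<sigma> t) has_vector_derivative 1) (at \<sigma>)"
    unfolding Complex_eq by (auto intro!: derivative_eq_intros)
  from field_vector_diff_chain_at[OF this assms] show ?thesis
    by (auto simp: o_def intro: has_vector_derivative_at_within)
qed

lemma has_vector_derivative_Complex_right:
  assumes "(f has_field_derivative f') (at (Complex \<sigma> t))"
  shows "((\<lambda>t. f (Complex \<sigma> t)) has_vector_derivative \<i> * f') (at t within S)"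
proof -
  have "((\<lambda>t. Complex \<sigma> t) has_vector_derivative \<i>) (at t)"
    unfolding Complex_eq by (auto intro!: derivative_eq_intros)
  from field_vector_diff_chain_at[OF this assms] show ?thesis
    by (auto simp: o_def intro: has_vector_derivative_at_within)
qed

text \<open>Second-order Taylor expansion at height h, with integral remainder, evaluated at
  \<delta> and integrated over t. The weight \<sigma> - \<delta> of the remainder vanishes at the
  bottom, so no derivative on the line Re s = \<delta> enters. The Laplacian turns the second
  \<sigma>-derivative into the area term with factor 4 minus a second t-derivative, which leaves
  values on the two horizontal edges t = u and t = v.\<close>

lemma mean_square_Green_formula:
  fixes f :: "complex \<Rightarrow> complex"
  assumes hol: "f holomorphic_on {s. Re s > 0}" and d: "0 < \<delta>" "\<delta> \<le> h" and uv: "u \<le> v"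
  shows "integral {u..v} (\<lambda>t. (cmod (f (Complex \<delta> t)))\<^sup>2) =
      integral {u..v} (\<lambda>t. (cmod (f (Complex h t)))\<^sup>2)
    - integral {u..v} (\<lambda>t. (h - \<delta>) * (2 * Re (cnj (f (Complex h t)) * deriv f (Complex h t))))
    + integral {\<delta>..h} (\<lambda>\<sigma>. (\<sigma> - \<delta>) * (4 * integral {u..v} (\<lambda>t. (cmod (deriv f (Complex \<sigma> t)))\<^sup>2)
        + 2 * (Im (cnj (f (Complex \<sigma> v)) * deriv f (Complex \<sigma> v))
             - Im (cnj (f (Complex \<sigma> u)) * deriv f (Complex \<sigma> u)))))"
proof -
  let ?H = "{s. Re s > 0}"
  have op: "open ?H" by (rule open_halfspace_Re_gt)
  define f1 where "f1 = deriv f"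
  define f2 where "f2 = deriv f1"
  have h1: "f1 holomorphic_on ?H" unfolding f1_def by (rule holomorphic_deriv[OF hol op])
  have h2: "f2 holomorphic_on ?H" unfolding f2_def by (rule holomorphic_deriv[OF h1 op])
  have df: "(f has_field_derivative f1 s) (at s)" if "Re s > 0" for s
    unfolding f1_def by (rule holomorphic_derivI[OF hol op]) (use that in auto)
  have df1: "(f1 has_field_derivative f2 s) (at s)" if "Re s > 0" for s
    unfolding f2_def by (rule holomorphic_derivI[OF h1 op]) (use that in auto)
  note cts = holomorphic_on_imp_continuous_on[OF hol] holomorphic_on_imp_continuous_on[OF h1]
    holomorphic_on_imp_continuous_on[OF h2]
  have ct: "continuous_on {a..b} (\<lambda>t. g (Complex \<sigma> t))" if "\<sigma> > 0" "continuous_on ?H g" for \<sigma> a b and g :: "complex \<Rightarrow> complex"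
    by (rule continuous_on_compose2[OF that(2) continuous_on_Complex(1)]) (use that in auto)
  have cs: "continuous_on {\<delta>..h} (\<lambda>\<sigma>. g (Complex \<sigma> t))" if "continuous_on ?H g" for t and g :: "complex \<Rightarrow> complex"
    by (rule continuous_on_compose2[OF that(1) continuous_on_Complex(2)]) (use d in auto)
  \<comment> \<open>\<open>D\<close> is the second \<open>\<sigma>\<close>-derivative of \<open>\<bar>f\<bar>\<^sup>2\<close>; by the Cauchy-Riemann equations it is \<open>4 \<bar>f'\<bar>\<^sup>2\<close> plus a \<open>t\<close>-derivative.\<close>
  define D where "D \<sigma> t = 2 * (cmod (f1 (Complex \<sigma> t)))\<^sup>2 + 2 * Re (cnj (f (Complex \<sigma> t)) * f2 (Complex \<sigma> t))" for \<sigma> t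
  define \<psi> where "\<psi> \<sigma> t = (cmod (f (Complex \<sigma> t)))\<^sup>2" for \<sigma> t
  define \<psi>1 where "\<psi>1 \<sigma> t = 2 * Re (cnj (f (Complex \<sigma> t)) * f1 (Complex \<sigma> t))" for \<sigma> t
  have taylor: "((\<lambda>\<sigma>. (\<sigma> - \<delta>) * D \<sigma> t) has_integral (((h - \<delta>) * \<psi>1 h t - \<psi> h t) - ((\<delta> - \<delta>) * \<psi>1 \<delta> t - \<psi> \<delta> t))) {\<delta>..h}" for t
  proof (rule fundamental_theorem_of_calculus[OF d(2)])
    fix \<sigma> assume s: "\<sigma> \<in> {\<delta>..h}"
    then have pos: "Re (Complex \<sigma> t) > 0" using d by auto
    note v0 = has_vector_derivative_Complex_left[OF df[OF pos], of "{\<delta>..h}"]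
    note v1 = has_vector_derivative_Complex_left[OF df1[OF pos], of "{\<delta>..h}"]
    have p0: "((\<lambda>\<sigma>. \<psi> \<sigma> t) has_real_derivative \<psi>1 \<sigma> t) (at \<sigma> within {\<delta>..h})"
    proof -
      have "((\<lambda>\<sigma>. Re (cnj (f (Complex \<sigma> t)) * f (Complex \<sigma> t))) has_vector_derivative
          Re (cnj (f (Complex \<sigma> t)) * f1 (Complex \<sigma> t) + cnj (f1 (Complex \<sigma> t)) * f (Complex \<sigma> t)))
          (at \<sigma> within {\<delta>..h})"
        by (rule bounded_linear.has_vector_derivative[OF bounded_linear_Re]
             has_vector_derivative_mult[OF has_vector_derivative_cnj[OF v0] v0])+
      moreover have "(\<lambda>\<sigma>. Re (cnj (f (Complex \<sigma> t)) * f (Complex \<sigma> t))) = (\<lambda>\<sigma>. \<psi> \<sigma> t)"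
        unfolding \<psi>_def by (rule ext) (simp only: cmod_power2, simp add: power2_eq_square)
      moreover have "Re (cnj (f (Complex \<sigma> t)) * f1 (Complex \<sigma> t) + cnj (f1 (Complex \<sigma> t)) * f (Complex \<sigma> t)) = \<psi>1 \<sigma> t"
        unfolding \<psi>1_def by (simp add: algebra_simps)
      ultimately show ?thesis by (simp add: has_real_derivative_iff_has_vector_derivative)
    qed
    have p1: "((\<lambda>\<sigma>. \<psi>1 \<sigma> t) has_real_derivative D \<sigma> t) (at \<sigma> within {\<delta>..h})"
    proof -
      have "((\<lambda>\<sigma>. Re (cnj (f (Complex \<sigma> t)) * f1 (Complex \<sigma> t))) has_vector_derivative
          Re (cnj (f (Complex \<sigma> t)) * f2 (Complex \<sigma> t) + cnj (f1 (Complex \<sigma> t)) * f1 (Complex \<sigma> t)))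
          (at \<sigma> within {\<delta>..h})"
        by (rule bounded_linear.has_vector_derivative[OF bounded_linear_Re]
             has_vector_derivative_mult[OF has_vector_derivative_cnj[OF v0] v1])+
      then have "((\<lambda>\<sigma>. 2 * Re (cnj (f (Complex \<sigma> t)) * f1 (Complex \<sigma> t))) has_real_derivative
          2 * Re (cnj (f (Complex \<sigma> t)) * f2 (Complex \<sigma> t) + cnj (f1 (Complex \<sigma> t)) * f1 (Complex \<sigma> t)))
          (at \<sigma> within {\<delta>..h})"
        by (intro DERIV_cmult) (simp add: has_real_derivative_iff_has_vector_derivative)
      moreover have "2 * Re (cnj (f (Complex \<sigma> t)) * f2 (Complex \<sigma> t) + cnj (f1 (Complex \<sigma> t)) * f1 (Complex \<sigma> t)) = D \<sigma> t"
        unfolding D_def by (simp only: cmod_power2) (simp add: power2_eq_square algebra_simps)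
      ultimately show ?thesis unfolding \<psi>1_def by simp
    qed
    show "((\<lambda>\<sigma>. (\<sigma> - \<delta>) * \<psi>1 \<sigma> t - \<psi> \<sigma> t) has_vector_derivative (\<sigma> - \<delta>) * D \<sigma> t) (at \<sigma> within {\<delta>..h})"
      unfolding has_real_derivative_iff_has_vector_derivative[symmetric]
      by (rule derivative_eq_intros p0 p1 refl)+ (simp add: algebra_simps)
  qed
  \<comment> \<open>On a vertical line the t-derivative of |f|^2 is -2 Im (cnj f f'), so the
    integral of minus the second t-derivative is a difference of endpoint values.\<close>
  have green: "((\<lambda>t. D \<sigma> t - 4 * (cmod (f1 (Complex \<sigma> t)))\<^sup>2) has_integral
     (2 * Im (cnj (f (Complex \<sigma> v)) * f1 (Complex \<sigma> v)) - 2 * Im (cnj (f (Complex \<sigma> u)) * f1 (Complex \<sigma> u)))) {u..v}"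
    if s: "\<sigma> \<in> {\<delta>..h}" for \<sigma>
  proof (rule fundamental_theorem_of_calculus[OF uv])
    fix t
    have pos: "Re (Complex \<sigma> t) > 0" using s d by auto
    note v0 = has_vector_derivative_Complex_right[OF df[OF pos], of "{u..v}"]
    note v1 = has_vector_derivative_Complex_right[OF df1[OF pos], of "{u..v}"]
    have "((\<lambda>t. Im (cnj (f (Complex \<sigma> t)) * f1 (Complex \<sigma> t))) has_vector_derivative
          Im (cnj (f (Complex \<sigma> t)) * (\<i> * f2 (Complex \<sigma> t)) + cnj (\<i> * f1 (Complex \<sigma> t)) * f1 (Complex \<sigma> t)))
          (at t within {u..v})"
      by (rule bounded_linear.has_vector_derivative[OF bounded_linear_Im]
             has_vector_derivative_mult[OF has_vector_derivative_cnj[OF v0] v1])+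
    then have "((\<lambda>t. 2 * Im (cnj (f (Complex \<sigma> t)) * f1 (Complex \<sigma> t))) has_real_derivative
          2 * Im (cnj (f (Complex \<sigma> t)) * (\<i> * f2 (Complex \<sigma> t)) + cnj (\<i> * f1 (Complex \<sigma> t)) * f1 (Complex \<sigma> t)))
          (at t within {u..v})"
      by (intro DERIV_cmult) (simp add: has_real_derivative_iff_has_vector_derivative)
    moreover have "2 * Im (cnj (f (Complex \<sigma> t)) * (\<i> * f2 (Complex \<sigma> t)) + cnj (\<i> * f1 (Complex \<sigma> t)) * f1 (Complex \<sigma> t))
        = D \<sigma> t - 4 * (cmod (f1 (Complex \<sigma> t)))\<^sup>2"
      unfolding D_def by (simp only: cmod_power2) (simp add: power2_eq_square algebra_simps)
    ultimately show "((\<lambda>t. 2 * Im (cnj (f (Complex \<sigma> t)) * f1 (Complex \<sigma> t))) has_vector_derivative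
          D \<sigma> t - 4 * (cmod (f1 (Complex \<sigma> t)))\<^sup>2) (at t within {u..v})"
      unfolding has_real_derivative_iff_has_vector_derivative[symmetric] by simp
  qed
  have i1: "(\<lambda>t. (cmod (f1 (Complex \<sigma> t)))\<^sup>2) integrable_on {u..v}" if "\<sigma> > 0" for \<sigma>
    by (intro integrable_continuous_real continuous_intros ct cts that)
  have inner: "integral {u..v} (\<lambda>t. D \<sigma> t) = 4 * integral {u..v} (\<lambda>t. (cmod (f1 (Complex \<sigma> t)))\<^sup>2)
        + 2 * (Im (cnj (f (Complex \<sigma> v)) * f1 (Complex \<sigma> v))
             - Im (cnj (f (Complex \<sigma> u)) * f1 (Complex \<sigma> u)))" if s: "\<sigma> \<in> {\<delta>..h}" for \<sigma>
  proof -
    have "\<sigma> > 0" using s d by auto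
    have "((\<lambda>t. (D \<sigma> t - 4 * (cmod (f1 (Complex \<sigma> t)))\<^sup>2) + 4 * (cmod (f1 (Complex \<sigma> t)))\<^sup>2) has_integral
      (2 * Im (cnj (f (Complex \<sigma> v)) * f1 (Complex \<sigma> v)) - 2 * Im (cnj (f (Complex \<sigma> u)) * f1 (Complex \<sigma> u)))
       + 4 * integral {u..v} (\<lambda>t. (cmod (f1 (Complex \<sigma> t)))\<^sup>2)) {u..v}"
      by (intro has_integral_add green[OF s] has_integral_mult_right integrable_integral i1 \<open>\<sigma> > 0\<close>)
    then have "((\<lambda>t. D \<sigma> t) has_integral
      (2 * Im (cnj (f (Complex \<sigma> v)) * f1 (Complex \<sigma> v)) - 2 * Im (cnj (f (Complex \<sigma> u)) * f1 (Complex \<sigma> u)))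
       + 4 * integral {u..v} (\<lambda>t. (cmod (f1 (Complex \<sigma> t)))\<^sup>2)) {u..v}" by simp
    then show ?thesis by (simp add: integral_unique algebra_simps)
  qed
  have cC: "continuous_on (cbox (u, \<delta>) (v, h)) (\<lambda>p. g (Complex (snd p) (fst p)))" if "continuous_on ?H g" for g :: "complex \<Rightarrow> complex"
  proof (rule continuous_on_compose2[OF that])
    show "continuous_on (cbox (u, \<delta>) (v, h)) (\<lambda>p. Complex (snd p) (fst p))"
      unfolding Complex_eq by (intro continuous_intros)
  qed (use d in \<open>auto simp: cbox_Pair_eq\<close>)
  have "continuous_on (cbox (u, \<delta>) (v, h)) (\<lambda>(t, \<sigma>). (\<sigma> - \<delta>) * D \<sigma> t)"
    unfolding D_def case_prod_beta by (intro continuous_intros cC cts)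
  from integral_swap_continuous[OF this]
  have swap: "integral {u..v} (\<lambda>t. integral {\<delta>..h} (\<lambda>\<sigma>. (\<sigma> - \<delta>) * D \<sigma> t)) =
      integral {\<delta>..h} (\<lambda>\<sigma>. integral {u..v} (\<lambda>t. (\<sigma> - \<delta>) * D \<sigma> t))" by simp
  have t: "\<psi> \<delta> t = \<psi> h t - (h - \<delta>) * \<psi>1 h t + integral {\<delta>..h} (\<lambda>\<sigma>. (\<sigma> - \<delta>) * D \<sigma> t)" for t
    using integral_unique[OF taylor[of t]] by simp
  have i2: "(\<lambda>t. integral {\<delta>..h} (\<lambda>\<sigma>. (\<sigma> - \<delta>) * D \<sigma> t)) integrable_on {u..v}"
  proof -
    have "(\<lambda>t. integral {\<delta>..h} (\<lambda>\<sigma>. (\<sigma> - \<delta>) * D \<sigma> t)) = (\<lambda>t. \<psi> \<delta> t - \<psi> h t + (h - \<delta>) * \<psi>1 h t)"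
      using t by (auto simp: fun_eq_iff)
    then show ?thesis unfolding \<psi>_def \<psi>1_def using d
      by (auto intro!: integrable_continuous_real continuous_intros ct cts)
  qed
  have i3: "\<psi> h integrable_on {u..v}" "(\<lambda>t. (h - \<delta>) * \<psi>1 h t) integrable_on {u..v}"
    unfolding \<psi>_def \<psi>1_def using d by (auto intro!: integrable_continuous_real continuous_intros ct cts)
  have "integral {u..v} (\<psi> \<delta>) = integral {u..v} (\<lambda>t. \<psi> h t - (h - \<delta>) * \<psi>1 h t + integral {\<delta>..h} (\<lambda>\<sigma>. (\<sigma> - \<delta>) * D \<sigma> t))"
    using t by (intro integral_cong) auto
  also have "\<dots> = integral {u..v} (\<psi> h) - integral {u..v} (\<lambda>t. (h - \<delta>) * \<psi>1 h t)
     + integral {\<delta>..h} (\<lambda>\<sigma>. integral {u..v} (\<lambda>t. (\<sigma> - \<delta>) * D \<sigma> t))"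
    by (subst integral_add, intro integrable_diff i3, rule i2, subst integral_diff, (rule i3)+, simp add: swap)
  also have "integral {\<delta>..h} (\<lambda>\<sigma>. integral {u..v} (\<lambda>t. (\<sigma> - \<delta>) * D \<sigma> t)) =
    integral {\<delta>..h} (\<lambda>\<sigma>. (\<sigma> - \<delta>) * (4 * integral {u..v} (\<lambda>t. (cmod (f1 (Complex \<sigma> t)))\<^sup>2)
        + 2 * (Im (cnj (f (Complex \<sigma> v)) * f1 (Complex \<sigma> v))
             - Im (cnj (f (Complex \<sigma> u)) * f1 (Complex \<sigma> u)))))"
    by (intro integral_cong) (simp add: inner)
  finally show ?thesis unfolding \<psi>_def \<psi>1_def f1_def .
qed

section \<open>Consequences of derivative bounds on the half-planes Re s \<ge> 2^(-k-1)\<close>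

lemma dyadic_scale:
  fixes \<sigma> :: real assumes "0 < \<sigma>" "\<sigma> \<le> 1"
  obtains k where "1 / 2 ^ Suc k < \<sigma>" "\<sigma> \<le> 1 / 2 ^ k"
proof -
  define n where "n = (LEAST n. (1/2::real) ^ n < \<sigma>)"
  obtain N where "(1/2::real) ^ N < \<sigma>" using real_arch_pow_inv[of \<sigma> "1/2"] assms by auto
  then have n: "(1/2::real) ^ n < \<sigma>" unfolding n_def by (rule LeastI)
  then have "n \<noteq> 0" using assms by (intro notI) simp
  then obtain k where k: "n = Suc k" using not0_implies_Suc by blast
  then have "\<not> (1/2::real) ^ k < \<sigma>" using not_less_Least[of k "\<lambda>n. (1/2::real) ^ n < \<sigma>"] by (simp add: n_def)
  then show thesis using that[of k] n k by (simp add: power_one_over)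
qed

text \<open>No integrability is required, since \<open>integral\<close> of a non-integrable function
  is 0.\<close>

lemma integral_nonneg_of_nonneg:
  fixes g :: "'a::euclidean_space \<Rightarrow> real"
  assumes "\<And>x. g x \<ge> 0" shows "integral S g \<ge> 0"
  using assms by (cases "g integrable_on S") (auto intro: integral_nonneg simp: not_integrable_integral)

context
  fixes f :: "complex \<Rightarrow> complex" and m :: "nat \<Rightarrow> real"
  assumes hol: "f holomorphic_on {s. Re s > 0}"
    and m: "\<And>k s. Re s \<ge> 1 / 2 ^ Suc k \<Longrightarrow> cmod (deriv f s) \<le> m k"
    and sm: "summable (\<lambda>k. (m k)\<^sup>2 / 4 ^ k)"
begin

lemma deriv_bound_nonneg: "m k \<ge> 0"
  using m[of k "of_real (1 / 2 ^ Suc k)"] by (rule order_trans[OF norm_ge_zero]) simp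

lemma suminf_deriv_bound_nonneg: "(\<Sum>k. (m k)\<^sup>2 / 4 ^ k) \<ge> 0"
  by (rule suminf_nonneg[OF sm]) simp

text \<open>A Bloch condition: for 2^(-k-1) < Re s \<le> 2^(-k) the left side is at most m k / 2^k,
  the square root of a single term of the convergent series.\<close>

lemma deriv_le_inverse_Re:
  assumes "0 < Re s" "Re s \<le> 1"
  shows "Re s * cmod (deriv f s) \<le> sqrt (\<Sum>k. (m k)\<^sup>2 / 4 ^ k)"
proof -
  obtain k where k: "1 / 2 ^ Suc k < Re s" "Re s \<le> 1 / 2 ^ k" using dyadic_scale assms by blast
  have "Re s * cmod (deriv f s) \<le> 1 / 2 ^ k * m k"
    using k m[of k s] by (intro mult_mono) auto
  also have "\<dots> = sqrt ((m k)\<^sup>2 / 4 ^ k)"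
    using deriv_bound_nonneg[of k] real_sqrt_power[of 4 k]
    by (simp add: real_sqrt_divide)
  also have "\<dots> \<le> sqrt (\<Sum>k. (m k)\<^sup>2 / 4 ^ k)"
    using sum_le_suminf[OF sm, of "{k}"] by simp
  finally show ?thesis .
qed

lemma continuous_on_mean_square_deriv:
  assumes "0 < a"
  shows "continuous_on {a..b} (\<lambda>\<sigma>. integral {u..v} (\<lambda>t. (cmod (deriv f (Complex \<sigma> t)))\<^sup>2))"
proof -
  have op: "open {s. Re s > 0}" by (rule open_halfspace_Re_gt)
  have c: "continuous_on {s. Re s > 0} (deriv f)"
    by (intro holomorphic_on_imp_continuous_on holomorphic_deriv hol op)
  have "continuous_on ({a..b} \<times> {u..v}) (\<lambda>p. deriv f (Complex (fst p) (snd p)))"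
  proof (rule continuous_on_compose2[OF c])
    show "continuous_on ({a..b} \<times> {u..v}) (\<lambda>p. Complex (fst p) (snd p))"
      unfolding Complex_eq by (intro continuous_intros)
  qed (use assms in auto)
  then have "continuous_on ({a..b} \<times> cbox u v) (\<lambda>(\<sigma>, t). (cmod (deriv f (Complex \<sigma> t)))\<^sup>2)"
    unfolding case_prod_beta by (auto intro!: continuous_intros)
  from integral_continuous_on_param[OF this] show ?thesis by simp
qed

text \<open>The layer between a = 2^(-N-1) and b = 2^(-N) has width a and \<sigma> \<le> b there, so
  it contributes at most a b (m N)^2 per unit of t, and a b \<le> b^2 = 4^(-N).\<close>

lemma dyadic_area_bound:
  assumes "u \<le> v"
  shows "integral {1 / 2 ^ N..1} (\<lambda>\<sigma>. \<sigma> * integral {u..v} (\<lambda>t. (cmod (deriv f (Complex \<sigma> t)))\<^sup>2))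
      \<le> (v - u) * (\<Sum>k<N. (m k)\<^sup>2 / 4 ^ k)"
proof (induction N)
  case 0 then show ?case by simp
next
  case (Suc N)
  let ?G = "\<lambda>\<sigma>. integral {u..v} (\<lambda>t. (cmod (deriv f (Complex \<sigma> t)))\<^sup>2)"
  let ?g = "\<lambda>\<sigma>. \<sigma> * ?G \<sigma>"
  define a :: real where "a = 1 / 2 ^ Suc N"
  define b :: real where "b = 1 / 2 ^ N"
  have ab: "0 < a" "a \<le> b" "b \<le> 1" "b - a = a" "b = 2 * a" by (simp_all add: a_def b_def field_simps)
  have cg: "continuous_on {a..1} ?g"
    by (intro continuous_intros continuous_on_mean_square_deriv ab)
  have "?G \<sigma> \<le> (v - u) * (m N)\<^sup>2" if "\<sigma> \<in> {a..b}" for \<sigma>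
  proof -
    have "\<sigma> > 0" using that ab by auto
    have op: "open {s. Re s > 0}" by (rule open_halfspace_Re_gt)
    have "continuous_on {s. Re s > 0} (deriv f)"
      by (intro holomorphic_on_imp_continuous_on holomorphic_deriv hol op)
    then have "continuous_on {u..v} (\<lambda>t. deriv f (Complex \<sigma> t))"
      by (rule continuous_on_compose2[OF _ continuous_on_Complex(1)]) (use \<open>\<sigma> > 0\<close> in auto)
    then have "?G \<sigma> \<le> integral {u..v} (\<lambda>t. (m N)\<^sup>2)"
      using m[of N] that
      by (intro integral_le integrable_continuous_real continuous_intros power_mono) (auto simp: a_def)
    then show ?thesis using assms by simp
  qed
  then have "integral {a..b} ?g \<le> integral {a..b} (\<lambda>\<sigma>. b * ((v - u) * (m N)\<^sup>2))"
    using ab assms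
    by (intro integral_le integrable_continuous_real continuous_on_subset[OF cg] continuous_intros mult_mono
        integral_nonneg_of_nonneg) auto
  also have "\<dots> = (v - u) * (a * b * (m N)\<^sup>2)" using ab by simp
  also have "\<dots> \<le> (v - u) * ((m N)\<^sup>2 / 4 ^ N)"
  proof (intro mult_left_mono)
    have "a * b \<le> b * b" using ab by simp
    also have "b * b = 1 / 4 ^ N" unfolding b_def by (simp flip: power_mult_distrib)
    finally have "a * b * (m N)\<^sup>2 \<le> 1 / 4 ^ N * (m N)\<^sup>2" by (intro mult_right_mono) auto
    then show "a * b * (m N)\<^sup>2 \<le> (m N)\<^sup>2 / 4 ^ N" by simp
  qed (use assms in simp)
  finally have 1: "integral {a..b} ?g \<le> (v - u) * ((m N)\<^sup>2 / 4 ^ N)" .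
  have "integral {a..1} ?g = integral {a..b} ?g + integral {b..1} ?g"
    by (rule Henstock_Kurzweil_Integration.integral_combine[symmetric])
      (use ab cg in \<open>auto intro: integrable_continuous_real\<close>)
  with 1 Suc.IH show ?case unfolding a_def b_def by (simp add: distrib_left del: power_Suc)
qed

lemma area_bound:
  assumes "u \<le> v" "0 < \<delta>" "h \<le> 1"
  shows "integral {\<delta>..h} (\<lambda>\<sigma>. \<sigma> * integral {u..v} (\<lambda>t. (cmod (deriv f (Complex \<sigma> t)))\<^sup>2))
      \<le> (v - u) * (\<Sum>k. (m k)\<^sup>2 / 4 ^ k)"
proof -
  let ?g = "\<lambda>\<sigma>. \<sigma> * integral {u..v} (\<lambda>t. (cmod (deriv f (Complex \<sigma> t)))\<^sup>2)"
  obtain N where N: "(1/2::real) ^ N < \<delta>" using real_arch_pow_inv[of \<delta> "1/2"] assms by auto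
  have "integral {\<delta>..h} ?g \<le> integral {1 / 2 ^ N..1} ?g"
  proof (rule integral_subset_le)
    show "{\<delta>..h} \<subseteq> {1 / 2 ^ N..1}" using N assms by (auto simp: power_one_over)
    show "?g integrable_on {\<delta>..h}"
      by (intro integrable_continuous_real continuous_intros continuous_on_mean_square_deriv assms)
    show "?g integrable_on {1 / 2 ^ N..1}"
      by (intro integrable_continuous_real continuous_intros continuous_on_mean_square_deriv) simp
    show "\<forall>x\<in>{1 / 2 ^ N..1}. 0 \<le> ?g x"
    proof
      fix x :: real assume x: "x \<in> {1 / 2 ^ N..1}"
      have "0 < (1 / 2 ^ N :: real)" by simp
      with x have "x \<ge> 0" by (meson atLeastAtMost_iff less_imp_le order_trans)
      moreover have "integral {u..v} (\<lambda>t. (cmod (deriv f (Complex x t)))\<^sup>2) \<ge> 0"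
        by (rule integral_nonneg_of_nonneg) simp
      ultimately show "0 \<le> ?g x" by simp
    qed
  qed
  also have "\<dots> \<le> (v - u) * (\<Sum>k<N. (m k)\<^sup>2 / 4 ^ k)" by (rule dyadic_area_bound[OF assms(1)])
  also have "\<dots> \<le> (v - u) * (\<Sum>k. (m k)\<^sup>2 / 4 ^ k)"
    using assms by (intro mult_left_mono sum_le_suminf sm) auto
  finally show ?thesis .
qed

text \<open>Integrating the Bloch bound \<kappa> / x for the derivative. The resulting growth
  towards the boundary is only logarithmic, hence integrable; this is what keeps the edge terms of
  Green's formula bounded.\<close>

lemma norm_diff_le_ln_ratio:
  assumes "0 < \<sigma>" "\<sigma> \<le> h" "h \<le> 1"
  shows "cmod (f (Complex h t) - f (Complex \<sigma> t)) \<le> sqrt (\<Sum>k. (m k)\<^sup>2 / 4 ^ k) * (ln h - ln \<sigma>)"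
proof (cases "\<sigma> = h")
  case False
  define \<kappa> where "\<kappa> = sqrt (\<Sum>k. (m k)\<^sup>2 / 4 ^ k)"
  have op: "open {s. Re s > 0}" by (rule open_halfspace_Re_gt)
  have "cmod (f (Complex h t) - f (Complex \<sigma> t)) \<le> \<kappa> * ln h - \<kappa> * ln \<sigma>"
  proof (rule differentiable_bound_general[where f' = "\<lambda>x. deriv f (Complex x t)" and \<phi>' = "\<lambda>x. \<kappa> * (1 / x)"])
    show "\<sigma> < h" using False assms by simp
    show "continuous_on {\<sigma>..h} (\<lambda>\<sigma>. f (Complex \<sigma> t))"
      by (rule continuous_on_compose2[OF holomorphic_on_imp_continuous_on[OF hol] continuous_on_Complex(2)])
        (use assms in auto)
    show "continuous_on {\<sigma>..h} (\<lambda>\<sigma>. \<kappa> * ln \<sigma>)"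
      using assms by (intro continuous_intros) auto
    fix x assume x: "\<sigma> < x" "x < h"
    then show "((\<lambda>\<sigma>. f (Complex \<sigma> t)) has_vector_derivative deriv f (Complex x t)) (at x)"
      using assms by (intro has_vector_derivative_Complex_left holomorphic_derivI[OF hol op]) auto
    have "(ln has_vector_derivative 1 / x) (at x)"
      using x assms DERIV_ln_divide[of x] by (simp add: has_real_derivative_iff_has_vector_derivative)
    then show "((\<lambda>\<sigma>. \<kappa> * ln \<sigma>) has_vector_derivative \<kappa> * (1 / x)) (at x)"
      by (rule has_vector_derivative_mult_right)
    show "cmod (deriv f (Complex x t)) \<le> \<kappa> * (1 / x)"
      using deriv_le_inverse_Re[of "Complex x t"] x assms by (simp add: \<kappa>_def field_simps)
  qed
  then show ?thesis by (simp add: \<kappa>_def algebra_simps)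
qed simp

text \<open>With \<kappa> = sqrt K, each unit of length costs B^2 from the values at height h, 2 B
  \<kappa> from the first-order Taylor term, 4 K from the area term, and 4 B \<kappa> + 4 K from the
  two edges. The edge terms are proportional to h, and h \<le> v - u converts them into multiples of
  the length.\<close>

lemma mean_square_local_bound:
  assumes "0 < \<delta>" "\<delta> \<le> h" "h \<le> 1" "h \<le> v - u"
    and B: "\<And>t. t \<in> {u..v} \<Longrightarrow> cmod (f (Complex h t)) \<le> B"
  defines "K \<equiv> (\<Sum>k. (m k)\<^sup>2 / 4 ^ k)"
  shows "integral {u..v} (\<lambda>t. (cmod (f (Complex \<delta> t)))\<^sup>2) \<le> (v - u) * (B\<^sup>2 + 6 * B * sqrt K + 8 * K)"
proof -
  have uv: "u \<le> v" and h: "h > 0" using assms by auto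
  have B0: "B \<ge> 0" using B[of u] uv norm_ge_zero order_trans by (metis atLeastAtMost_iff order_refl)
  define \<kappa> where "\<kappa> = sqrt K"
  have K0: "K \<ge> 0" unfolding K_def by (rule suminf_deriv_bound_nonneg)
  have \<kappa>0: "\<kappa> \<ge> 0" and \<kappa>2: "\<kappa>\<^sup>2 = K" using K0 by (auto simp: \<kappa>_def)
  have op: "open {s. Re s > 0}" by (rule open_halfspace_Re_gt)
  have c0: "continuous_on {s. Re s > 0} f" by (intro holomorphic_on_imp_continuous_on hol)
  have c1: "continuous_on {s. Re s > 0} (deriv f)"
    by (intro holomorphic_on_imp_continuous_on holomorphic_deriv hol op)
  have ct: "continuous_on {a..b} (\<lambda>t. g (Complex \<sigma> t))" if "\<sigma> > 0" "continuous_on {s. Re s > 0} g" for \<sigma> a b and g :: "complex \<Rightarrow> complex"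
    by (rule continuous_on_compose2[OF that(2) continuous_on_Complex(1)]) (use that in auto)
  have cs: "continuous_on {\<delta>..h} (\<lambda>\<sigma>. g (Complex \<sigma> t))" if "continuous_on {s. Re s > 0} g" for t and g :: "complex \<Rightarrow> complex"
    by (rule continuous_on_compose2[OF that(1) continuous_on_Complex(2)]) (use assms in auto)
  let ?G = "\<lambda>\<sigma>. integral {u..v} (\<lambda>t. (cmod (deriv f (Complex \<sigma> t)))\<^sup>2)"
  let ?E = "\<lambda>\<sigma>. Im (cnj (f (Complex \<sigma> v)) * deriv f (Complex \<sigma> v)) - Im (cnj (f (Complex \<sigma> u)) * deriv f (Complex \<sigma> u))"
  have 1: "integral {u..v} (\<lambda>t. (cmod (f (Complex h t)))\<^sup>2) \<le> (v - u) * B\<^sup>2"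
  proof -
    have "integral {u..v} (\<lambda>t. (cmod (f (Complex h t)))\<^sup>2) \<le> integral {u..v} (\<lambda>t. B\<^sup>2)"
      by (intro integral_le integrable_continuous_real continuous_intros ct c0 h power_mono B) auto
    then show ?thesis using uv by simp
  qed
  have kd: "\<sigma> * cmod (deriv f (Complex \<sigma> t)) \<le> \<kappa>" if "0 < \<sigma>" "\<sigma> \<le> h" for \<sigma> t
    using deriv_le_inverse_Re[of "Complex \<sigma> t"] that assms by (simp add: \<kappa>_def K_def)
  have 2: "- integral {u..v} (\<lambda>t. (h - \<delta>) * (2 * Re (cnj (f (Complex h t)) * deriv f (Complex h t)))) \<le> (v - u) * (2 * B * \<kappa>)"
  proof -
    have "- integral {u..v} (\<lambda>t. (h - \<delta>) * (2 * Re (cnj (f (Complex h t)) * deriv f (Complex h t)))) =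
       integral {u..v} (\<lambda>t. - ((h - \<delta>) * (2 * Re (cnj (f (Complex h t)) * deriv f (Complex h t)))))"
      by simp
    also have "\<dots> \<le> integral {u..v} (\<lambda>t. 2 * B * \<kappa>)"
    proof (intro integral_le integrable_continuous_real continuous_intros ct c0 c1 h)
      fix t assume t: "t \<in> {u..v}"
      let ?z = "cnj (f (Complex h t)) * deriv f (Complex h t)"
      have "- ((h - \<delta>) * (2 * Re ?z)) \<le> \<bar>(h - \<delta>) * (2 * Re ?z)\<bar>" by simp
      also have "\<dots> = (h - \<delta>) * (2 * \<bar>Re ?z\<bar>)" unfolding abs_mult using assms by simp
      also have "\<dots> \<le> h * (2 * (cmod (f (Complex h t)) * cmod (deriv f (Complex h t))))"
        using assms abs_Re_le_cmod[of ?z] by (intro mult_mono) (auto simp: norm_mult)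
      also have "\<dots> = 2 * cmod (f (Complex h t)) * (h * cmod (deriv f (Complex h t)))" by simp
      also have "\<dots> \<le> 2 * B * \<kappa>"
        using B[OF t] kd[of h t] h B0 by (intro mult_mono) auto
      finally show "- ((h - \<delta>) * (2 * Re ?z)) \<le> 2 * B * \<kappa>" .
    qed
    finally show ?thesis using uv by (simp add: algebra_simps)
  qed
  have cG: "continuous_on {\<delta>..h} ?G" by (rule continuous_on_mean_square_deriv[OF assms(1)])
  have G0: "?G \<sigma> \<ge> 0" for \<sigma> by (rule integral_nonneg_of_nonneg) simp
  have 3: "integral {\<delta>..h} (\<lambda>\<sigma>. (\<sigma> - \<delta>) * (4 * ?G \<sigma> + 2 * ?E \<sigma>)) \<le> 4 * ((v - u) * K) + 4 * \<kappa> * (B * h + \<kappa> * h)"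
  proof -
    \<comment> \<open>Bound for both edge terms together: each of the two edges carries a factor 2,
      |f| at \<sigma> is at most B plus the logarithmic growth, and \<sigma> |f'| \<le> \<kappa>
      absorbs the Taylor weight.\<close>
    let ?L = "\<lambda>\<sigma>. 4 * \<kappa> * (B + \<kappa> * (ln h - ln \<sigma>))"
    have i: "?L integrable_on {\<delta>..h}"
      using assms by (intro integrable_continuous_real continuous_intros) auto
    have i': "(\<lambda>\<sigma>. 4 * (\<sigma> * ?G \<sigma>)) integrable_on {\<delta>..h}"
      by (intro integrable_continuous_real continuous_intros cG)
    have e: "\<sigma> * \<bar>Im (cnj (f (Complex \<sigma> t)) * deriv f (Complex \<sigma> t))\<bar> \<le> \<kappa> * (B + \<kappa> * (ln h - ln \<sigma>))"
      if s: "\<sigma> \<in> {\<delta>..h}" and t: "t \<in> {u..v}" for \<sigma> t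
    proof -
      have "cmod (f (Complex \<sigma> t)) \<le> cmod (f (Complex h t)) + cmod (f (Complex h t) - f (Complex \<sigma> t))"
        by (metis norm_minus_commute norm_triangle_sub add.commute)
      also have "\<dots> \<le> B + \<kappa> * (ln h - ln \<sigma>)"
        using B[OF t] norm_diff_le_ln_ratio[of \<sigma> h t] s assms by (simp add: \<kappa>_def K_def)
      finally have a: "cmod (f (Complex \<sigma> t)) \<le> B + \<kappa> * (ln h - ln \<sigma>)" .
      have "\<sigma> * \<bar>Im (cnj (f (Complex \<sigma> t)) * deriv f (Complex \<sigma> t))\<bar> \<le>
          \<sigma> * (cmod (f (Complex \<sigma> t)) * cmod (deriv f (Complex \<sigma> t)))"
        using abs_Im_le_cmod[of "cnj (f (Complex \<sigma> t)) * deriv f (Complex \<sigma> t)"] s assms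
        by (intro mult_left_mono) (auto simp: norm_mult)
      also have "\<dots> = (\<sigma> * cmod (deriv f (Complex \<sigma> t))) * cmod (f (Complex \<sigma> t))" by simp
      also have "\<dots> \<le> \<kappa> * (B + \<kappa> * (ln h - ln \<sigma>))"
        using a kd[of \<sigma> t] s assms \<kappa>0 by (intro mult_mono) auto
      finally show ?thesis .
    qed
    have "integral {\<delta>..h} (\<lambda>\<sigma>. (\<sigma> - \<delta>) * (4 * ?G \<sigma> + 2 * ?E \<sigma>)) \<le>
       integral {\<delta>..h} (\<lambda>\<sigma>. 4 * (\<sigma> * ?G \<sigma>) + ?L \<sigma>)"
    proof (intro integral_le integrable_add i i')
      show "(\<lambda>\<sigma>. (\<sigma> - \<delta>) * (4 * ?G \<sigma> + 2 * ?E \<sigma>)) integrable_on {\<delta>..h}"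
        by (intro integrable_continuous_real continuous_intros cG cs c0 c1)
      fix \<sigma> assume s: "\<sigma> \<in> {\<delta>..h}"
      have "(\<sigma> - \<delta>) * (4 * ?G \<sigma>) \<le> \<sigma> * (4 * ?G \<sigma>)"
        using assms G0[of \<sigma>] s by (intro mult_right_mono) auto
      moreover have "(\<sigma> - \<delta>) * (2 * ?E \<sigma>) \<le> ?L \<sigma>"
      proof -
        let ?a = "\<bar>Im (cnj (f (Complex \<sigma> v)) * deriv f (Complex \<sigma> v))\<bar>"
        let ?b = "\<bar>Im (cnj (f (Complex \<sigma> u)) * deriv f (Complex \<sigma> u))\<bar>"
        have "(\<sigma> - \<delta>) * (2 * ?E \<sigma>) \<le> (\<sigma> - \<delta>) * (2 * (?a + ?b))"
          using s by (intro mult_left_mono) auto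
        also have "\<dots> \<le> \<sigma> * (2 * (?a + ?b))" using s assms by (intro mult_right_mono) auto
        also have "\<dots> = 2 * (\<sigma> * ?a) + 2 * (\<sigma> * ?b)" by (simp add: algebra_simps)
        also have "\<dots> \<le> ?L \<sigma>" using e[OF s, of v] e[OF s, of u] uv by auto
        finally show ?thesis .
      qed
      ultimately show "(\<sigma> - \<delta>) * (4 * ?G \<sigma> + 2 * ?E \<sigma>) \<le> 4 * (\<sigma> * ?G \<sigma>) + ?L \<sigma>"
        by (simp add: distrib_left)
    qed
    also have "\<dots> = 4 * integral {\<delta>..h} (\<lambda>\<sigma>. \<sigma> * ?G \<sigma>) + integral {\<delta>..h} ?L"
      by (subst integral_add[OF i' i]) simp
    also have "integral {\<delta>..h} ?L \<le> 4 * \<kappa> * (B * h + \<kappa> * h)"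
    proof -
      \<comment> \<open>The additional summand \<sigma> cancels the -1 produced by differentiating
        \<sigma> (ln h - ln \<sigma>). The value at \<delta> is nonnegative, so a bound uniform in
        \<delta> remains.\<close>
      let ?F = "\<lambda>\<sigma>. 4 * \<kappa> * (B * \<sigma> + \<kappa> * (\<sigma> * (ln h - ln \<sigma>) + \<sigma>))"
      have "(?L has_integral (?F h - ?F \<delta>)) {\<delta>..h}"
      proof (rule fundamental_theorem_of_calculus[OF assms(2)])
        fix x assume "x \<in> {\<delta>..h}"
        then have "x > 0" using assms by auto
        then show "(?F has_vector_derivative ?L x) (at x within {\<delta>..h})"
          unfolding has_real_derivative_iff_has_vector_derivative[symmetric]
          by (auto intro!: derivative_eq_intros simp: field_simps)
      qed
      then have "integral {\<delta>..h} ?L = ?F h - ?F \<delta>" by (rule integral_unique)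
      moreover have "?F \<delta> \<ge> 0" using assms B0 \<kappa>0 by (intro mult_nonneg_nonneg add_nonneg_nonneg) auto
      ultimately show ?thesis by simp
    qed
    finally show ?thesis using area_bound[OF uv assms(1) assms(3)] by (simp add: K_def)
  qed
  have 4: "4 * \<kappa> * (B * h + \<kappa> * h) \<le> (v - u) * (4 * B * \<kappa> + 4 * K)"
  proof -
    have "4 * \<kappa> * (B * h + \<kappa> * h) = h * (4 * B * \<kappa> + 4 * K)"
      by (simp add: \<kappa>2[symmetric] power2_eq_square algebra_simps)
    also have "\<dots> \<le> (v - u) * (4 * B * \<kappa> + 4 * K)"
      using assms B0 \<kappa>0 K0 by (intro mult_right_mono) auto
    finally show ?thesis .
  qed
  have "integral {u..v} (\<lambda>t. (cmod (f (Complex \<delta> t)))\<^sup>2) \<le>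
     (v - u) * B\<^sup>2 + (v - u) * (2 * B * \<kappa>) + (4 * ((v - u) * K) + (v - u) * (4 * B * \<kappa> + 4 * K))"
    using mean_square_Green_formula[OF hol assms(1,2) uv] 1 2 3 4 by linarith
  also have "\<dots> = (v - u) * (B\<^sup>2 + 6 * B * \<kappa> + 8 * K)" by (simp add: algebra_simps)
  finally show ?thesis by (simp add: \<kappa>_def)
qed

end

section \<open>From mean squares to BMOA\<close>

lemma nn_integral_inverse_1_plus_square_finite:
  "(\<integral>\<^sup>+x. ennreal (1 / (1 + x\<^sup>2)) \<partial>lborel) < \<infinity>"
proof -
  have "integrable lborel (\<lambda>x::real. inverse (1 + x\<^sup>2))"
    using integrable_inverse_1_plus_square by (simp add: set_integrable_def)
  then show ?thesis
    by (simp add: integrable_iff_bounded inverse_eq_divide)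
qed

text \<open>The centre c may depend on the interval and need not be the mean: the mean differs from
  c by at most the average of |g - c|, which costs a factor 2. The inequality x \<le> 1 + x^2 passes
  from second to first moments and accounts for the 1 in 2 (1 + |C|).\<close>

lemma BMO_bound_of_mean_square:
  fixes g :: "real \<Rightarrow> complex"
  assumes g[measurable]: "g \<in> borel_measurable borel"
    and C: "\<And>u v. u < v \<Longrightarrow> \<exists>c. (\<integral>\<^sup>+t\<in>{u..v}. ennreal ((cmod (g t - c))\<^sup>2) \<partial>lborel) \<le> ennreal ((v - u) * C)"
  shows "BMO_seminorm g < \<infinity>"
proof -
  have bound: "(\<integral>\<^sup>+ t \<in> {u..v}. ennreal (cmod (g t - interval_mean g u v)) \<partial>lborel) / ennreal (v - u)
      \<le> ennreal (2 * (1 + \<bar>C\<bar>))" if uv: "u < v" for u v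
  proof -
    obtain c where c: "(\<integral>\<^sup>+t\<in>{u..v}. ennreal ((cmod (g t - c))\<^sup>2) \<partial>lborel) \<le> ennreal ((v - u) * C)"
      using C uv by blast
    let ?D = "(v - u) * (1 + \<bar>C\<bar>)"
    have n1: "(\<integral>\<^sup>+t\<in>{u..v}. ennreal (cmod (g t - c)) \<partial>lborel) \<le> ennreal ?D"
    proof -
      have "(\<integral>\<^sup>+t\<in>{u..v}. ennreal (cmod (g t - c)) \<partial>lborel) \<le>
          (\<integral>\<^sup>+t. indicator {u..v} t + ennreal ((cmod (g t - c))\<^sup>2) * indicator {u..v} t \<partial>lborel)"
      proof (rule nn_integral_mono)
        fix t
        have "x \<le> 1 + x\<^sup>2" if "x \<ge> 0" for x :: real
          using that sum_power2_ge_zero[of "x - 1/2" 0] by (simp add: power2_eq_square algebra_simps)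
        then have "ennreal (cmod (g t - c)) \<le> ennreal (1 + (cmod (g t - c))\<^sup>2)"
          by (intro ennreal_leI) simp
        also have "\<dots> = 1 + ennreal ((cmod (g t - c))\<^sup>2)" by (simp add: ennreal_plus)
        finally show "ennreal (cmod (g t - c)) * indicator {u..v} t \<le>
            indicator {u..v} t + ennreal ((cmod (g t - c))\<^sup>2) * indicator {u..v} t"
          by (auto simp: indicator_def)
      qed
      also have "\<dots> = ennreal (v - u) + (\<integral>\<^sup>+t\<in>{u..v}. ennreal ((cmod (g t - c))\<^sup>2) \<partial>lborel)"
        using uv by (subst nn_integral_add) auto
      also have "\<dots> \<le> ennreal (v - u) + ennreal ((v - u) * \<bar>C\<bar>)"
        using uv by (intro add_left_mono order_trans[OF c] ennreal_leI mult_left_mono) auto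
      also have "\<dots> = ennreal ?D"
        using uv by (simp flip: ennreal_plus add: distrib_left)
      finally show ?thesis .
    qed
    \<comment> \<open>Integrability on the interval has to come first, because otherwise
      \<open>interval_mean\<close> would be the default value 0 of the Bochner integral.\<close>
    have i1: "set_integrable lborel {u..v} (\<lambda>t. g t - c)"
      unfolding set_integrable_def integrable_iff_bounded
    proof
      have "(\<integral>\<^sup>+ x. ennreal (norm (indicator {u..v} x *\<^sub>R (g x - c))) \<partial>lborel) =
         (\<integral>\<^sup>+t\<in>{u..v}. ennreal (cmod (g t - c)) \<partial>lborel)"
        by (intro nn_integral_cong) (auto simp: indicator_def)
      also have "\<dots> < \<infinity>" using n1 by (rule order.strict_trans1) simp
      finally show "(\<integral>\<^sup>+ x. ennreal (norm (indicator {u..v} x *\<^sub>R (g x - c))) \<partial>lborel) < \<infinity>" .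
    qed simp
    have i2: "set_integrable lborel {u..v} (\<lambda>t. c)"
      unfolding set_integrable_def by (intro integrable_scaleR_left) (use uv in \<open>auto simp: integrable_indicator_iff\<close>)
    have i3: "set_integrable lborel {u..v} g"
      using set_integral_add(1)[OF i1 i2] by simp
    define \<mu> where "\<mu> = interval_mean g u v"
    have "(LINT t:{u..v}|lborel. g t - c) = (LINT t:{u..v}|lborel. g t) - (LINT t:{u..v}|lborel. c)"
      by (rule set_integral_diff(2)[OF i3 i2])
    also have "(LINT t:{u..v}|lborel. c) = of_real (v - u) * c"
      using uv by (simp add: set_lebesgue_integral_def scaleR_conv_of_real)
    also have "(LINT t:{u..v}|lborel. g t) = of_real (v - u) * \<mu>"
      using uv by (simp add: \<mu>_def interval_mean_def)
    finally have e: "(LINT t:{u..v}|lborel. g t - c) = of_real (v - u) * (\<mu> - c)"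
      by (simp add: algebra_simps)
    have "ennreal ((v - u) * cmod (\<mu> - c)) = ennreal (cmod (LINT t:{u..v}|lborel. g t - c))"
      unfolding e norm_mult norm_of_real using uv by simp
    also have "\<dots> \<le> (\<integral>\<^sup>+t. ennreal (norm (indicator {u..v} t *\<^sub>R (g t - c))) \<partial>lborel)"
      unfolding set_lebesgue_integral_def
      by (intro integral_norm_bound_ennreal i1[unfolded set_integrable_def])
    also have "\<dots> = (\<integral>\<^sup>+t\<in>{u..v}. ennreal (cmod (g t - c)) \<partial>lborel)"
      by (intro nn_integral_cong) (auto simp: indicator_def)
    finally have n2: "ennreal ((v - u) * cmod (\<mu> - c)) \<le> ennreal ?D" using n1 by simp
    have "(\<integral>\<^sup>+t\<in>{u..v}. ennreal (cmod (g t - \<mu>)) \<partial>lborel) \<le>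
      (\<integral>\<^sup>+t. ennreal (cmod (g t - c)) * indicator {u..v} t + ennreal (cmod (\<mu> - c)) * indicator {u..v} t \<partial>lborel)"
    proof (rule nn_integral_mono)
      fix t
      have "cmod (g t - \<mu>) \<le> cmod (g t - c) + cmod (\<mu> - c)"
        using norm_triangle_ineq4[of "g t - c" "\<mu> - c"] by simp
      then show "ennreal (cmod (g t - \<mu>)) * indicator {u..v} t \<le>
          ennreal (cmod (g t - c)) * indicator {u..v} t + ennreal (cmod (\<mu> - c)) * indicator {u..v} t"
        by (auto simp: indicator_def simp flip: ennreal_plus intro: ennreal_leI)
    qed
    also have "\<dots> = (\<integral>\<^sup>+t\<in>{u..v}. ennreal (cmod (g t - c)) \<partial>lborel) + ennreal ((v - u) * cmod (\<mu> - c))"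
      using uv by (subst nn_integral_add)
        (auto simp: nn_integral_cmult ennreal_mult' mult.commute simp del: ennreal_mult)
    also have "\<dots> \<le> ennreal ?D + ennreal ?D" by (intro add_mono n1 n2)
    also have "\<dots> = ennreal (2 * (1 + \<bar>C\<bar>) * (v - u))"
    proof -
      have "?D \<ge> 0" using uv by (intro mult_nonneg_nonneg) auto
      then have "ennreal ?D + ennreal ?D = ennreal (?D + ?D)" by (metis ennreal_plus)
      also have "?D + ?D = 2 * (1 + \<bar>C\<bar>) * (v - u)" by (simp add: algebra_simps)
      finally show ?thesis .
    qed
    finally have "(\<integral>\<^sup>+t\<in>{u..v}. ennreal (cmod (g t - \<mu>)) \<partial>lborel) / ennreal (v - u) \<le>
        ennreal (2 * (1 + \<bar>C\<bar>) * (v - u)) / ennreal (v - u)"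
      by (rule divide_right_mono_ennreal)
    also have "\<dots> = ennreal (2 * (1 + \<bar>C\<bar>))"
      using uv by (simp add: divide_ennreal)
    finally show ?thesis unfolding \<mu>_def .
  qed
  have "BMO_seminorm g \<le> ennreal (2 * (1 + \<bar>C\<bar>))"
    unfolding BMO_seminorm_def by (intro SUP_least) (use bound in \<open>simp del: ennreal_plus split: prod.splits\<close>)
  then show ?thesis by (rule order.strict_trans1) simp
qed

context
  fixes f :: "complex \<Rightarrow> complex" and m :: "nat \<Rightarrow> real"
  assumes hol: "f holomorphic_on {s. Re s > 0}"
    and m: "\<And>k s. Re s \<ge> 1 / 2 ^ Suc k \<Longrightarrow> cmod (deriv f s) \<le> m k"
    and sm: "summable (\<lambda>k. (m k)\<^sup>2 / 4 ^ k)"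
begin

text \<open>Subtracting a constant leaves the derivative unchanged, so the same \<open>m\<close> and
  K serve f - c for every c.\<close>

lemma nn_mean_square_local_bound:
  assumes "0 < \<delta>" "\<delta> \<le> h" "h \<le> 1" "h \<le> v - u"
    and B: "\<And>t. t \<in> {u..v} \<Longrightarrow> cmod (f (Complex h t) - c) \<le> B"
  defines "K \<equiv> (\<Sum>k. (m k)\<^sup>2 / 4 ^ k)"
  shows "(\<integral>\<^sup>+t\<in>{u..v}. ennreal ((cmod (f (Complex \<delta> t) - c))\<^sup>2) \<partial>lborel) \<le>
     ennreal ((v - u) * (B\<^sup>2 + 6 * B * sqrt K + 8 * K))"
proof -
  have op: "open {s. Re s > 0}" by (rule open_halfspace_Re_gt)
  have hol': "(\<lambda>s. f s - c) holomorphic_on {s. Re s > 0}" by (intro holomorphic_intros hol)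
  have m': "cmod (deriv (\<lambda>s. f s - c) s) \<le> m k" if "Re s \<ge> 1 / 2 ^ Suc k" for k s
  proof -
    have "(0::real) < 1 / 2 ^ Suc k" by simp
    then have "Re s > 0" using that by linarith
    then have "(f has_field_derivative deriv f s) (at s)"
      by (intro holomorphic_derivI[OF hol op]) auto
    then have "((\<lambda>s. f s - c) has_field_derivative deriv f s - 0) (at s)"
      by (intro DERIV_diff DERIV_const)
    from DERIV_imp_deriv[OF this] show ?thesis using m[OF that] by simp
  qed
  have "continuous_on {u..v} (\<lambda>t. f (Complex \<delta> t) - c)"
    by (rule continuous_on_compose2[OF holomorphic_on_imp_continuous_on[OF hol'] continuous_on_Complex(1)])
      (use assms in auto)
  then have "(\<lambda>t. (cmod (f (Complex \<delta> t) - c))\<^sup>2) integrable_on {u..v}"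
    by (intro integrable_continuous_real continuous_on_power continuous_on_norm)
  from nn_integral_has_integral_lebesgue[OF _ integrable_integral[OF this]]
  have "(\<integral>\<^sup>+t\<in>{u..v}. ennreal ((cmod (f (Complex \<delta> t) - c))\<^sup>2) \<partial>lborel) =
    ennreal (integral {u..v} (\<lambda>t. (cmod (f (Complex \<delta> t) - c))\<^sup>2))"
    by (simp add: ennreal_mult' ennreal_indicator mult.commute)
  also have "\<dots> \<le> ennreal ((v - u) * (B\<^sup>2 + 6 * B * sqrt K + 8 * K))"
    unfolding K_def
    by (intro ennreal_leI mean_square_local_bound[OF hol' m' sm assms(1-4) B])
  finally show ?thesis .
qed

text \<open>The interval length dictates the height of comparison. If v - u \<le> 1, take h = v - u
  and c = f(h + iu): the Bloch bound sqrt K / h on a segment of length h makes f - c at most sqrt K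
  there. Longer intervals are compared at h = 1 with c = 0, where |f| \<le> B.\<close>

lemma BMOA_criterion:
  assumes bd: "\<And>s. Re s \<ge> 1 \<Longrightarrow> cmod (f s) \<le> B"
    and lim: "AE t in lborel. \<exists>l. ((\<lambda>\<sigma>. f (Complex \<sigma> t)) \<longlongrightarrow> l) (at_right 0)"
  shows "f \<in> BMOA"
proof -
  define K where "K = (\<Sum>k. (m k)\<^sup>2 / 4 ^ k)"
  \<comment> \<open>The maximum lets short and long intervals share the constant C.\<close>
  define B' where "B' = max (sqrt K) B"
  define C where "C = B'\<^sup>2 + 6 * B' * sqrt K + 8 * K"
  have K0: "K \<ge> 0" unfolding K_def by (rule suminf_deriv_bound_nonneg[OF hol m sm])
  have B0: "B' \<ge> 0" unfolding B'_def using K0 by (simp add: le_max_iff_disj)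
  have C0: "C \<ge> 0" unfolding C_def using K0 B0 by (intro add_nonneg_nonneg mult_nonneg_nonneg) auto
  have op: "open {s. Re s > 0}" by (rule open_halfspace_Re_gt)
  have fm: "(\<lambda>t. f (Complex \<sigma> t)) \<in> borel_measurable borel" if "\<sigma> > 0" for \<sigma>
    by (intro borel_measurable_continuous_onI
      continuous_on_compose2[OF holomorphic_on_imp_continuous_on[OF hol] continuous_on_Complex(1)])
      (use that in auto)
  define g where "g = boundary_fun f"
  have g[measurable]: "g \<in> borel_measurable borel"
    unfolding g_def by (rule borel_measurable_boundary_fun[OF hol])
  \<comment> \<open>Fatou's lemma carries the bound from the lines Re s = 1 / (n + 1) to the
    boundary. The height h stays fixed meanwhile, so the bound does not depend on n.\<close>
  have fatou: "(\<integral>\<^sup>+t\<in>{u..v}. ennreal ((cmod (g t - c))\<^sup>2) \<partial>lborel) \<le> ennreal ((v - u) * C)"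
    if h: "0 < h" "h \<le> 1" "h \<le> v - u" and c: "\<And>t. t \<in> {u..v} \<Longrightarrow> cmod (f (Complex h t) - c) \<le> B'" for u v c h
  proof -
    define \<phi> where "\<phi> n t = ennreal ((cmod (f (Complex (1 / real (Suc n)) t) - c))\<^sup>2) * indicator {u..v} t" for n t
    have [measurable]: "\<phi> n \<in> borel_measurable borel" for n
      unfolding \<phi>_def using fm[of "1 / real (Suc n)"] by measurable
    have fl: "filterlim (\<lambda>n. 1 / real (Suc n)) (at_right 0) sequentially"
      unfolding filterlim_at using LIMSEQ_Suc[OF lim_1_over_n] by auto
    have "(\<integral>\<^sup>+t\<in>{u..v}. ennreal ((cmod (g t - c))\<^sup>2) \<partial>lborel) = (\<integral>\<^sup>+t. liminf (\<lambda>n. \<phi> n t) \<partial>lborel)"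
    proof (rule nn_integral_cong_AE)
      show "AE t in lborel. ennreal ((cmod (g t - c))\<^sup>2) * indicator {u..v} t = liminf (\<lambda>n. \<phi> n t)"
        using lim
      proof eventually_elim
        case (elim t)
        then obtain l where l: "((\<lambda>\<sigma>. f (Complex \<sigma> t)) \<longlongrightarrow> l) (at_right 0)" by blast
        have gl: "g t = l" unfolding g_def by (rule boundary_fun_eq[OF l])
        have "(\<lambda>n. f (Complex (1 / real (Suc n)) t)) \<longlonglongrightarrow> l"
          by (rule filterlim_compose[OF l fl])
        then have "(\<lambda>n. ennreal ((cmod (f (Complex (1 / real (Suc n)) t) - c))\<^sup>2)) \<longlonglongrightarrow> ennreal ((cmod (l - c))\<^sup>2)"
          by (intro tendsto_ennrealI tendsto_intros)
        then have "(\<lambda>n. \<phi> n t) \<longlonglongrightarrow> ennreal ((cmod (g t - c))\<^sup>2) * indicator {u..v} t"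
          unfolding \<phi>_def gl by (cases "t \<in> {u..v}") auto
        then show ?case by (simp add: lim_imp_Liminf)
      qed
    qed
    also have "\<dots> \<le> liminf (\<lambda>n. integral\<^sup>N lborel (\<phi> n))" by (rule nn_integral_liminf) measurable
    also have "\<dots> \<le> limsup (\<lambda>n. integral\<^sup>N lborel (\<phi> n))" by (rule Liminf_le_Limsup) simp
    also have "\<dots> \<le> ennreal ((v - u) * C)"
    proof (rule Limsup_bounded)
      have "eventually (\<lambda>n. 1 / real (Suc n) < h) sequentially"
        using order_tendstoD(2)[OF LIMSEQ_Suc[OF lim_1_over_n] h(1)] by simp
      then show "\<forall>\<^sub>F n in sequentially. integral\<^sup>N lborel (\<phi> n) \<le> ennreal ((v - u) * C)"
      proof eventually_elim
        case (elim n)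
        show ?case unfolding \<phi>_def C_def K_def
          by (rule nn_mean_square_local_bound[of "1 / real (Suc n)" h]) (use elim h c in auto)
      qed
    qed
    finally show ?thesis .
  qed
  have "BMO_seminorm g < \<infinity>"
  proof (rule BMO_bound_of_mean_square[OF g])
    fix u v :: real assume uv: "u < v"
    show "\<exists>c. (\<integral>\<^sup>+t\<in>{u..v}. ennreal ((cmod (g t - c))\<^sup>2) \<partial>lborel) \<le> ennreal ((v - u) * C)"
    proof (cases "v - u \<le> 1")
      case True
      define h where "h = v - u"
      have h: "0 < h" "h \<le> 1" using uv True by (auto simp: h_def)
      have "cmod (f (Complex h t) - f (Complex h u)) \<le> B'" if t: "t \<in> {u..v}" for t
      proof -
        have "cmod (f (Complex h t) - f (Complex h u)) \<le> (sqrt K / h) * cmod (Complex h t - Complex h u)"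
        proof (rule field_differentiable_bound[where S = "{s. Re s = h}" and f' = "deriv f"])
          show "convex {s. Re s = h}"
            using convex_hyperplane[of "1 :: complex" h] by (simp add: inner_complex_def)
          fix z assume z: "z \<in> {s. Re s = h}"
          then show "(f has_field_derivative deriv f z) (at z within {s. Re s = h})"
            using h by (auto intro!: has_field_derivative_at_within[OF holomorphic_derivI[OF hol op]])
          show "cmod (deriv f z) \<le> sqrt K / h"
            using deriv_le_inverse_Re[OF hol m sm, of z] z h by (simp add: K_def field_simps)
        qed auto
        also have "Complex h t - Complex h u = \<i> * of_real (t - u)" by (simp add: complex_eq_iff)
        also have "sqrt K / h * cmod (\<i> * of_real (t - u)) \<le> sqrt K / h * h"
          using t h K0 unfolding norm_mult norm_of_real by (intro mult_left_mono) (auto simp: h_def)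
        also have "\<dots> = sqrt K" using h by simp
        also have "\<dots> \<le> B'" by (simp add: B'_def)
        finally show ?thesis .
      qed
      then show ?thesis using fatou[of h v u "f (Complex h u)"] h by (auto simp: h_def)
    next
      case False
      have "cmod (f (Complex 1 t) - 0) \<le> B'" for t
        using bd[of "Complex 1 t"] by (simp add: B'_def le_max_iff_disj)
      then show ?thesis using fatou[of 1 v u 0] False by (intro exI[of _ 0]) auto
    qed
  qed
  moreover have "(SUP \<sigma> \<in> {0<..}. \<integral>\<^sup>+ t. ennreal ((cmod (f (Complex \<sigma> t)))\<^sup>2 / (1 + \<sigma>\<^sup>2 + t\<^sup>2)) \<partial>lborel) < \<infinity>"
  proof -
    \<comment> \<open>The summand B'^2 serves \<sigma> \<ge> 1, where f is bounded. The summand 3 C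
      serves \<sigma> < 1, where 3 comes from 1 + x^2 \<le> 3 (1 + t^2) for |x - t| \<le> 1.\<close>
    define E where "E = B'\<^sup>2 + 3 * C"
    have E: "E \<ge> 0" "B'\<^sup>2 \<le> E" "3 * C \<le> E" using C0 by (auto simp: E_def)
    let ?I = "\<integral>\<^sup>+x. ennreal (1 / (1 + x\<^sup>2)) \<partial>lborel"
    have "(\<integral>\<^sup>+ t. ennreal ((cmod (f (Complex \<sigma> t)))\<^sup>2 / (1 + \<sigma>\<^sup>2 + t\<^sup>2)) \<partial>lborel) \<le>
        ennreal E * ?I" if s: "\<sigma> > 0" for \<sigma>
    proof (cases "\<sigma> \<ge> 1")
      case True
      have "(\<integral>\<^sup>+ t. ennreal ((cmod (f (Complex \<sigma> t)))\<^sup>2 / (1 + \<sigma>\<^sup>2 + t\<^sup>2)) \<partial>lborel) \<le>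
         (\<integral>\<^sup>+ t. ennreal E * ennreal (1 / (1 + t\<^sup>2)) \<partial>lborel)"
      proof (intro nn_integral_mono)
        fix t
        have "cmod (f (Complex \<sigma> t)) \<le> B'"
          using bd[of "Complex \<sigma> t"] True by (simp add: B'_def le_max_iff_disj)
        then have "(cmod (f (Complex \<sigma> t)))\<^sup>2 \<le> E"
          using E power_mono[of "cmod (f (Complex \<sigma> t))" B' 2] by simp
        then have "(cmod (f (Complex \<sigma> t)))\<^sup>2 / (1 + \<sigma>\<^sup>2 + t\<^sup>2) \<le> E / (1 + t\<^sup>2)"
          using E by (intro frac_le) (auto intro: add_pos_nonneg)
        then show "ennreal ((cmod (f (Complex \<sigma> t)))\<^sup>2 / (1 + \<sigma>\<^sup>2 + t\<^sup>2)) \<le> ennreal E * ennreal (1 / (1 + t\<^sup>2))"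
          using E by (simp add: ennreal_mult[symmetric] ennreal_leI)
      qed
      also have "\<dots> = ennreal E * ?I" by (rule nn_integral_cmult) simp
      finally show ?thesis .
    next
      case False
      define F where "F t = ennreal ((cmod (f (Complex \<sigma> t)))\<^sup>2)" for t
      have [measurable]: "F \<in> borel_measurable borel" unfolding F_def using fm[OF s] by measurable
      have loc: "(\<integral>\<^sup>+t\<in>{x..x+1}. F t \<partial>lborel) \<le> ennreal C" for x
      proof -
        have "cmod (f (Complex 1 t) - 0) \<le> B'" for t
          using bd[of "Complex 1 t"] by (simp add: B'_def le_max_iff_disj)
        then show ?thesis
          using nn_mean_square_local_bound[of \<sigma> 1 "x + 1" x 0 B'] False s by (simp add: F_def C_def K_def)
      qed
      \<comment> \<open>Averaging \<open>1 / (1 + x\<^sup>2)\<close> over \<open>{t-1..t}\<close> and Tonelli reduce the weighted integral to unit intervals.\<close>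
      have pt: "ennreal ((cmod (f (Complex \<sigma> t)))\<^sup>2 / (1 + \<sigma>\<^sup>2 + t\<^sup>2)) \<le>
          (\<integral>\<^sup>+x. 3 * ennreal (1 / (1 + x\<^sup>2)) * (F t * indicator {x..x+1} t) \<partial>lborel)" for t
      proof -
        have "F t * ennreal (1 / (1 + t\<^sup>2)) * 1 = (\<integral>\<^sup>+x. F t * ennreal (1 / (1 + t\<^sup>2)) * indicator {t-1..t} x \<partial>lborel)"
          by (subst nn_integral_cmult_indicator) auto
        also have "\<dots> \<le> (\<integral>\<^sup>+x. 3 * ennreal (1 / (1 + x\<^sup>2)) * (F t * indicator {x..x+1} t) \<partial>lborel)"
        proof (rule nn_integral_mono)
          fix x
          show "F t * ennreal (1 / (1 + t\<^sup>2)) * indicator {t-1..t} x \<le> 3 * ennreal (1 / (1 + x\<^sup>2)) * (F t * indicator {x..x+1} t)"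
          proof (cases "x \<in> {t-1..t}")
            case True
            have "x\<^sup>2 \<le> (\<bar>t\<bar> + 1)\<^sup>2"
              using True by (intro power2_le_iff_abs_le[THEN iffD2]) auto
            also have "(\<bar>t\<bar> + 1)\<^sup>2 \<le> 2 * t\<^sup>2 + 2"
              using sum_power2_ge_zero[of "\<bar>t\<bar> - 1" 0] by (simp add: power2_eq_square algebra_simps)
            finally have "1 + x\<^sup>2 \<le> 1 + (2 * t\<^sup>2 + 2)" by simp
            also have "\<dots> \<le> 3 * (1 + t\<^sup>2)" by simp
            finally have "1 + x\<^sup>2 \<le> 3 * (1 + t\<^sup>2)" .
            then have "1 / (1 + t\<^sup>2) \<le> 3 * (1 / (1 + x\<^sup>2))"
              by (simp add: divide_simps add_pos_nonneg)
            then have "ennreal (1 / (1 + t\<^sup>2)) \<le> 3 * ennreal (1 / (1 + x\<^sup>2))"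
              using ennreal_leI ennreal_mult[of 3 "1 / (1 + x\<^sup>2)"] by fastforce
            then show ?thesis using True by (auto intro: mult_left_mono simp: mult.commute)
          qed simp
        qed
        finally have "F t * ennreal (1 / (1 + t\<^sup>2)) \<le> (\<integral>\<^sup>+x. 3 * ennreal (1 / (1 + x\<^sup>2)) * (F t * indicator {x..x+1} t) \<partial>lborel)"
          by simp
        moreover have "ennreal ((cmod (f (Complex \<sigma> t)))\<^sup>2 / (1 + \<sigma>\<^sup>2 + t\<^sup>2)) \<le> F t * ennreal (1 / (1 + t\<^sup>2))"
          unfolding F_def
          by (simp add: ennreal_mult[symmetric]) (intro ennreal_leI divide_left_mono, auto intro!: mult_pos_pos add_pos_nonneg)
        ultimately show ?thesis by (rule order_trans[rotated])
      qed
      have "(\<integral>\<^sup>+ t. ennreal ((cmod (f (Complex \<sigma> t)))\<^sup>2 / (1 + \<sigma>\<^sup>2 + t\<^sup>2)) \<partial>lborel) \<le>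
         (\<integral>\<^sup>+ t. (\<integral>\<^sup>+x. 3 * ennreal (1 / (1 + x\<^sup>2)) * (F t * indicator {x..x+1} t) \<partial>lborel) \<partial>lborel)"
        by (intro nn_integral_mono pt)
      also have "\<dots> = (\<integral>\<^sup>+ x. (\<integral>\<^sup>+t. 3 * ennreal (1 / (1 + x\<^sup>2)) * (F t * indicator {x..x+1} t) \<partial>lborel) \<partial>lborel)"
      proof -
        \<comment> \<open>The interval {x..x+1} moves with x; for joint measurability its indicator
          is rewritten as that of one strip in the plane.\<close>
        have "(\<lambda>p. 3 * ennreal (1 / (1 + (snd p)\<^sup>2)) * (F (fst p) * indicator {p. snd p \<le> fst p \<and> fst p \<le> snd p + 1} p))
          \<in> borel_measurable (lborel \<Otimes>\<^sub>M lborel)" by measurable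
        then have "(\<lambda>(t, x). 3 * ennreal (1 / (1 + x\<^sup>2)) * (F t * indicator {x..x+1} t)) \<in> borel_measurable (lborel \<Otimes>\<^sub>M lborel)"
          by (rule back_subst[where P = "\<lambda>f. f \<in> _"]) (auto simp: fun_eq_iff indicator_def)
        from lborel_pair.Fubini'[OF this] show ?thesis ..
      qed
      also have "\<dots> \<le> (\<integral>\<^sup>+ x. ennreal (3 * C) * ennreal (1 / (1 + x\<^sup>2)) \<partial>lborel)"
      proof (intro nn_integral_mono)
        fix x
        have "(\<integral>\<^sup>+t. 3 * ennreal (1 / (1 + x\<^sup>2)) * (F t * indicator {x..x+1} t) \<partial>lborel) =
           3 * ennreal (1 / (1 + x\<^sup>2)) * (\<integral>\<^sup>+t\<in>{x..x+1}. F t \<partial>lborel)"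
          by (subst nn_integral_cmult) auto
        also have "\<dots> \<le> 3 * ennreal (1 / (1 + x\<^sup>2)) * ennreal C" by (intro mult_left_mono loc) auto
        also have "\<dots> = ennreal (3 * C) * ennreal (1 / (1 + x\<^sup>2))"
          using C0 ennreal_mult[of 3 C] by (simp add: ac_simps)
        finally show "(\<integral>\<^sup>+t. 3 * ennreal (1 / (1 + x\<^sup>2)) * (F t * indicator {x..x+1} t) \<partial>lborel) \<le>
          ennreal (3 * C) * ennreal (1 / (1 + x\<^sup>2))" .
      qed
      also have "\<dots> = ennreal (3 * C) * ?I" by (rule nn_integral_cmult) simp
      also have "\<dots> \<le> ennreal E * ?I" using E by (intro mult_right_mono ennreal_leI) auto
      finally show ?thesis .
    qed
    then have "(SUP \<sigma> \<in> {0<..}. \<integral>\<^sup>+ t. ennreal ((cmod (f (Complex \<sigma> t)))\<^sup>2 / (1 + \<sigma>\<^sup>2 + t\<^sup>2)) \<partial>lborel) \<le> ennreal E * ?I"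
      by (intro SUP_least) auto
    also have "\<dots> < \<infinity>"
      using nn_integral_inverse_1_plus_square_finite by (simp add: ennreal_mult_less_top)
    finally show ?thesis .
  qed
  ultimately show ?thesis using hol by (simp add: BMOA_def g_def)
qed

end

subsection \<open>Polynomials on the polydisc\<close>

text \<open>Fourier inversion on the group of Q-th roots of unity: averaging the polynomial against
  the k-th inverse power isolates c k. As D < Q, two exponents in 0..D never agree modulo Q, so no
  other coefficient is picked up.\<close>

lemma coeff_le_max_roots_of_unity:
  fixes c :: "nat \<Rightarrow> complex"
  assumes DQ: "D < Q" and B: "\<And>\<omega>. \<omega> ^ Q = 1 \<Longrightarrow> cmod (\<Sum>l\<le>D. c l * \<omega> ^ l) \<le> B" and k: "k \<le> D"
  shows "cmod (c k) \<le> B"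
proof -
  define \<omega> where "\<omega> r = cis (2 * pi * real r / real Q)" for r
  have Q: "Q > 0" using DQ by simp
  have wQ: "\<omega> r ^ Q = 1" for r
  proof -
    have "\<omega> r ^ Q = cis (real Q * (2 * pi * real r / real Q))" unfolding \<omega>_def by (rule Complex.DeMoivre)
    also have "real Q * (2 * pi * real r / real Q) = 2 * pi * real r" using Q by simp
    also have "cis (2 * pi * real r) = 1" by (rule cis_multiple_2pi) simp
    finally show ?thesis .
  qed
  \<comment> \<open>This is the (l - k)-th power of a primitive Q-th root of unity, written through
    \<open>cis\<close> because l - k may be negative.\<close>
  define x where "x l = cis (2 * pi * (real l - real k) / real Q)" for l
  have wx: "\<omega> r ^ l * cnj (\<omega> r) ^ k = x l ^ r" for r l
  proof -
    have "\<omega> r ^ l * cnj (\<omega> r) ^ k = cis (real l * (2 * pi * real r / real Q)) * cis (- (real k * (2 * pi * real r / real Q)))"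
      by (simp only: \<omega>_def cis_cnj complex_cnj_power[symmetric] Complex.DeMoivre mult_minus_right)
    also have "\<dots> = cis (real l * (2 * pi * real r / real Q) - real k * (2 * pi * real r / real Q))"
      by (simp add: cis_mult)
    also have "\<dots> = x l ^ r"
      unfolding x_def Complex.DeMoivre by (rule arg_cong[where f = cis]) (simp add: diff_divide_distrib right_diff_distrib left_diff_distrib mult_ac)
    finally show ?thesis .
  qed
  have geo: "(\<Sum>r<Q. x l ^ r) = (if l = k then of_nat Q else 0)" if "l \<le> D" for l
  proof (cases "l = k")
    case False
    have x1: "x l \<noteq> 1"
    proof
      assume "x l = 1"
      then have "cos (2 * pi * (real l - real k) / real Q) = 1"
        by (metis x_def cis.sel(1) one_complex.sel(1))
      then obtain n :: int where "2 * pi * (real l - real k) / real Q = of_int n * 2 * pi"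
        using cos_one_2pi_int by blast
      then have "2 * pi * ((real l - real k) / real Q) = 2 * pi * of_int n" by (simp add: mult_ac)
      then have "(real l - real k) / real Q = of_int n" by (subst (asm) mult_left_cancel) simp_all
      then have "real l - real k = of_int n * real Q" using Q by (simp add: field_simps)
      then have e: "int l - int k = n * int Q"
        by (metis of_int_diff of_int_eq_iff of_int_mult of_int_of_nat_eq)
      have "\<bar>int l - int k\<bar> < int Q" using that k DQ by linarith
      then have "\<bar>n\<bar> * int Q < 1 * int Q" unfolding e by (simp add: abs_mult)
      then have "n = 0" using Q by simp
      with e False show False by simp
    qed
    have "x l ^ Q = cis (real Q * (2 * pi * (real l - real k) / real Q))" unfolding x_def by (rule Complex.DeMoivre)
    also have "real Q * (2 * pi * (real l - real k) / real Q) = 2 * pi * (real l - real k)" using Q by simp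
    also have "cis (2 * pi * (real l - real k)) = 1" by (rule cis_multiple_2pi) simp
    finally have "x l ^ Q = 1" .
    then show ?thesis using x1 False by (simp add: geometric_sum)
  next
    case True then show ?thesis by (simp add: x_def)
  qed
  have "of_nat Q * c k = (\<Sum>l\<le>D. c l * (\<Sum>r<Q. x l ^ r))"
  proof -
    have "(\<Sum>l\<le>D. c l * (\<Sum>r<Q. x l ^ r)) = (\<Sum>l\<le>D. if l = k then of_nat Q * c k else 0)"
      by (intro sum.cong refl) (use geo in auto)
    then show ?thesis using k by simp
  qed
  also have "\<dots> = (\<Sum>r<Q. (\<Sum>l\<le>D. c l * \<omega> r ^ l) * cnj (\<omega> r) ^ k)"
    unfolding sum_distrib_left sum_distrib_right
    by (subst sum.swap) (simp flip: wx add: mult_ac)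
  also have "cmod \<dots> \<le> (\<Sum>r<Q. B)"
  proof (rule sum_norm_le)
    fix r
    have "cmod (\<omega> r) = 1" by (simp add: \<omega>_def)
    then show "cmod ((\<Sum>l\<le>D. c l * \<omega> r ^ l) * cnj (\<omega> r) ^ k) \<le> B"
      using B[OF wQ[of r]] by (simp add: norm_mult norm_power)
  qed
  finally show ?thesis using Q by (simp add: norm_mult)
qed

lemma norm_cis_diff_le: "cmod (cis a - cis b) \<le> \<bar>a - b\<bar>"
proof -
  have "cis a - cis b = cis b * (cis (a - b) - 1)"
    by (simp add: algebra_simps cis_mult)
  then have "cmod (cis a - cis b) = cmod (exp (\<i> * of_real (a - b)) - 1)"
    by (simp add: norm_mult cis_conv_exp)
  also have "\<dots> = 2 * \<bar>sin ((a - b) / 2)\<bar>" by (rule dist_exp_i_1)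
  also have "\<dots> \<le> \<bar>a - b\<bar>" using abs_sin_x_le_abs_x[of "(a - b) / 2"] by simp
  finally show ?thesis .
qed

text \<open>Every coefficient is at most B by Fourier inversion, and every point of the circle lies
  within 2 \<pi> / Q \<le> 7 / Q of a root of unity. Each of the D nonconstant terms then moves by
  at most B D 7 / Q. The maximum principle extends the bound to the disc.\<close>

lemma poly_le_max_roots_of_unity:
  fixes g :: "'b \<Rightarrow> complex" and e :: "'b \<Rightarrow> nat"
  assumes fin: "finite A" and e: "\<And>n. n \<in> A \<Longrightarrow> e n \<le> D" and DQ: "D < Q"
    and B: "\<And>\<omega>. \<omega> ^ Q = 1 \<Longrightarrow> cmod (\<Sum>n\<in>A. g n * \<omega> ^ e n) \<le> B" and w: "cmod w \<le> 1"
  shows "cmod (\<Sum>n\<in>A. g n * w ^ e n) \<le> (1 + 7 * real D ^ 2 / real Q) * B"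
proof -
  define c where "c k = (\<Sum>n | n \<in> A \<and> e n = k. g n)" for k
  have F: "(\<Sum>n\<in>A. g n * z ^ e n) = (\<Sum>k\<le>D. c k * z ^ k)" for z
  proof -
    have "(\<Sum>k\<le>D. \<Sum>n | n \<in> A \<and> e n = k. g n * z ^ e n) = (\<Sum>n\<in>A. g n * z ^ e n)"
      by (rule sum.group[OF fin]) (use e in auto)
    moreover have "(\<Sum>k\<le>D. \<Sum>n | n \<in> A \<and> e n = k. g n * z ^ e n) = (\<Sum>k\<le>D. c k * z ^ k)"
      unfolding c_def sum_distrib_right by (intro sum.cong refl) auto
    ultimately show ?thesis by (rule trans[OF sym])
  qed
  have c: "cmod (c k) \<le> B" if "k \<le> D" for k
    by (rule coeff_le_max_roots_of_unity[OF DQ _ that]) (use B in \<open>simp add: F\<close>)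
  have Q: "Q > 0" using DQ by simp
  have B0: "B \<ge> 0" using c[of 0] norm_ge_zero order_trans by blast
  have circle: "cmod (\<Sum>k\<le>D. c k * z ^ k) \<le> (1 + 7 * real D ^ 2 / real Q) * B" if z: "cmod z = 1" for z
  proof -
    obtain \<theta> where th: "z = cis (2 * pi * \<theta>)"
    proof
      show "z = cis (2 * pi * (Arg z / (2 * pi)))"
        using rcis_cmod_Arg[of z] z by (simp add: rcis_def)
    qed
    define r where "r = \<lfloor>\<theta> * real Q\<rfloor>"
    define \<omega> where "\<omega> = cis (2 * pi * (of_int r / real Q))"
    have "\<omega> ^ Q = cis (2 * pi * of_int r)" using Q by (simp add: \<omega>_def Complex.DeMoivre)
    then have wQ: "\<omega> ^ Q = 1" using cis_multiple_2pi[of "of_int r"] by simp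
    have "\<bar>\<theta> - of_int r / real Q\<bar> \<le> 1 / real Q"
    proof -
      have "\<bar>\<theta> * real Q - of_int r\<bar> \<le> 1" unfolding r_def by linarith
      moreover have "\<theta> - of_int r / real Q = (\<theta> * real Q - of_int r) / real Q" using Q by (simp add: field_simps)
      ultimately show ?thesis by (simp add: divide_right_mono)
    qed
    then have "2 * pi * \<bar>\<theta> - of_int r / real Q\<bar> \<le> 7 * (1 / real Q)"
      using pi_less_4 pi_approx by (intro mult_mono) auto
    moreover have "cmod (z - \<omega>) \<le> 2 * pi * \<bar>\<theta> - of_int r / real Q\<bar>"
      using norm_cis_diff_le[of "2 * pi * \<theta>" "2 * pi * (of_int r / real Q)"]
      unfolding th \<omega>_def right_diff_distrib[symmetric] by (simp add: abs_mult)
    ultimately have zw: "cmod (z - \<omega>) \<le> 7 / real Q" by simp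
    \<comment> \<open>The last factor drops k = 0: the constant term does not move, so the total is
      exactly D times the bound and not D + 1 times.\<close>
    have "cmod ((\<Sum>k\<le>D. c k * z ^ k) - (\<Sum>k\<le>D. c k * \<omega> ^ k)) \<le> (\<Sum>k\<le>D. B * (real D * (7 / real Q)) * (if k = 0 then 0 else 1))"
      unfolding sum_subtractf[symmetric] right_diff_distrib[symmetric]
    proof (rule sum_norm_le)
      fix k assume k: "k \<in> {..D}"
      have "cmod (z ^ k - \<omega> ^ k) \<le> real k * cmod (z - \<omega>)"
        by (rule norm_power_diff) (use z in \<open>auto simp: \<omega>_def\<close>)
      also have "\<dots> \<le> real D * (7 / real Q)" using k zw by (intro mult_mono) auto
      finally have "cmod (z ^ k - \<omega> ^ k) \<le> real D * (7 / real Q)" .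
      then show "cmod (c k * (z ^ k - \<omega> ^ k)) \<le> B * (real D * (7 / real Q)) * (if k = 0 then 0 else 1)"
        using mult_mono[OF c[of k] _ B0 norm_ge_zero, of "z ^ k - \<omega> ^ k" "real D * (7 / real Q)"] k by (cases "k = 0") (auto simp: norm_mult)
    qed
    also have "\<dots> = B * (real D * (7 / real Q)) * real D"
    proof -
      have "(\<Sum>k\<le>D. if k = 0 then 0 else 1 :: real) = real D" by (induction D) auto
      then show ?thesis unfolding sum_distrib_left[symmetric] by simp
    qed
    finally have "cmod ((\<Sum>k\<le>D. c k * z ^ k) - (\<Sum>k\<le>D. c k * \<omega> ^ k)) \<le> 7 * real D ^ 2 / real Q * B"
      by (simp add: power2_eq_square field_simps)
    moreover have "cmod (\<Sum>k\<le>D. c k * \<omega> ^ k) \<le> B" using B[OF wQ] by (simp add: F)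
    ultimately show ?thesis
      using norm_triangle_sub[of "\<Sum>k\<le>D. c k * z ^ k" "\<Sum>k\<le>D. c k * \<omega> ^ k"]
      by (simp add: distrib_right)
  qed
  have "cmod ((\<lambda>z. \<Sum>k\<le>D. c k * z ^ k) w) \<le> (1 + 7 * real D ^ 2 / real Q) * B"
  proof (rule maximum_modulus_frontier[where S = "cball 0 1" and f = "\<lambda>z. \<Sum>k\<le>D. c k * z ^ k"])
    show "(\<lambda>z. \<Sum>k\<le>D. c k * z ^ k) holomorphic_on interior (cball 0 1)" by (intro holomorphic_intros)
    show "continuous_on (closure (cball 0 1)) (\<lambda>z. \<Sum>k\<le>D. c k * z ^ k)" by (intro continuous_intros)
  qed (use w circle in auto)
  then show ?thesis by (simp add: F)
qed

text \<open>One variable is released at a time, each at the cost of one factor. For the new variable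
  held at a root of unity, its powers are absorbed into the coefficients; this is why the induction
  needs arbitrary \<open>b\<close>.\<close>

lemma polydisc_le_max_grid:
  fixes b :: "'b \<Rightarrow> complex" and e :: "'p \<Rightarrow> 'b \<Rightarrow> nat"
  assumes "finite S" and fin: "finite A" and e: "\<And>p n. p \<in> S \<Longrightarrow> n \<in> A \<Longrightarrow> e p n \<le> D" and DQ: "D < Q"
    and B: "\<And>\<zeta>. \<zeta> \<in> PiE S (\<lambda>_. {\<omega>. \<omega> ^ Q = 1}) \<Longrightarrow> cmod (\<Sum>n\<in>A. b n * (\<Prod>p\<in>S. \<zeta> p ^ e p n)) \<le> B"
    and z: "\<And>p. p \<in> S \<Longrightarrow> cmod (z p) \<le> 1"
  shows "cmod (\<Sum>n\<in>A. b n * (\<Prod>p\<in>S. z p ^ e p n)) \<le> (1 + 7 * real D ^ 2 / real Q) ^ card S * B"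
  using assms(1) e B z
proof (induction S arbitrary: b rule: finite_induct)
  case empty
  then show ?case by simp
next
  case (insert q S)
  let ?\<kappa> = "1 + 7 * real D ^ 2 / real Q"
  have 1: "cmod (\<Sum>n\<in>A. (b n * (\<Prod>p\<in>S. z p ^ e p n)) * \<omega> ^ e q n) \<le> ?\<kappa> ^ card S * B" if w: "\<omega> ^ Q = 1" for \<omega>
  proof -
    have "cmod (\<Sum>n\<in>A. (b n * \<omega> ^ e q n) * (\<Prod>p\<in>S. z p ^ e p n)) \<le> ?\<kappa> ^ card S * B"
    proof (rule insert.IH)
      fix \<zeta> :: "'p \<Rightarrow> complex" assume \<zeta>: "\<zeta> \<in> PiE S (\<lambda>_. {\<omega>. \<omega> ^ Q = 1})"
      have "\<zeta>(q := \<omega>) \<in> PiE (insert q S) (\<lambda>_. {\<omega>. \<omega> ^ Q = 1})"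
        using w by (intro PiE_fun_upd \<zeta>) simp
      from insert.prems(2)[OF this]
      have "cmod (\<Sum>n\<in>A. b n * (\<omega> ^ e q n * (\<Prod>p\<in>S. (\<zeta>(q := \<omega>)) p ^ e p n))) \<le> B"
        using insert.hyps by simp
      moreover have "(\<Prod>p\<in>S. (\<zeta>(q := \<omega>)) p ^ e p n) = (\<Prod>p\<in>S. \<zeta> p ^ e p n)" for n
        using insert.hyps by (intro prod.cong) auto
      ultimately show "cmod (\<Sum>n\<in>A. b n * \<omega> ^ e q n * (\<Prod>p\<in>S. \<zeta> p ^ e p n)) \<le> B"
        by (simp add: mult.assoc)
    qed (use insert.prems in auto)
    then show ?thesis by (simp add: mult_ac)
  qed
  have "cmod (\<Sum>n\<in>A. (b n * (\<Prod>p\<in>S. z p ^ e p n)) * z q ^ e q n) \<le> ?\<kappa> * (?\<kappa> ^ card S * B)"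
    by (rule poly_le_max_roots_of_unity[OF fin _ DQ 1]) (use insert.prems in auto)
  then show ?case using insert.hyps by (simp add: mult_ac)
qed

subsection \<open>Suprema of Rademacher sums\<close>

text \<open>Hoeffding's lemma for a fair sign: the auxiliary inequality with p = 1/2 and parameter 2
  c, multiplied through by exp (- c). Evenness covers negative c.\<close>

lemma cosh_le_exp_square: "(exp c + exp (- c)) / 2 \<le> exp (c\<^sup>2 / 2)" for c :: real
proof -
  have *: "(exp c + exp (- c)) / 2 \<le> exp (c\<^sup>2 / 2)" if "c \<ge> 0" for c :: real
  proof -
    have "- (2 * c) * (1 / 2) + ln (1 + 1 / 2 * (exp (2 * c) - 1)) \<le> (2 * c)\<^sup>2 / 8"
      by (rule Hoeffdings_lemma_aux) (use that in auto)
    then have "ln (1 + 1 / 2 * (exp (2 * c) - 1)) \<le> c + c\<^sup>2 / 2" by (simp add: power2_eq_square)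
    moreover have pos: "1 + 1 / 2 * (exp (2 * c) - 1) > 0"
      using exp_gt_zero[of "2 * c"] by (simp add: field_simps add_pos_pos)
    ultimately have "1 + 1 / 2 * (exp (2 * c) - 1) \<le> exp (c + c\<^sup>2 / 2)"
      using ln_ge_iff by (metis exp_le_cancel_iff exp_ln)
    then have "exp (- c) * ((1 + exp (2 * c)) / 2) \<le> exp (- c) * exp (c + c\<^sup>2 / 2)"
      by (intro mult_left_mono) (auto simp: field_simps)
    then show ?thesis by (simp add: distrib_left add_divide_distrib flip: exp_add)
  qed
  show ?thesis using *[of c] *[of "- c"] by (cases "c \<ge> 0") (auto simp: add.commute)
qed

text \<open>For choosing a threshold x: values y \<le> x are paid for by x^2, and the excess z = l
  (y - x) of larger ones enters through z \<le> exp z and z^2 / 2 \<le> exp z. A maximum of squares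
  is thereby dominated by a sum of exponentials, whose expectations are computable.\<close>

lemma square_le_exp:
  fixes x y l :: real
  assumes "x \<ge> 0" "y \<ge> 0" "l > 0"
  shows "y\<^sup>2 \<le> x\<^sup>2 + (2 * x / l + 2 / l\<^sup>2) * exp (- l * x) * exp (l * y)"
proof (cases "y \<le> x")
  case True
  then have "y\<^sup>2 \<le> x\<^sup>2" using assms by (intro power_mono)
  moreover have "0 \<le> (2 * x / l + 2 / l\<^sup>2) * exp (- l * x) * exp (l * y)"
    using assms by (intro mult_nonneg_nonneg add_nonneg_nonneg) auto
  ultimately show ?thesis by linarith
next
  case False
  define z where "z = l * (y - x)"
  have z: "z \<ge> 0" using False assms by (simp add: z_def)
  have e1: "z \<le> exp z" using exp_ge_add_one_self[of z] by linarith
  have e2: "z\<^sup>2 / 2 \<le> exp z" using exp_lower_Taylor_quadratic[OF z] z by linarith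
  have y: "y = x + z / l" using assms by (simp add: z_def)
  have "y\<^sup>2 = x\<^sup>2 + (2 * x / l) * z + 2 / l\<^sup>2 * (z\<^sup>2 / 2)"
    unfolding y using assms by (simp add: power2_eq_square field_simps)
  also have "\<dots> \<le> x\<^sup>2 + (2 * x / l) * exp z + 2 / l\<^sup>2 * exp z"
    using e1 e2 assms by (intro add_mono mult_left_mono) auto
  also have "\<dots> = x\<^sup>2 + (2 * x / l + 2 / l\<^sup>2) * exp z" by (simp add: algebra_simps)
  also have "exp z = exp (- l * x) * exp (l * y)" by (simp add: z_def exp_add[symmetric] algebra_simps)
  finally show ?thesis by (simp add: mult.assoc)
qed

context prob_space
begin

context
  fixes I :: "nat set" and \<epsilon> :: "nat \<Rightarrow> 'a \<Rightarrow> real"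
  assumes rad: "rademacher_family M I \<epsilon>"
begin

lemma rademacher_measurable: "n \<in> I \<Longrightarrow> \<epsilon> n \<in> borel_measurable M"
  using rad by (simp add: rademacher_family_def indep_vars_def)

lemma rademacher_prob:
  assumes "n \<in> I"
  shows "prob {\<omega> \<in> space M. \<epsilon> n \<omega> = 1} = 1 / 2" "prob {\<omega> \<in> space M. \<epsilon> n \<omega> = - 1} = 1 / 2"
  using rad assms unfolding rademacher_family_def by blast+

lemma rademacher_AE:
  assumes "n \<in> I" shows "AE \<omega> in M. \<epsilon> n \<omega> = 1 \<or> \<epsilon> n \<omega> = - 1"
proof -
  note [measurable] = rademacher_measurable[OF assms]
  have "prob {\<omega> \<in> space M. \<epsilon> n \<omega> = 1 \<or> \<epsilon> n \<omega> = - 1} =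
    prob ({\<omega> \<in> space M. \<epsilon> n \<omega> = 1} \<union> {\<omega> \<in> space M. \<epsilon> n \<omega> = - 1})"
    by (rule arg_cong[where f = prob]) auto
  also have "\<dots> = prob {\<omega> \<in> space M. \<epsilon> n \<omega> = 1} + prob {\<omega> \<in> space M. \<epsilon> n \<omega> = - 1}"
    by (rule finite_measure_Union) auto
  also have "\<dots> = 1" using rademacher_prob[OF assms] by simp
  finally show ?thesis by (subst (asm) prob_Collect_eq_1) auto
qed

lemma rademacher_mgf_single:
  assumes "n \<in> I"
  shows "(\<integral>\<^sup>+\<omega>. ennreal (exp (c * \<epsilon> n \<omega>)) \<partial>M) \<le> ennreal (exp (c\<^sup>2 / 2))"
proof -
  note [measurable] = rademacher_measurable[OF assms]
  have "(\<integral>\<^sup>+\<omega>. ennreal (exp (c * \<epsilon> n \<omega>)) \<partial>M) =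
    (\<integral>\<^sup>+\<omega>. ennreal (exp c) * indicator {\<omega> \<in> space M. \<epsilon> n \<omega> = 1} \<omega> + ennreal (exp (- c)) * indicator {\<omega> \<in> space M. \<epsilon> n \<omega> = - 1} \<omega> \<partial>M)"
    by (intro nn_integral_cong_AE) (use rademacher_AE[OF assms] AE_space in eventually_elim, auto simp: indicator_def)
  also have "\<dots> = ennreal (exp c) * emeasure M {\<omega> \<in> space M. \<epsilon> n \<omega> = 1} + ennreal (exp (- c)) * emeasure M {\<omega> \<in> space M. \<epsilon> n \<omega> = - 1}"
    by (subst nn_integral_add) (auto simp: nn_integral_cmult_indicator)
  also have "\<dots> = ennreal (exp c) * ennreal (1 / 2) + ennreal (exp (- c)) * ennreal (1 / 2)"
    using rademacher_prob[OF assms] by (simp only: emeasure_eq_measure)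
  also have "\<dots> = ennreal ((exp c + exp (- c)) / 2)"
  proof -
    have "ennreal (exp x) * ennreal (1 / 2) = ennreal (exp x / 2)" for x :: real
      by (metis ennreal_mult' exp_ge_zero times_divide_eq_right mult.right_neutral)
    then show ?thesis
      by (simp only:) (simp add: ennreal_plus[symmetric] add_divide_distrib del: ennreal_plus)
  qed
  also have "\<dots> \<le> ennreal (exp (c\<^sup>2 / 2))" by (intro ennreal_leI cosh_le_exp_square)
  finally show ?thesis .
qed

lemma rademacher_mgf:
  assumes fin: "finite A" and A: "A \<subseteq> I"
  shows "(\<integral>\<^sup>+\<omega>. ennreal (exp (\<Sum>n\<in>A. c n * \<epsilon> n \<omega>)) \<partial>M) \<le> ennreal (exp ((\<Sum>n\<in>A. (c n)\<^sup>2) / 2))"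
proof -
  have indep: "indep_vars (\<lambda>_. borel) \<epsilon> A"
    using rad A by (auto simp: rademacher_family_def intro: indep_vars_subset)
  have "(\<integral>\<^sup>+\<omega>. ennreal (exp (\<Sum>n\<in>A. c n * \<epsilon> n \<omega>)) \<partial>M) = (\<integral>\<^sup>+\<omega>. (\<Prod>n\<in>A. ennreal (exp (c n * \<epsilon> n \<omega>))) \<partial>M)"
    by (simp add: exp_sum fin prod_ennreal)
  also have "\<dots> = (\<Prod>n\<in>A. \<integral>\<^sup>+\<omega>. ennreal (exp (c n * \<epsilon> n \<omega>)) \<partial>M)"
    by (intro indep_vars_nn_integral fin indep_vars_compose2[OF indep]) auto
  also have "\<dots> \<le> (\<Prod>n\<in>A. ennreal (exp ((c n)\<^sup>2 / 2)))"
    using A by (intro prod_mono_ennreal rademacher_mgf_single) auto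
  also have "\<dots> = ennreal (exp ((\<Sum>n\<in>A. (c n)\<^sup>2) / 2))"
    by (simp add: prod_ennreal exp_sum[OF fin, symmetric] sum_divide_distrib)
  finally show ?thesis .
qed

text \<open>The majorant \<open>U\<close> is an explicit sum of exponentials, so that no supremum has to be measurable.\<close>

lemma rademacher_sup_bound:
  fixes c :: "'g \<Rightarrow> nat \<Rightarrow> complex"
  assumes fin: "finite A" and A: "A \<subseteq> I" and G: "finite G" "G \<noteq> {}"
    and \<beta>: "\<And>\<zeta> n. \<zeta> \<in> G \<Longrightarrow> n \<in> A \<Longrightarrow> cmod (c \<zeta> n) \<le> \<beta> n"
  defines "v \<equiv> \<Sum>n\<in>A. (\<beta> n)\<^sup>2"
  shows "\<exists>U. U \<in> borel_measurable M \<and> (\<forall>\<omega>. 0 \<le> U \<omega>) \<and>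
    (\<forall>\<zeta>\<in>G. \<forall>\<omega>. (cmod (\<Sum>n\<in>A. c \<zeta> n * of_real (\<epsilon> n \<omega>)))\<^sup>2 \<le> U \<omega>) \<and>
    (\<integral>\<^sup>+\<omega>. ennreal (U \<omega>) \<partial>M) \<le> ennreal (10 * v * ln (4 * real (card G)))"
proof (cases "v = 0")
  case True
  then have "\<beta> n = 0" if "n \<in> A" for n
    using that fin by (simp add: v_def sum_nonneg_eq_0_iff)
  then have "c \<zeta> n = 0" if "n \<in> A" "\<zeta> \<in> G" for n \<zeta>
    using \<beta>[OF that(2,1)] that by simp
  then show ?thesis using True by (intro exI[of _ "\<lambda>_. 0"]) simp
next
  case False
  note [measurable] = rademacher_measurable
  have v: "v > 0" using False sum_nonneg[of A "\<lambda>n. (\<beta> n)\<^sup>2"] unfolding v_def by (simp add: order_less_le)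
  \<comment> \<open>Four exponentials belong to each grid point: both signs of the real and of the
    imaginary part.\<close>
  define H where "H = 4 * real (card G)"
  have cG: "card G \<ge> 1" using G by (simp add: Suc_le_eq card_gt_0_iff)
  have H: "H \<ge> 4" using cG by (simp add: H_def)
  define l where "l = ln H"
  have "exp 1 \<le> (4::real)" using exp_le by linarith
  then have l: "l \<ge> 1" using H unfolding l_def by (subst ln_ge_iff) auto
  \<comment> \<open>With H = exp l, these values balance the estimate: each exponential has mean at
    most exp (\<mu>^2 v / 2) = exp l, while exp (- \<mu> x) = exp (-2 l), so H exp l exp (- \<mu> x)
    = 1 and only the prefactor 2 x / \<mu> + 2 / \<mu>^2 = 2 v + v / l is left.\<close>
  define x where "x = sqrt (2 * v * l)"
  define \<mu> where "\<mu> = sqrt (2 * l / v)"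
  have x: "x > 0" and \<mu>: "\<mu> > 0" using v l by (auto simp: x_def \<mu>_def)
  have \<mu>2: "\<mu>\<^sup>2 = 2 * l / v" using v l by (simp add: \<mu>_def)
  have x2: "x\<^sup>2 = 2 * v * l" using v l by (simp add: x_def)
  have \<mu>x: "\<mu> * x = 2 * l"
  proof -
    have "\<mu> * x = sqrt ((2 * l) * (2 * l))" unfolding \<mu>_def x_def real_sqrt_mult[symmetric] using v by simp
    then show ?thesis using l unfolding real_sqrt_abs2 by simp
  qed
  define k where "k = (2 * x / \<mu> + 2 / \<mu>\<^sup>2) * exp (- \<mu> * x)"
  have k0: "k \<ge> 0" unfolding k_def using x \<mu> by (intro mult_nonneg_nonneg add_nonneg_nonneg) auto
  define X where "X \<phi> \<zeta> \<omega> = (\<Sum>n\<in>A. \<phi> (c \<zeta> n) * \<epsilon> n \<omega>)" for \<phi> :: "complex \<Rightarrow> real" and \<zeta> \<omega>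
  have X[measurable]: "X \<phi> \<zeta> \<in> borel_measurable M" for \<phi> \<zeta>
    unfolding X_def using A by (intro borel_measurable_sum) (auto intro!: borel_measurable_times rademacher_measurable)
  define S where "S \<omega> = (\<Sum>\<zeta>\<in>G. \<Sum>\<phi>\<in>{Re, Im}. exp (\<mu> * X \<phi> \<zeta> \<omega>) + exp (- \<mu> * X \<phi> \<zeta> \<omega>))" for \<omega>
  have S[measurable]: "S \<in> borel_measurable M" unfolding S_def by measurable
  have S0: "S \<omega> \<ge> 0" for \<omega> unfolding S_def by (intro sum_nonneg add_nonneg_nonneg) auto
  have pt: "(X \<phi> \<zeta> \<omega>)\<^sup>2 \<le> x\<^sup>2 + k * S \<omega>" if "\<zeta> \<in> G" "\<phi> \<in> {Re, Im}" for \<phi> \<zeta> \<omega>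
  proof -
    have "(X \<phi> \<zeta> \<omega>)\<^sup>2 = \<bar>X \<phi> \<zeta> \<omega>\<bar>\<^sup>2" by simp
    also have "\<dots> \<le> x\<^sup>2 + k * exp (\<mu> * \<bar>X \<phi> \<zeta> \<omega>\<bar>)"
      unfolding k_def by (rule square_le_exp) (use x \<mu> in auto)
    also have "exp (\<mu> * \<bar>X \<phi> \<zeta> \<omega>\<bar>) \<le> exp (\<mu> * X \<phi> \<zeta> \<omega>) + exp (- \<mu> * X \<phi> \<zeta> \<omega>)"
      by (simp add: abs_if)
    also have "\<dots> \<le> (\<Sum>\<phi>\<in>{Re, Im}. exp (\<mu> * X \<phi> \<zeta> \<omega>) + exp (- \<mu> * X \<phi> \<zeta> \<omega>))"
      using that(2) by (intro member_le_sum) (auto intro: add_nonneg_nonneg)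
    also have "\<dots> \<le> S \<omega>"
      unfolding S_def using that(1) G by (intro member_le_sum sum_nonneg add_nonneg_nonneg) auto
    finally show ?thesis using k0 by (simp add: mult_left_mono)
  qed
  have mgf: "(\<integral>\<^sup>+\<omega>. ennreal (exp (s * X \<phi> \<zeta> \<omega>)) \<partial>M) \<le> ennreal (exp l)" if "\<zeta> \<in> G" "\<phi> \<in> {Re, Im}" "s\<^sup>2 = \<mu>\<^sup>2" for s \<phi> \<zeta>
  proof -
    have "(\<integral>\<^sup>+\<omega>. ennreal (exp (s * X \<phi> \<zeta> \<omega>)) \<partial>M) = (\<integral>\<^sup>+\<omega>. ennreal (exp (\<Sum>n\<in>A. (s * \<phi> (c \<zeta> n)) * \<epsilon> n \<omega>)) \<partial>M)"
      by (simp add: X_def sum_distrib_left mult.assoc)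
    also have "\<dots> \<le> ennreal (exp ((\<Sum>n\<in>A. (s * \<phi> (c \<zeta> n))\<^sup>2) / 2))" by (rule rademacher_mgf[OF fin A])
    also have "(\<Sum>n\<in>A. (s * \<phi> (c \<zeta> n))\<^sup>2) \<le> (\<Sum>n\<in>A. \<mu>\<^sup>2 * (\<beta> n)\<^sup>2)"
    proof (rule sum_mono)
      fix n assume n: "n \<in> A"
      have "\<bar>\<phi> (c \<zeta> n)\<bar> \<le> cmod (c \<zeta> n)" using that(2) abs_Re_le_cmod abs_Im_le_cmod by auto
      also have "\<dots> \<le> \<beta> n" by (rule \<beta>[OF that(1) n])
      finally have "(\<phi> (c \<zeta> n))\<^sup>2 \<le> (\<beta> n)\<^sup>2" using power_mono[of "\<bar>\<phi> (c \<zeta> n)\<bar>" "\<beta> n" 2] by simp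
      then show "(s * \<phi> (c \<zeta> n))\<^sup>2 \<le> \<mu>\<^sup>2 * (\<beta> n)\<^sup>2"
        unfolding power_mult_distrib that(3) by (intro mult_left_mono) auto
    qed
    also have "\<dots> = \<mu>\<^sup>2 * v" by (simp add: v_def sum_distrib_left)
    also have "\<dots> = 2 * l" using v by (simp add: \<mu>2)
    finally show ?thesis by (simp add: ennreal_leI)
  qed
  have "(\<integral>\<^sup>+\<omega>. ennreal (S \<omega>) \<partial>M) = (\<Sum>\<zeta>\<in>G. \<Sum>\<phi>\<in>{Re, Im}. (\<integral>\<^sup>+\<omega>. ennreal (exp (\<mu> * X \<phi> \<zeta> \<omega>)) \<partial>M) + (\<integral>\<^sup>+\<omega>. ennreal (exp (- \<mu> * X \<phi> \<zeta> \<omega>)) \<partial>M))"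
  proof -
    have "ennreal (S \<omega>) = (\<Sum>\<zeta>\<in>G. \<Sum>\<phi>\<in>{Re, Im}. ennreal (exp (\<mu> * X \<phi> \<zeta> \<omega>)) + ennreal (exp (- \<mu> * X \<phi> \<zeta> \<omega>)))" for \<omega>
    proof -
      have "ennreal (S \<omega>) = (\<Sum>\<zeta>\<in>G. ennreal (\<Sum>\<phi>\<in>{Re, Im}. exp (\<mu> * X \<phi> \<zeta> \<omega>) + exp (- \<mu> * X \<phi> \<zeta> \<omega>)))"
        unfolding S_def by (rule sum_ennreal[symmetric]) (intro sum_nonneg add_nonneg_nonneg, auto)
      also have "\<dots> = (\<Sum>\<zeta>\<in>G. \<Sum>\<phi>\<in>{Re, Im}. ennreal (exp (\<mu> * X \<phi> \<zeta> \<omega>) + exp (- \<mu> * X \<phi> \<zeta> \<omega>)))"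
        by (intro sum.cong refl sum_ennreal[symmetric] add_nonneg_nonneg) auto
      finally show ?thesis by simp
    qed
    then show ?thesis by (simp add: nn_integral_sum nn_integral_add)
  qed
  also have "\<dots> \<le> (\<Sum>\<zeta>\<in>G. \<Sum>\<phi>\<in>{Re, Im}. ennreal (exp l) + ennreal (exp l))"
    by (intro sum_mono add_mono mgf) auto
  also have "\<dots> = ennreal (H * exp l)"
  proof -
    have "Re \<noteq> Im" by (metis complex.sel zero_neq_one)
    then have "(\<Sum>\<zeta>\<in>G. \<Sum>\<phi>\<in>{Re, Im}. ennreal (exp l) + ennreal (exp l)) = of_nat (card G) * (4 * ennreal (exp l))"
      using distrib_right[of 2 2 "ennreal (exp l)"] by (simp add: mult_2[symmetric])
    also have "\<dots> = ennreal (real (card G)) * (ennreal 4 * ennreal (exp l))"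
      by (simp add: ennreal_of_nat_eq_real_of_nat)
    also have "\<dots> = ennreal (H * exp l)"
      by (simp only: ennreal_mult'[symmetric] exp_ge_zero mult_nonneg_nonneg H_def) (simp add: mult_ac)
    finally show ?thesis .
  qed
  finally have ES: "(\<integral>\<^sup>+\<omega>. ennreal (S \<omega>) \<partial>M) \<le> ennreal (H * exp l)" .
  \<comment> \<open>The factor 2 adds the squares of real and imaginary part. In expectation this
    gives at most 4 v l + 6 v, and l \<ge> 1 turns it into 10 v l.\<close>
  define U where "U \<omega> = 2 * (x\<^sup>2 + k * S \<omega>)" for \<omega>
  show ?thesis
  proof (intro exI[of _ U] conjI allI ballI)
    show "U \<in> borel_measurable M" unfolding U_def by measurable
    show "0 \<le> U \<omega>" for \<omega> unfolding U_def using S0[of \<omega>] k0 by simp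
    show "(cmod (\<Sum>n\<in>A. c \<zeta> n * of_real (\<epsilon> n \<omega>)))\<^sup>2 \<le> U \<omega>" if "\<zeta> \<in> G" for \<zeta> \<omega>
      using pt[OF that, of Re \<omega>] pt[OF that, of Im \<omega>]
      unfolding U_def X_def cmod_power2 by (simp add: Re_sum Im_sum)
    have "(\<integral>\<^sup>+\<omega>. ennreal (U \<omega>) \<partial>M) = (\<integral>\<^sup>+\<omega>. ennreal (2 * x\<^sup>2) + ennreal (2 * k) * ennreal (S \<omega>) \<partial>M)"
      using S0 k0 by (intro nn_integral_cong) (simp add: U_def ennreal_mult'[symmetric] ennreal_plus[symmetric] distrib_left mult.assoc del: ennreal_plus)
    also have "\<dots> = ennreal (2 * x\<^sup>2) + ennreal (2 * k) * (\<integral>\<^sup>+\<omega>. ennreal (S \<omega>) \<partial>M)"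
      by (simp add: nn_integral_add nn_integral_cmult emeasure_space_1)
    also have "\<dots> \<le> ennreal (2 * x\<^sup>2) + ennreal (2 * k) * ennreal (H * exp l)"
      by (intro add_left_mono mult_left_mono ES) auto
    also have "\<dots> = ennreal (2 * x\<^sup>2 + 2 * k * (H * exp l))"
      using k0 H by (simp add: ennreal_mult'[symmetric] ennreal_plus[symmetric] del: ennreal_plus)
    also have "2 * x\<^sup>2 + 2 * k * (H * exp l) \<le> 10 * v * ln (4 * real (card G))"
    proof -
      have "H * exp l * exp (- \<mu> * x) = 1"
      proof -
        have "H = exp l" using H by (simp add: l_def)
        then show ?thesis using \<mu>x by (simp add: exp_add[symmetric])
      qed
      then have "k * (H * exp l) = 2 * x / \<mu> + 2 / \<mu>\<^sup>2"
        unfolding k_def by (metis mult.assoc mult.commute mult.right_neutral)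
      also have "2 * x / \<mu> = 2 * v"
      proof -
        have "x = v * \<mu>"
          using \<mu>x \<mu>2 \<mu> v by (metis (no_types, opaque_lifting) mult.commute mult.left_commute mult_cancel_left nonzero_mult_div_cancel_left order_less_irrefl power2_eq_square times_divide_eq_right)
        then show ?thesis using \<mu> by simp
      qed
      also have "2 / \<mu>\<^sup>2 = v / l" using v l by (simp add: \<mu>2)
      also have "v / l \<le> v" using v l by (simp add: divide_le_eq)
      finally have "k * (H * exp l) \<le> 3 * v" by simp
      moreover have "3 * v \<le> 3 * v * l" using v l by simp
      ultimately show ?thesis using x2 by (simp add: l_def H_def)
    qed
    finally show "(\<integral>\<^sup>+\<omega>. ennreal (U \<omega>) \<partial>M) \<le> ennreal (10 * v * ln (4 * real (card G)))"
      by (simp add: ennreal_leI)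
  qed
qed

text \<open>Orthogonality would give the constant 1. The maximal inequality over a one-point grid
  gives 10 ln 4 \<le> 20 with no further computation.\<close>

lemma rademacher_second_moment:
  fixes c :: "nat \<Rightarrow> complex"
  assumes fin: "finite A" and A: "A \<subseteq> I"
  shows "(\<integral>\<^sup>+\<omega>. ennreal ((cmod (\<Sum>n\<in>A. c n * of_real (\<epsilon> n \<omega>)))\<^sup>2) \<partial>M) \<le> ennreal (20 * (\<Sum>n\<in>A. (cmod (c n))\<^sup>2))"
proof -
  obtain U where U: "\<forall>\<omega>. (cmod (\<Sum>n\<in>A. c n * of_real (\<epsilon> n \<omega>)))\<^sup>2 \<le> U \<omega>"
    "(\<integral>\<^sup>+\<omega>. ennreal (U \<omega>) \<partial>M) \<le> ennreal (10 * (\<Sum>n\<in>A. (cmod (c n))\<^sup>2) * ln 4)"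
    using rademacher_sup_bound[OF fin A, of "{()}" "\<lambda>_. c" "\<lambda>n. cmod (c n)"] by auto
  have "(\<integral>\<^sup>+\<omega>. ennreal ((cmod (\<Sum>n\<in>A. c n * of_real (\<epsilon> n \<omega>)))\<^sup>2) \<partial>M) \<le> (\<integral>\<^sup>+\<omega>. ennreal (U \<omega>) \<partial>M)"
    using U(1) by (intro nn_integral_mono ennreal_leI) auto
  also note U(2)
  also have "10 * (\<Sum>n\<in>A. (cmod (c n))\<^sup>2) * ln 4 \<le> 20 * (\<Sum>n\<in>A. (cmod (c n))\<^sup>2)"
  proof -
    have "ln 4 = 2 * ln (2::real)" using ln_realpow[of 2 2] by simp
    then have "ln (4::real) \<le> 2" using ln_2_less_1 by simp
    then have "10 * (\<Sum>n\<in>A. (cmod (c n))\<^sup>2) * ln 4 \<le> 10 * (\<Sum>n\<in>A. (cmod (c n))\<^sup>2) * 2"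
      by (intro mult_left_mono) (auto intro: sum_nonneg)
    then show ?thesis by simp
  qed
  finally show ?thesis by (simp add: ennreal_leI)
qed

end

end

subsection \<open>Weights at the scales $e^{2^k}$\<close>

text \<open>Among positive n, scale J \<ge> 1 means exp (2^(J-1)) < n \<le> exp (2^J), so ln n and
  2^J agree up to a factor 2; n = 1 and n = 2 fall into scale 0.\<close>

definition log_scale :: "nat \<Rightarrow> nat" where
  "log_scale n = (LEAST J. ln (real n) \<le> 2 ^ J)"

lemma ln_le_scale: "ln (real n) \<le> 2 ^ log_scale n"
proof -
  obtain J where "ln (real n) < 2 ^ J" using real_arch_pow[of 2] by auto
  then have "ln (real n) \<le> 2 ^ J" by simp
  then show ?thesis unfolding log_scale_def by (rule LeastI[where P = "\<lambda>J. ln (real n) \<le> 2 ^ J"])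
qed

lemma scale_le_iff: "log_scale n \<le> J \<longleftrightarrow> ln (real n) \<le> 2 ^ J"
proof
  assume "log_scale n \<le> J"
  then have "(2::real) ^ log_scale n \<le> 2 ^ J" by (intro power_increasing) auto
  with ln_le_scale[of n] show "ln (real n) \<le> 2 ^ J" by (rule order_trans)
next
  assume "ln (real n) \<le> 2 ^ J"
  then show "log_scale n \<le> J" unfolding log_scale_def by (rule Least_le[where P = "\<lambda>J. ln (real n) \<le> 2 ^ J"])
qed

lemma scale_le_ln:
  assumes "n \<ge> 2" shows "2 ^ log_scale n \<le> 2 * ln (real n)"
proof (cases "log_scale n")
  case 0
  have "1 \<le> 2 * ln (2::real)" using ln2_ge_two_thirds by simp
  also have "\<dots> \<le> 2 * ln (real n)" using assms by simp
  finally show ?thesis using 0 by simp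
next
  case (Suc J)
  then have "\<not> log_scale n \<le> J" by simp
  then have "2 ^ J < ln (real n)" unfolding scale_le_iff by simp
  then show ?thesis unfolding Suc power_Suc by linarith
qed

lemma scale_pos: assumes "n \<ge> 3" shows "log_scale n \<ge> 1"
proof -
  have "exp 1 < (3::real)" using e_less_272 by simp
  then have "ln (exp 1) < ln (3::real)" by (subst ln_less_cancel_iff) auto
  then have "1 < ln (3::real)" by simp
  also have "\<dots> \<le> ln (real n)" using assms by simp
  finally have "\<not> log_scale n \<le> 0" unfolding scale_le_iff by simp
  then show ?thesis by simp
qed

definition scale_count :: "nat set \<Rightarrow> nat \<Rightarrow> nat" where
  "scale_count P k = prime_count_in P (exp (2 ^ k))"

text \<open>Up to a constant, the integral of \<open>thin_integrand P\<close> over \<open>{exp (2 ^ k)..exp (2 ^ Suc k)}\<close> is at least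
  \<open>scale_weight P k\<close>.\<close>

definition scale_weight :: "nat set \<Rightarrow> nat \<Rightarrow> real" where
  "scale_weight P k = real (k + 1) * real (scale_count P k) / 4 ^ k"

lemma scale_weight_nonneg: "scale_weight P k \<ge> 0"
  by (simp add: scale_weight_def)

lemma finite_primes_le: "finite {p \<in> P. real p \<le> x}"
  by (rule finite_subset[of _ "{..nat \<lfloor>x\<rfloor>}"]) (auto simp: le_nat_floor)

lemma prime_count_in_mono: "x \<le> y \<Longrightarrow> prime_count_in P x \<le> prime_count_in P y"
  unfolding prime_count_in_def by (intro card_mono finite_primes_le) auto

section \<open>Comparison of the scale weights with the weight sequence\<close>

lemma integral_inverse_x_ln_cubed:
  fixes a b :: real
  assumes "1 < a" "a \<le> b"
  shows "set_integrable lborel {a..b} (\<lambda>x. 1 / (x * ln x ^ 3))"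
    and "(LINT x:{a..b}|lborel. 1 / (x * ln x ^ 3)) = 1 / (2 * ln a ^ 2) - 1 / (2 * ln b ^ 2)"
proof -
  have d: "((\<lambda>x. - 1 / (2 * ln x ^ 2)) has_real_derivative 1 / (x * ln x ^ 3)) (at x)" if "x \<ge> a" for x
  proof -
    have "x > 1" using that assms by simp
    then have "x > 0" "ln x > 0" by auto
    then show ?thesis
      by (auto intro!: derivative_eq_intros simp: field_simps power2_eq_square power3_eq_cube)
  qed
  have c: "isCont (\<lambda>x. 1 / (x * ln x ^ 3)) x" if "x \<ge> a" for x
    using that assms by (intro continuous_intros) auto
  have hb: "has_bochner_integral lborel (\<lambda>x. 1 / (x * ln x ^ 3) * indicator {a..b} x)
     ((- 1 / (2 * ln b ^ 2)) - (- 1 / (2 * ln a ^ 2)))"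
    using d c assms by (intro has_bochner_integral_FTC_Icc_real) auto
  show "set_integrable lborel {a..b} (\<lambda>x. 1 / (x * ln x ^ 3))"
    using hb unfolding has_bochner_integral_iff set_integrable_def real_scaleR_def by (simp only: mult.commute)
  show "(LINT x:{a..b}|lborel. 1 / (x * ln x ^ 3)) = 1 / (2 * ln a ^ 2) - 1 / (2 * ln b ^ 2)"
    using hb unfolding has_bochner_integral_iff set_lebesgue_integral_def real_scaleR_def by (simp only: mult.commute)
qed

lemma thin_integrand_nonneg: assumes "x \<ge> 3" shows "thin_integrand P x \<ge> 0"
proof -
  have "exp 1 \<le> x" using e_less_272 assms by linarith
  then have "1 \<le> ln x" using assms by (subst ln_ge_iff) auto
  then show ?thesis using assms unfolding thin_integrand_def by (intro divide_nonneg_nonneg mult_nonneg_nonneg) auto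
qed

context
  fixes P :: "nat set"
  assumes ut: "ultra_thin P"
begin

lemma thin_integrable: "a \<ge> 3 \<Longrightarrow> A \<subseteq> {a..} \<Longrightarrow> A \<in> sets borel \<Longrightarrow> set_integrable lborel A (thin_integrand P)"
  using ut unfolding ultra_thin_def by (elim set_integrable_subset) auto

text \<open>Between exp (2^k) and exp (2^(k+1)) the counting function is at least its value at the
  left end, ln (ln x) \<ge> k ln 2, and 1 / (x ln^3 x) has integral (3/8) / 4^k. The hypothesis k
  \<ge> 1 allows k + 1 \<le> 2 k; with ln 2 \<ge> 2/3 this yields the factor 1/8. It also places the
  interval beyond 3.\<close>

lemma thin_tail_step:
  assumes k: "k \<ge> 1"
  shows "scale_weight P k / 8 + (LINT x:{exp (2 ^ Suc k)..}|lborel. thin_integrand P x)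
      \<le> (LINT x:{exp (2 ^ k)..}|lborel. thin_integrand P x)"
proof -
  define a :: real where "a = exp (2 ^ k)"
  define b :: real where "b = exp (2 ^ Suc k)"
  have "(2::real) ^ 1 \<le> 2 ^ k" using k by (intro power_increasing) auto
  then have "a \<ge> exp 2" unfolding a_def by simp
  moreover have "(3::real) \<le> exp 2" using exp_ge_add_one_self[of 2] by simp
  ultimately have a3: "a \<ge> 3" by simp
  have ab: "a \<le> b" unfolding a_def b_def by simp
  have lna: "ln a = 2 ^ k" and lnb: "ln b = 2 ^ Suc k" by (simp_all add: a_def b_def)
  define c where "c = real (scale_count P k) * (real k * ln 2)"
  have low: "scale_weight P k / 8 \<le> (LINT x:{a..b}|lborel. thin_integrand P x)"
  proof -
    have e: "1 / (2 * ln a ^ 2) - 1 / (2 * ln b ^ 2) = (3 / 8) / 4 ^ k"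
    proof -
      have "ln a ^ 2 = 4 ^ k" "ln b ^ 2 = 4 * 4 ^ k"
        by (simp_all add: lna lnb power2_eq_square flip: power_mult_distrib)
      then show ?thesis by (simp add: field_simps)
    qed
    have L: "(LINT x:{a..b}|lborel. 1 / (x * ln x ^ 3)) = (3 / 8) / 4 ^ k"
      by (rule trans[OF integral_inverse_x_ln_cubed(2) e]) (use a3 ab in auto)
    have "c * ((3 / 8) / 4 ^ k) = c * (LINT x:{a..b}|lborel. 1 / (x * ln x ^ 3))"
      by (simp only: L)
    also have "\<dots> = (LINT x:{a..b}|lborel. c * (1 / (x * ln x ^ 3)))"
      by (rule set_integral_mult_right[symmetric])
    also have "\<dots> \<le> (LINT x:{a..b}|lborel. thin_integrand P x)"
    proof (rule set_integral_mono)
      show "set_integrable lborel {a..b} (\<lambda>x. c * (1 / (x * ln x ^ 3)))"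
        using a3 ab by (intro set_integrable_mult_right integral_inverse_x_ln_cubed) auto
      show "set_integrable lborel {a..b} (thin_integrand P)"
        using a3 by (intro thin_integrable[of a]) auto
      fix x assume x: "x \<in> {a..b}"
      have lx: "2 ^ k \<le> ln x" using x a3 by (simp add: lna[symmetric])
      then have lx0: "ln x > 0" by (rule order.strict_trans2[rotated]) simp
      have "ln (2 ^ k) \<le> ln (ln x)" using lx lx0 by (intro ln_mono) auto
      then have "real k * ln 2 \<le> ln (ln x)" by (simp add: ln_realpow)
      moreover have "real (scale_count P k) \<le> real (prime_count_in P x)"
        unfolding scale_count_def using x by (intro of_nat_mono prime_count_in_mono) (auto simp: a_def)
      ultimately have "c \<le> real (prime_count_in P x) * ln (ln x)"
        unfolding c_def by (intro mult_mono) auto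
      then show "c * (1 / (x * ln x ^ 3)) \<le> thin_integrand P x"
        unfolding thin_integrand_def using lx0 x a3 by (auto intro!: divide_right_mono)
    qed
    finally have "c * ((3 / 8) / 4 ^ k) \<le> (LINT x:{a..b}|lborel. thin_integrand P x)" .
    moreover have "scale_weight P k / 8 \<le> c * ((3 / 8) / 4 ^ k)"
    proof -
      have "(real k + 1) / 8 \<le> real k * (2 / 3) * (3 / 8)" using k by (simp add: field_simps)
      also have "\<dots> \<le> real k * ln 2 * (3 / 8)" using ln2_ge_two_thirds by (intro mult_right_mono mult_left_mono) auto
      finally have "(real k + 1) / 8 * (real (scale_count P k) / 4 ^ k) \<le> real k * ln 2 * (3 / 8) * (real (scale_count P k) / 4 ^ k)"
        by (intro mult_right_mono) auto
      then show ?thesis by (simp add: scale_weight_def c_def field_simps)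
    qed
    ultimately show ?thesis by simp
  qed
  have "{a..b} \<union> {b..} = {a..}" using ab by auto
  then have "(LINT x:{a..}|lborel. thin_integrand P x) = (LINT x:{a..b} \<union> {b..}|lborel. thin_integrand P x)"
    by (simp only:)
  also have "\<dots> = (LINT x:{a..b}|lborel. thin_integrand P x) + (LINT x:{b..}|lborel. thin_integrand P x)"
  proof (rule set_integral_Un_AE)
    have "AE x in lborel. x \<noteq> b" by (rule AE_lborel_singleton)
    then show "AE x in lborel. \<not> (x \<in> {a..b} \<and> x \<in> {b..})" by eventually_elim auto
  qed (use a3 ab in \<open>auto intro: thin_integrable[of a]\<close>)
  finally have "scale_weight P k / 8 + (LINT x:{b..}|lborel. thin_integrand P x) \<le> (LINT x:{a..}|lborel. thin_integrand P x)"
    using low by linarith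
  then show ?thesis unfolding a_def b_def .
qed

lemma thin_tail_nonneg: "a \<ge> 3 \<Longrightarrow> 0 \<le> (LINT x:{a..}|lborel. thin_integrand P x)"
  unfolding set_lebesgue_integral_def
  by (intro integral_nonneg_AE AE_I2) (auto simp: indicator_def thin_integrand_nonneg)

text \<open>\<open>thin_tail_step\<close> telescopes, and the integral from exp (2^J) on is part of
  the one from n on. Leaving J free above \<open>log_scale n\<close> lets n = 3, J = 1 give
  summability of all scale weights.\<close>

lemma sum_scale_weight_le:
  assumes n: "n \<ge> 3" "log_scale n \<le> J"
  shows "(\<Sum>k<K. scale_weight P (k + J)) \<le> 8 * weight_seq P n"
proof -
  have J: "J \<ge> 1" using scale_pos[OF n(1)] n(2) by simp
  let ?T = "\<lambda>a. (LINT x:{a..}|lborel. thin_integrand P x)"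
  have "(\<Sum>k<K. scale_weight P (k + J) / 8) + ?T (exp (2 ^ (K + J))) \<le> ?T (exp (2 ^ J))"
  proof (induction K)
    case (Suc K)
    have "scale_weight P (K + J) / 8 + ?T (exp (2 ^ (Suc K + J))) \<le> ?T (exp (2 ^ (K + J)))"
      using thin_tail_step[of "K + J"] J by (simp only: add_Suc)
    then show ?case unfolding sum.lessThan_Suc using Suc.IH by linarith
  next
    case 0
    show ?case by (simp only: lessThan_0 sum.empty add_0)
  qed
  moreover have "?T (exp (2 ^ (K + J))) \<ge> 0"
  proof (rule thin_tail_nonneg)
    have "(2::real) ^ 1 \<le> 2 ^ (K + J)" using J by (intro power_increasing) auto
    then have "exp 2 \<le> exp ((2::real) ^ (K + J))" by simp
    moreover have "(3::real) \<le> exp 2" using exp_ge_add_one_self[of 2] by simp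
    ultimately show "exp (2 ^ (K + J)) \<ge> (3::real)" by (rule order_trans[rotated])
  qed
  moreover have "?T (exp (2 ^ J)) \<le> ?T (real n)"
  proof -
    have ne: "real n \<le> exp (2 ^ J)"
      using n scale_le_iff[of n J] by (metis exp_le_cancel_iff exp_ln not_numeral_le_zero of_nat_0_less_iff zero_less_iff_neq_zero le_zero_eq)
    show ?thesis
      unfolding set_lebesgue_integral_def
    proof (rule integral_mono)
      show "integrable lborel (\<lambda>x. indicator {exp (2 ^ J)..} x *\<^sub>R thin_integrand P x)"
        "integrable lborel (\<lambda>x. indicator {real n..} x *\<^sub>R thin_integrand P x)"
        using thin_integrable[of "real n"] n ne by (auto simp: set_integrable_def)
      show "indicator {exp (2 ^ J)..} x *\<^sub>R thin_integrand P x \<le> indicator {real n..} x *\<^sub>R thin_integrand P x" for x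
        using n ne thin_integrand_nonneg[of x P] by (auto simp: indicator_def)
    qed
  qed
  ultimately have "(\<Sum>k<K. scale_weight P (k + J) / 8) \<le> weight_seq P n"
  proof -
    have "weight_seq P n = ?T (real n)" unfolding weight_seq_def by (rule if_not_P) (use n in simp)
    moreover assume "0 \<le> ?T (exp (2 ^ (K + J)))" "?T (exp (2 ^ J)) \<le> ?T (real n)"
      "(\<Sum>k<K. scale_weight P (k + J) / 8) + ?T (exp (2 ^ (K + J))) \<le> ?T (exp (2 ^ J))"
    ultimately show ?thesis by linarith
  qed
  then show ?thesis unfolding sum_divide_distrib[symmetric] by linarith
qed

lemma summable_scale_weight: "summable (scale_weight P)"
proof -
  have "ln (3::real) \<le> 2 ^ 1" using ln_le_minus_one[of 3] by simp
  then have s3: "log_scale 3 \<le> 1" unfolding scale_le_iff of_nat_numeral .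
  have "summable (\<lambda>k. scale_weight P (k + 1))"
  proof (rule bounded_imp_summable)
    show "0 \<le> scale_weight P (k + 1)" for k by (rule scale_weight_nonneg)
    show "(\<Sum>k\<le>K. scale_weight P (k + 1)) \<le> 8 * weight_seq P 3" for K
      unfolding lessThan_Suc_atMost[symmetric] by (rule sum_scale_weight_le[OF order_refl s3])
  qed
  then show ?thesis using summable_iff_shift[of "scale_weight P" 1] by blast
qed

lemma weight_seq_nonneg: "weight_seq P n \<ge> 0"
  using thin_tail_nonneg[of "real n"] by (auto simp: weight_seq_def)

text \<open>The only passage from the scales back to w_n. For n = 2 the scale is 0 and w_2 = 1 by
  convention, so the full sum of the scale weights is added to the constant.\<close>

lemma tail_scale_weight_le:
  assumes "n \<ge> 2"
  shows "(\<Sum>k. scale_weight P (k + log_scale n)) \<le> (8 + (\<Sum>k. scale_weight P k)) * weight_seq P n"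
proof (cases "n \<ge> 3")
  case True
  have W: "(\<Sum>k. scale_weight P k) \<ge> 0" by (intro suminf_nonneg summable_scale_weight scale_weight_nonneg)
  have s: "summable (\<lambda>k. scale_weight P (k + log_scale n))"
    by (rule summable_ignore_initial_segment[OF summable_scale_weight])
  have "(\<Sum>k. scale_weight P (k + log_scale n)) \<le> 8 * weight_seq P n"
    by (rule suminf_le_const[OF s]) (rule sum_scale_weight_le[OF True order_refl])
  also have "\<dots> \<le> (8 + (\<Sum>k. scale_weight P k)) * weight_seq P n"
    using W weight_seq_nonneg by (intro mult_right_mono) auto
  finally show ?thesis .
next
  case False
  then have n: "n = 2" using assms by simp
  have "log_scale 2 = 0" using ln_2_less_1 scale_le_iff[of 2 0] by simp
  then show ?thesis by (simp add: n weight_seq_def)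
qed

end

subsection \<open>Suprema of random Dirichlet polynomials\<close>

text \<open>From 2 ^ multiplicity \<le> n and ln 2 \<ge> 1/2: a degree bound in each prime variable
  that does not depend on the prime.\<close>

lemma multiplicity_le_of_ln_le:
  fixes n p :: nat
  assumes "n > 0" "ln (real n) \<le> 2 ^ j" "p \<ge> 2"
  shows "multiplicity p n \<le> 2 ^ Suc j"
proof -
  have "p ^ multiplicity p n \<le> n" using assms by (intro dvd_imp_le multiplicity_dvd) auto
  then have "2 ^ multiplicity p n \<le> n" using assms by (meson order_trans power_mono zero_le)
  then have "(2::real) ^ multiplicity p n \<le> real n" by (metis of_nat_le_iff of_nat_numeral of_nat_power)
  then have "ln ((2::real) ^ multiplicity p n) \<le> ln (real n)" using assms by (intro ln_mono) auto
  then have 1: "real (multiplicity p n) * ln 2 \<le> 2 ^ j" using assms by (simp add: ln_realpow)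
  have "real (multiplicity p n) * (1 / 2) \<le> real (multiplicity p n) * ln 2"
    using ln2_ge_two_thirds by (intro mult_left_mono) auto
  then have "real (multiplicity p n) \<le> 2 ^ Suc j" using 1 by simp
  then have "real (multiplicity p n) \<le> real (2 ^ Suc j)" by simp
  then show ?thesis by (simp only: of_nat_le_iff)
qed

text \<open>Bohr's correspondence, which makes a Dirichlet polynomial a polynomial in the p^(-s). A
  common \<open>S\<close> is allowed so that all n share the same variables; primes not dividing n
  enter with exponent 0.\<close>

lemma nat_powr_eq_prod_primes:
  assumes "n > 0" "finite S" "prime_factors n \<subseteq> S" "\<forall>p\<in>S. prime p"
  shows "of_nat n powr s = (\<Prod>p\<in>S. (of_nat p powr s) ^ multiplicity p n :: complex)"
proof -
  have "(\<Prod>p\<in>S. p ^ multiplicity p n) = (\<Prod>p\<in>prime_factors n. p ^ multiplicity p n)"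
  proof (rule prod.mono_neutral_right[OF assms(2,3)])
    show "\<forall>p\<in>S - prime_factors n. p ^ multiplicity p n = 1"
      using assms by (auto simp: prime_factors_multiplicity)
  qed
  also have "\<dots> = n" using prod_prime_factors[of n] assms by simp
  finally have n: "(\<Prod>p\<in>S. p ^ multiplicity p n) = n" .
  have "ln (real n) = ln (\<Prod>p\<in>S. real p ^ multiplicity p n)"
    by (subst n[symmetric]) (simp del: of_nat_prod add: of_nat_prod[symmetric] flip: of_nat_power)
  also have "\<dots> = (\<Sum>p\<in>S. ln (real p ^ multiplicity p n))"
    using assms by (intro ln_prod) (auto intro: prime_gt_0_nat)
  also have "\<dots> = (\<Sum>p\<in>S. real (multiplicity p n) * ln (real p))"
    by (simp add: ln_realpow)
  finally have ln: "ln (real n) = (\<Sum>p\<in>S. real (multiplicity p n) * ln (real p))" .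
  have "of_nat n powr s = exp (s * of_real (ln (real n)))"
    using assms by (simp add: powr_def Ln_of_nat)
  also have "s * of_real (ln (real n)) = (\<Sum>p\<in>S. of_nat (multiplicity p n) * (s * of_real (ln (real p))))"
    unfolding ln by (simp add: sum_distrib_left mult_ac)
  also have "exp \<dots> = (\<Prod>p\<in>S. exp (s * of_real (ln (real p))) ^ multiplicity p n)"
    using assms by (simp add: exp_sum exp_of_nat_mult)
  also have "\<dots> = (\<Prod>p\<in>S. (of_nat p powr s) ^ multiplicity p n)"
    using assms by (intro prod.cong refl) (auto simp: powr_def Ln_of_nat dest: prime_gt_0_nat)
  finally show ?thesis .
qed

lemma norm_nat_powr: "cmod (of_nat n powr s) = real n powr Re s"
  using norm_powr_real_powr[of "of_nat n" s] by simp

lemma norm_nat_powr_le_1: "n > 0 \<Longrightarrow> Re s \<ge> 0 \<Longrightarrow> cmod (of_nat n powr (- s)) \<le> 1"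
  unfolding norm_nat_powr using powr_mono[of "- Re s" 0 "real n"] by simp

lemma smooth_prime_factors_le:
  assumes "n \<in> smooth_numbers P" "ln (real n) \<le> 2 ^ j"
  shows "prime_factors n \<subseteq> {p \<in> P. real p \<le> exp (2 ^ j)}"
proof
  fix p assume p: "p \<in> prime_factors n"
  have n: "n > 0" "p \<in> P" using assms p by (auto simp: smooth_numbers_def)
  have "real p \<le> real n" using p n by (auto intro!: dvd_imp_le)
  also have "real n \<le> exp (2 ^ j)" using assms(2) n exp_le_cancel_iff[of "ln (real n)"] by simp
  finally show "p \<in> {p \<in> P. real p \<le> exp (2 ^ j)}" using n by simp
qed

text \<open>For Re s \<ge> 0 all the numbers p^(-s) lie in the closed unit disc, so the entire
  half-plane is mapped into the polydisc and one bound covers every s.\<close>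

lemma dirichlet_poly_le_max_grid:
  fixes b :: "nat \<Rightarrow> complex"
  assumes P: "\<forall>p\<in>P. prime p" and fin: "finite A" and A: "A \<subseteq> {n \<in> smooth_numbers P. ln (real n) \<le> 2 ^ j}"
    and Q: "2 ^ Suc j < Q"
    and B: "\<And>\<zeta>. \<zeta> \<in> PiE {p \<in> P. real p \<le> exp (2 ^ j)} (\<lambda>_. {\<omega>. \<omega> ^ Q = 1}) \<Longrightarrow>
       cmod (\<Sum>n\<in>A. b n * (\<Prod>p\<in>{p \<in> P. real p \<le> exp (2 ^ j)}. \<zeta> p ^ multiplicity p n)) \<le> B"
    and s: "Re s \<ge> 0"
  shows "cmod (\<Sum>n\<in>A. b n * of_nat n powr (- s)) \<le> (1 + 7 * real (2 ^ Suc j) ^ 2 / real Q) ^ scale_count P j * B"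
proof -
  define S where "S = {p \<in> P. real p \<le> exp (2 ^ j)}"
  have S: "finite S" unfolding S_def by (rule finite_primes_le)
  have SP: "\<forall>p\<in>S. prime p" using P by (auto simp: S_def)
  have "(\<Sum>n\<in>A. b n * of_nat n powr (- s)) = (\<Sum>n\<in>A. b n * (\<Prod>p\<in>S. (of_nat p powr (- s)) ^ multiplicity p n))"
  proof (intro sum.cong refl)
    fix n assume "n \<in> A"
    then have n: "n \<in> smooth_numbers P" "ln (real n) \<le> 2 ^ j" using A by auto
    have "of_nat n powr (- s) = (\<Prod>p\<in>S. (of_nat p powr (- s)) ^ multiplicity p n)"
      by (rule nat_powr_eq_prod_primes)
        (use n smooth_prime_factors_le[OF n] S SP in \<open>auto simp: S_def smooth_numbers_def\<close>)
    then show "b n * of_nat n powr (- s) = b n * (\<Prod>p\<in>S. (of_nat p powr (- s)) ^ multiplicity p n)" by simp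
  qed
  also have "cmod \<dots> \<le> (1 + 7 * real (2 ^ Suc j) ^ 2 / real Q) ^ card S * B"
  proof (rule polydisc_le_max_grid[OF S fin _ Q])
    show "multiplicity p n \<le> 2 ^ Suc j" if "p \<in> S" "n \<in> A" for p n
      using that A SP by (intro multiplicity_le_of_ln_le) (auto simp: smooth_numbers_def intro: prime_ge_2_nat)
    show "cmod (\<Sum>n\<in>A. b n * (\<Prod>p\<in>S. \<zeta> p ^ multiplicity p n)) \<le> B"
      if "\<zeta> \<in> S \<rightarrow>\<^sub>E {\<omega>. \<omega> ^ Q = 1}" for \<zeta>
      using B that unfolding S_def by blast
    show "cmod (of_nat p powr (- s)) \<le> 1" if "p \<in> S" for p
      using that SP s by (intro norm_nat_powr_le_1) (auto intro: prime_gt_0_nat)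
  qed
  finally show ?thesis by (simp add: S_def scale_count_def prime_count_in_def)
qed

text \<open>\<open>C\<close> depends on P alone, which permits its use for infinitely many blocks.
  Passing from the grid to the polydisc costs a factor at most 3, hence 9 for squares, and 9 times
  the 10 of the maximal inequality is the 90 below.\<close>

lemma (in prob_space) random_dirichlet_poly_sup:
  fixes \<epsilon> :: "nat \<Rightarrow> 'a \<Rightarrow> real"
  assumes rad: "rademacher_family M (smooth_numbers P) \<epsilon>" and P: "\<forall>p\<in>P. prime p" and ut: "ultra_thin P"
  obtains C where "C \<ge> 0"
    "\<And>j A b \<sigma>. finite A \<Longrightarrow> A \<subseteq> {n \<in> smooth_numbers P. n \<ge> 2 \<and> ln (real n) \<le> 2 ^ j} \<Longrightarrow>
      \<exists>U. U \<in> borel_measurable M \<and> (\<forall>\<omega>. 0 \<le> U \<omega>) \<and>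
        (\<forall>\<omega> s. Re s \<ge> \<sigma> \<longrightarrow> (cmod (\<Sum>n\<in>A. of_real (\<epsilon> n \<omega>) * b n * of_nat n powr (- s)))\<^sup>2 \<le> U \<omega>) \<and>
        (\<integral>\<^sup>+\<omega>. ennreal (U \<omega>) \<partial>M) \<le>
          ennreal (C * (real (j + 1) * real (scale_count P j)) * (\<Sum>n\<in>A. (cmod (b n) * real n powr (- \<sigma>))\<^sup>2))"
proof -
  define R where "R = (\<Sum>k. scale_weight P k)"
  have R0: "R \<ge> 0" unfolding R_def
    by (intro suminf_nonneg summable_scale_weight[OF ut] scale_weight_nonneg)
  \<comment> \<open>This keeps the logarithm of the number of grid points per variable linear in j +
    1, although the grid is refined as the number of variables grows.\<close>
  have dR: "real (scale_count P j) \<le> R * 4 ^ j" for j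
  proof -
    have "scale_weight P j \<le> R"
      using sum_le_suminf[OF summable_scale_weight[OF ut], of "{j}"] scale_weight_nonneg by (simp add: R_def)
    then have "real (j + 1) * real (scale_count P j) \<le> R * 4 ^ j"
      by (simp add: scale_weight_def field_simps)
    moreover have "1 * real (scale_count P j) \<le> real (j + 1) * real (scale_count P j)"
      by (intro mult_right_mono) auto
    ultimately show ?thesis by linarith
  qed
  define C1 where "C1 = ln 7 + 2 * ln 4 + ln (R + 1)"
  have C1: "C1 \<ge> 0" using R0 by (simp add: C1_def)
  show thesis
  proof (rule that[of "90 * (ln 4 + C1)"])
    show "90 * (ln 4 + C1) \<ge> 0" using C1 by (intro mult_nonneg_nonneg add_nonneg_nonneg) auto
    fix j A and b :: "nat \<Rightarrow> complex" and \<sigma> :: real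
    assume fin: "finite A" and A: "A \<subseteq> {n \<in> smooth_numbers P. n \<ge> 2 \<and> ln (real n) \<le> 2 ^ j}"
    define d where "d = scale_count P j"
    define S where "S = {p \<in> P. real p \<le> exp (2 ^ j)}"
    have S: "finite S" unfolding S_def by (rule finite_primes_le)
    have dS: "card S = d" by (simp add: d_def S_def scale_count_def prime_count_in_def)
    define \<beta> where "\<beta> n = cmod (b n) * real n powr (- \<sigma>)" for n
    define v where "v = (\<Sum>n\<in>A. (\<beta> n)\<^sup>2)"
    have v0: "v \<ge> 0" unfolding v_def by (intro sum_nonneg) auto
    show "\<exists>U. U \<in> borel_measurable M \<and> (\<forall>\<omega>. 0 \<le> U \<omega>) \<and>
        (\<forall>\<omega> s. Re s \<ge> \<sigma> \<longrightarrow> (cmod (\<Sum>n\<in>A. of_real (\<epsilon> n \<omega>) * b n * of_nat n powr (- s)))\<^sup>2 \<le> U \<omega>) \<and>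
        (\<integral>\<^sup>+\<omega>. ennreal (U \<omega>) \<partial>M) \<le>
          ennreal (90 * (ln 4 + C1) * (real (j + 1) * real (scale_count P j)) * (\<Sum>n\<in>A. (cmod (b n) * real n powr (- \<sigma>))\<^sup>2))"
    \<comment> \<open>Here the claimed bound is 0, so the polynomial must be empty. It is, because n
      \<ge> 2 excludes n = 1, the one smooth number with no prime factor.\<close>
    proof (cases "d = 0")
      case True
      have "A = {}"
      proof (rule ccontr)
        assume "A \<noteq> {}"
        then obtain n where n: "n \<in> smooth_numbers P" "n \<ge> 2" "ln (real n) \<le> 2 ^ j" using A by auto
        then obtain p where "p \<in> prime_factors n"
          using prime_factor_nat[of n] by (auto simp: prime_factors_dvd)
        then have "p \<in> S" using smooth_prime_factors_le[OF n(1,3)] by (auto simp: S_def)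
        then show False using S dS True by auto
      qed
      then show ?thesis by (intro exI[of _ "\<lambda>_. 0"]) simp
    next
      case False
      then have d1: "d \<ge> 1" by simp
      \<comment> \<open>With D = 2^(j+1) this makes 7 D^2 / Q = 1 / (d + 1), and the d-th power of 1
        + 1 / (d + 1) is below e.\<close>
      define Q where "Q = 7 * 4 ^ Suc j * (d + 1)"
      define G where "G = PiE S (\<lambda>_. {\<omega>::complex. \<omega> ^ Q = 1})"
      have Q0: "Q > 0" by (simp add: Q_def)
      have QD: "2 ^ Suc j < Q"
      proof -
        have "(2::nat) ^ Suc j \<le> 4 ^ Suc j" by (intro power_mono) auto
        also have "\<dots> < 7 * 4 ^ Suc j * 1" by simp
        also have "\<dots> \<le> Q" unfolding Q_def by (intro mult_left_mono) auto
        finally show ?thesis .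
      qed
      have cG: "card G = Q ^ d"
        unfolding G_def card_PiE[OF S] using card_roots_unity_eq[OF Q0] dS by simp
      have finG: "finite G" "G \<noteq> {}"
        using cG Q0 by (auto intro: card_ge_0_finite)
      \<comment> \<open>The factor n^(-\<sigma>) is moved into the coefficients, so that Re s \<ge>
        \<sigma> becomes the half-plane Re (s - \<sigma>) \<ge> 0 to which the grid bound
        applies.\<close>
      define c where "c \<zeta> n = b n * of_real (real n powr (- \<sigma>)) * (\<Prod>p\<in>S. \<zeta> p ^ multiplicity p n)" for \<zeta> :: "nat \<Rightarrow> complex" and n
      have c\<beta>: "cmod (c \<zeta> n) \<le> \<beta> n" if "\<zeta> \<in> G" "n \<in> A" for \<zeta> n
      proof -
        have "cmod (\<zeta> p) = 1" if "p \<in> S" for p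
        proof -
          have "\<zeta> p ^ Q = 1" using \<open>\<zeta> \<in> G\<close> that by (auto simp: G_def PiE_def Pi_def)
          then show ?thesis using power_eq_1_iff[of "\<zeta> p" Q] Q0 by simp
        qed
        then have "(\<Prod>p\<in>S. cmod (\<zeta> p) ^ multiplicity p n) = 1" by simp
        then show ?thesis by (simp add: c_def \<beta>_def norm_mult norm_power prod_norm[symmetric])
      qed
      have AN: "A \<subseteq> smooth_numbers P" using A by auto
      obtain U where U: "U \<in> borel_measurable M" "\<And>\<omega>. 0 \<le> U \<omega>"
        "\<And>\<zeta> \<omega>. \<zeta> \<in> G \<Longrightarrow> (cmod (\<Sum>n\<in>A. c \<zeta> n * of_real (\<epsilon> n \<omega>)))\<^sup>2 \<le> U \<omega>"
        "(\<integral>\<^sup>+\<omega>. ennreal (U \<omega>) \<partial>M) \<le> ennreal (10 * v * ln (4 * real (card G)))"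
        using rademacher_sup_bound[OF rad fin AN finG, of c \<beta>] c\<beta> unfolding v_def by blast
      have kap: "(1 + 7 * real (2 ^ Suc j) ^ 2 / real Q) ^ d \<le> 3"
      proof -
        have "real (2 ^ Suc j) ^ 2 = 4 ^ Suc j" by (simp add: power2_eq_square flip: power_mult_distrib)
        moreover have "real Q = (7 * 4 ^ Suc j) * (real d + 1)" by (simp add: Q_def distrib_left)
        ultimately have "7 * real (2 ^ Suc j) ^ 2 / real Q = 1 / (real d + 1)"
          by (simp only: nonzero_divide_mult_cancel_left) simp
        then have "(1 + 7 * real (2 ^ Suc j) ^ 2 / real Q) ^ d \<le> exp (1 / (real d + 1)) ^ d"
          using exp_ge_add_one_self[of "1 / (real d + 1)"] by (intro power_mono) auto
        also have "\<dots> = exp (real d * (1 / (real d + 1)))" by (rule exp_of_nat_mult[symmetric])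
        also have "\<dots> \<le> exp 1" by (subst exp_le_cancel_iff) (simp add: divide_simps)
        also have "\<dots> \<le> 3" using e_less_272 by simp
        finally show ?thesis .
      qed
      have lnQ: "ln (real Q) \<le> C1 * real (j + 1)"
      proof -
        have "real Q = 7 * 4 ^ Suc j * (real d + 1)" by (simp add: Q_def distrib_left)
        also have "\<dots> \<le> 7 * 4 ^ Suc j * ((R + 1) * 4 ^ j)"
        proof (intro mult_left_mono)
          have "(1::real) \<le> 4 ^ j" by simp
          with dR[of j] have "real d + 1 \<le> R * 4 ^ j + 4 ^ j" unfolding d_def by (rule add_mono)
          then show "real d + 1 \<le> (R + 1) * 4 ^ j" by (simp add: distrib_right)
        qed simp
        finally have "ln (real Q) \<le> ln (7 * 4 ^ Suc j * ((R + 1) * 4 ^ j))" using Q0 by (intro ln_mono) auto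
        also have "\<dots> = ln 7 + real (Suc j) * ln 4 + (ln (R + 1) + real j * ln 4)"
          using R0 by (subst ln_mult_pos, simp, simp)+ (simp only: ln_realpow)
        also have "\<dots> \<le> C1 * real (j + 1)"
        proof -
          have "ln 7 \<le> ln 7 * real (j + 1)" "ln (R + 1) \<le> ln (R + 1) * real (j + 1)"
            using R0 by (simp_all add: mult_le_cancel_left1)
          moreover have "real (Suc j) * ln 4 + real j * ln 4 \<le> 2 * ln 4 * real (j + 1)"
            by (simp add: algebra_simps)
          ultimately show ?thesis unfolding C1_def by (simp add: algebra_simps)
        qed
        finally show ?thesis .
      qed
      have lnG: "ln (4 * real (card G)) \<le> (ln 4 + C1) * (real (j + 1) * real d)"
      proof -
        have "ln (4 * real (card G)) = ln 4 + real d * ln (real Q)"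
          using Q0 by (simp add: cG ln_mult ln_realpow)
        also have "\<dots> \<le> ln 4 * (real (j + 1) * real d) + real d * (C1 * real (j + 1))"
        proof (intro add_mono mult_left_mono lnQ)
          have "1 * 1 \<le> real (j + 1) * real d" using d1 by (intro mult_mono) auto
          then show "ln 4 \<le> ln 4 * (real (j + 1) * real d)" by (simp add: mult_le_cancel_left1)
        qed auto
        finally show ?thesis by (simp add: algebra_simps)
      qed
      show ?thesis
      proof (intro exI[of _ "\<lambda>\<omega>. 9 * U \<omega>"] conjI allI impI)
        show "(\<lambda>\<omega>. 9 * U \<omega>) \<in> borel_measurable M" using U(1) by measurable
        show "0 \<le> 9 * U \<omega>" for \<omega> using U(2) by simp
        fix \<omega> and s :: complex assume s: "Re s \<ge> \<sigma>"
        have "cmod (\<Sum>n\<in>A. (of_real (\<epsilon> n \<omega>) * b n * of_real (real n powr (- \<sigma>))) * of_nat n powr (- (s - of_real \<sigma>)))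
           \<le> (1 + 7 * real (2 ^ Suc j) ^ 2 / real Q) ^ scale_count P j * sqrt (U \<omega>)"
        proof (rule dirichlet_poly_le_max_grid[OF P fin _ QD])
          fix \<zeta> :: "nat \<Rightarrow> complex" assume "\<zeta> \<in> PiE {p \<in> P. real p \<le> exp (2 ^ j)} (\<lambda>_. {\<omega>. \<omega> ^ Q = 1})"
          then have "\<zeta> \<in> G" by (simp add: G_def S_def)
          from real_le_rsqrt[OF U(3)[OF this]]
          show "cmod (\<Sum>n\<in>A. of_real (\<epsilon> n \<omega>) * b n * of_real (real n powr (- \<sigma>)) * (\<Prod>p\<in>{p \<in> P. real p \<le> exp (2 ^ j)}. \<zeta> p ^ multiplicity p n)) \<le> sqrt (U \<omega>)"
            by (simp add: c_def S_def mult_ac)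
        qed (use A s in auto)
        also have "\<dots> \<le> 3 * sqrt (U \<omega>)" using kap U(2) unfolding d_def by (intro mult_right_mono) auto
        also have "(\<Sum>n\<in>A. (of_real (\<epsilon> n \<omega>) * b n * of_real (real n powr (- \<sigma>))) * of_nat n powr (- (s - of_real \<sigma>))) =
           (\<Sum>n\<in>A. of_real (\<epsilon> n \<omega>) * b n * of_nat n powr (- s))"
        proof (intro sum.cong refl)
          fix n assume "n \<in> A"
          then have "n > 0" using A by auto
          then have "complex_of_real (real n powr (- \<sigma>)) = of_nat n powr (- of_real \<sigma>)"
            using powr_of_real[of "real n" "- \<sigma>"] by simp
          then have "complex_of_real (real n powr (- \<sigma>)) * of_nat n powr (- (s - of_real \<sigma>)) = of_nat n powr (- s)"
            using \<open>n > 0\<close> by (simp add: powr_add[symmetric])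
          then show "of_real (\<epsilon> n \<omega>) * b n * of_real (real n powr (- \<sigma>)) * of_nat n powr (- (s - of_real \<sigma>)) =
             of_real (\<epsilon> n \<omega>) * b n * of_nat n powr (- s)" by (simp add: mult.assoc)
        qed
        finally have "(cmod (\<Sum>n\<in>A. of_real (\<epsilon> n \<omega>) * b n * of_nat n powr (- s)))\<^sup>2 \<le> (3 * sqrt (U \<omega>))\<^sup>2"
          by (intro power_mono) auto
        then show "(cmod (\<Sum>n\<in>A. of_real (\<epsilon> n \<omega>) * b n * of_nat n powr (- s)))\<^sup>2 \<le> 9 * U \<omega>"
          using U(2) by (simp add: power_mult_distrib)
      next
        have "(\<integral>\<^sup>+\<omega>. ennreal (9 * U \<omega>) \<partial>M) = 9 * (\<integral>\<^sup>+\<omega>. ennreal (U \<omega>) \<partial>M)"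
          using U(1) by (simp add: ennreal_mult' nn_integral_cmult)
        also have "\<dots> \<le> 9 * ennreal (10 * v * ln (4 * real (card G)))" by (intro mult_left_mono U(4)) auto
        also have "\<dots> = ennreal (90 * v * ln (4 * real (card G)))"
          using ennreal_mult'[of 9 "10 * v * ln (4 * real (card G))"] by (simp add: mult.assoc)
        also have "\<dots> \<le> ennreal (90 * v * ((ln 4 + C1) * (real (j + 1) * real d)))"
          using v0 by (intro ennreal_leI mult_left_mono lnG) auto
        finally show "(\<integral>\<^sup>+\<omega>. ennreal (9 * U \<omega>) \<partial>M) \<le>
          ennreal (90 * (ln 4 + C1) * (real (j + 1) * real (scale_count P j)) * (\<Sum>n\<in>A. (cmod (b n) * real n powr (- \<sigma>))\<^sup>2))"
          unfolding v_def \<beta>_def d_def by (simp only: mult_ac)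
      qed
    qed
  qed
qed

subsection \<open>Dirichlet series assembled from blocks\<close>

lemma finite_scale_le: "finite {n. log_scale n \<le> k}"
proof (rule finite_subset)
  show "{n. log_scale n \<le> k} \<subseteq> {..nat \<lfloor>exp (2 ^ k :: real)\<rfloor>}"
  proof
    fix n assume "n \<in> {n. log_scale n \<le> k}"
    then have "ln (real n) \<le> 2 ^ k" by (simp add: scale_le_iff)
    then have "n > 0 \<Longrightarrow> real n \<le> exp (2 ^ k)" using exp_le_cancel_iff[of "ln (real n)" "2 ^ k"] by simp
    then have "real n \<le> exp (2 ^ k)" by (cases "n = 0") auto
    then show "n \<in> {..nat \<lfloor>exp (2 ^ k :: real)\<rfloor>}" by (simp add: le_nat_floor)
  qed
qed simp

text \<open>Cauchy-Schwarz against the weights 2^(-i), whose sum is 2.\<close>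

lemma sqrt_sum_weighted:
  fixes u :: "nat \<Rightarrow> real"
  assumes u: "\<And>i. u i \<ge> 0" and s: "summable (\<lambda>i. 2 ^ i * u i)"
  shows "summable (\<lambda>i. sqrt (u i))" and "(\<Sum>i. sqrt (u i))\<^sup>2 \<le> 2 * (\<Sum>i. 2 ^ i * u i)"
proof -
  have geo: "(\<Sum>i<n. (1/2) ^ i) \<le> (2::real)" for n
    using sum_le_suminf[OF summable_geometric[of "1/2 :: real"], of "{..<n}"] suminf_geometric[of "1/2 :: real"] by simp
  define T where "T = (\<Sum>i. 2 ^ i * u i)"
  have T0: "T \<ge> 0" unfolding T_def using u by (intro suminf_nonneg s) auto
  have fin: "(\<Sum>i<n. sqrt (u i))\<^sup>2 \<le> 2 * T" for n
  proof -
    have "(\<Sum>i<n. sqrt (u i)) = (\<Sum>i<n. sqrt ((1/2) ^ i) * sqrt (2 ^ i * u i))"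
    proof (intro sum.cong refl)
      fix i
      have "(1/2) ^ i * (2 ^ i * u i) = u i" by (simp add: power_one_over)
      then show "sqrt (u i) = sqrt ((1/2) ^ i) * sqrt (2 ^ i * u i)" by (metis real_sqrt_mult)
    qed
    then have "(\<Sum>i<n. sqrt (u i))\<^sup>2 \<le> (\<Sum>i<n. (sqrt ((1/2) ^ i))\<^sup>2) * (\<Sum>i<n. (sqrt (2 ^ i * u i))\<^sup>2)"
      by (simp only: Cauchy_Schwarz_ineq_sum)
    also have "\<dots> = (\<Sum>i<n. (1/2) ^ i) * (\<Sum>i<n. 2 ^ i * u i)"
      using u by (intro arg_cong2[where f = "(*)"] sum.cong refl) simp_all
    also have "\<dots> \<le> 2 * T"
      unfolding T_def using u by (intro mult_mono geo sum_le_suminf s sum_nonneg) auto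
    finally show ?thesis .
  qed
  have fin': "(\<Sum>i<n. sqrt (u i)) \<le> sqrt (2 * T)" for n
    using real_le_rsqrt[OF fin] .
  show sm: "summable (\<lambda>i. sqrt (u i))"
  proof (rule bounded_imp_summable)
    show "(\<Sum>i\<le>n. sqrt (u i)) \<le> sqrt (2 * T)" for n using fin'[of "Suc n"] by (simp only: lessThan_Suc_atMost)
  qed (use u in simp)
  have "(\<Sum>i. sqrt (u i)) \<le> sqrt (2 * T)" by (rule suminf_le_const[OF sm fin'])
  moreover have "(\<Sum>i. sqrt (u i)) \<ge> 0" using u by (intro suminf_nonneg sm) auto
  ultimately have "(\<Sum>i. sqrt (u i))\<^sup>2 \<le> (sqrt (2 * T))\<^sup>2" by (intro power_mono)
  then show "(\<Sum>i. sqrt (u i))\<^sup>2 \<le> 2 * (\<Sum>i. 2 ^ i * u i)" using T0 by (simp add: T_def)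
qed

text \<open>On \<open>Re s \<ge> 1 / 2 ^ Suc k\<close> the terms with \<open>log_scale n \<le> k\<close> form a single piece \<open>A k 0\<close>; each further
  log_scale \<open>k + i\<close> is a piece of its own, and the factors \<open>2 ^ i\<close> needed to add up infinitely many pieces
  are paid for by the decay of \<open>n powr (- s)\<close>.\<close>

lemma dirichlet_series_from_blocks:
  fixes c :: "nat \<Rightarrow> complex" and u :: "nat \<Rightarrow> nat \<Rightarrow> real" and N :: "nat set"
  defines "A \<equiv> \<lambda>k i. if i = 0 then {n \<in> N. n \<ge> 2 \<and> log_scale n \<le> k} else {n \<in> N. n \<ge> 2 \<and> log_scale n = k + i}"
  assumes N: "0 \<notin> N" "1 \<in> N"
    and u0: "\<And>k i. u k i \<ge> 0"
    and u: "\<And>k i s. Re s \<ge> 1 / 2 ^ Suc k \<Longrightarrow> (cmod (\<Sum>n\<in>A k i. c n * of_real (ln (real n)) * of_nat n powr (- s)))\<^sup>2 \<le> u k i"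
    and fin: "(\<Sum>k. \<Sum>i. ennreal (2 ^ i / 4 ^ k * u k i)) < \<infinity>"
    and c: "\<And>n. n \<in> N \<Longrightarrow> cmod (c n) \<le> Bc"
  obtains f m B where "f holomorphic_on {s. Re s > 0}"
    "\<And>k s. Re s \<ge> 1 / 2 ^ Suc k \<Longrightarrow> cmod (deriv f s) \<le> m k" "summable (\<lambda>k. (m k)\<^sup>2 / 4 ^ k)"
    "\<And>s. Re s \<ge> 1 \<Longrightarrow> cmod (f s) \<le> B"
    "dirichlet_represents (\<lambda>n. if n \<in> N then c n else 0) f"
    "\<And>s. Re s > 0 \<Longrightarrow> (\<lambda>K. \<Sum>n | n \<in> N \<and> n \<ge> 2 \<and> log_scale n \<le> K. c n * of_nat n powr (- s)) \<longlonglongrightarrow> f s - c 1"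
proof -
  define blk where "blk j = {n \<in> N. n \<ge> 2 \<and> log_scale n = j}" for j
  define L where "L k = {n \<in> N. n \<ge> 2 \<and> log_scale n \<le> k}" for k
  have finL: "finite (L k)" for k
    unfolding L_def by (rule finite_subset[OF _ finite_scale_le[of k]]) auto
  have fblk: "finite (blk j)" for j
    unfolding blk_def by (rule finite_subset[OF _ finite_scale_le[of j]]) auto
  have sumL: "(\<Sum>j<Suc k. \<Sum>n\<in>blk j. g n) = (\<Sum>n\<in>L k. g n)" for k and g :: "nat \<Rightarrow> 'b::comm_monoid_add"
  proof -
    have "L k = (\<Union>j<Suc k. blk j)" by (auto simp: L_def blk_def)
    moreover have "sum g (\<Union>j<Suc k. blk j) = (\<Sum>j<Suc k. \<Sum>n\<in>blk j. g n)"
      by (rule sum.UNION_disjoint) (simp, simp add: fblk, auto simp: blk_def)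
    ultimately show ?thesis by (simp only:)
  qed
  have A0: "A k 0 = L k" and A1: "i \<noteq> 0 \<Longrightarrow> A k i = blk (k + i)" for k i
    by (auto simp: A_def L_def blk_def)
  define Bl where "Bl j s = (\<Sum>n\<in>blk j. c n * of_nat n powr (- s))" for j s
  define F where "F j s = (\<Sum>n\<in>blk j. - (c n * of_real (ln (real n)) * of_nat n powr (- s)))" for j s
  have dB: "(Bl j has_field_derivative F j s) (at s within S)" for j s S
    unfolding Bl_def F_def
  proof (rule DERIV_sum)
    fix n assume "n \<in> blk j"
    then have "n > 0" by (simp add: blk_def)
    then have "((\<lambda>s. of_nat n powr (- s)) has_field_derivative (Ln (of_nat n) * of_nat n powr (- s)) * (- 1)) (at s within S)"
      by (intro DERIV_chain2[OF has_field_derivative_powr_right]) (auto intro!: derivative_eq_intros)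
    from DERIV_cmult[OF this, of "c n"]
    show "((\<lambda>s. c n * of_nat n powr (- s)) has_field_derivative
      - (c n * of_real (ln (real n)) * of_nat n powr (- s))) (at s within S)"
      using \<open>n > 0\<close> by (simp add: Ln_of_nat mult.assoc)
  qed
  have su: "summable (\<lambda>i. 2 ^ i / 4 ^ k * u k i)" for k
  proof (rule summable_suminf_not_top)
    show "(\<Sum>i. ennreal (2 ^ i / 4 ^ k * u k i)) \<noteq> \<top>"
      using ennreal_suminf_lessD[OF fin[unfolded infinity_ennreal_def], of k] by (simp add: less_top)
  qed (use u0 in auto)
  have su2: "summable (\<lambda>i. 2 ^ i * u k i)" for k
    using summable_mult[OF su[of k], of "4 ^ k"] by simp
  define m where "m k = (\<Sum>i. sqrt (u k i))" for k
  have sq: "summable (\<lambda>i. sqrt (u k i))" and m2: "(m k)\<^sup>2 \<le> 2 * (\<Sum>i. 2 ^ i * u k i)" for k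
    unfolding m_def using sqrt_sum_weighted[OF u0 su2] by auto
  have sm: "summable (\<lambda>k. (m k)\<^sup>2 / 4 ^ k)"
  proof (rule summable_comparison_test')
    have "summable (\<lambda>k. \<Sum>i. 2 ^ i / 4 ^ k * u k i)"
    proof (rule summable_suminf_not_top)
      show "0 \<le> (\<Sum>i. 2 ^ i / 4 ^ k * u k i)" for k using u0 by (intro suminf_nonneg su) auto
      have "(\<Sum>k. ennreal (\<Sum>i. 2 ^ i / 4 ^ k * u k i)) = (\<Sum>k. \<Sum>i. ennreal (2 ^ i / 4 ^ k * u k i))"
        using u0 by (intro suminf_cong suminf_ennreal2[symmetric] su) auto
      then show "(\<Sum>k. ennreal (\<Sum>i. 2 ^ i / 4 ^ k * u k i)) \<noteq> \<top>" using fin by (simp add: less_top)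
    qed
    then show "summable (\<lambda>k. 2 * (\<Sum>i. 2 ^ i / 4 ^ k * u k i))" by (rule summable_mult)
    fix k :: nat
    have "(\<Sum>i. 2 ^ i / 4 ^ k * u k i) = (\<Sum>i. 2 ^ i * u k i) / 4 ^ k"
      using suminf_divide[OF su2[of k], of "4 ^ k"] by simp
    then show "norm ((m k)\<^sup>2 / 4 ^ k) \<le> 2 * (\<Sum>i. 2 ^ i / 4 ^ k * u k i)"
      using m2[of k] by (simp add: divide_right_mono)
  qed
  have Fb: "cmod (F (k + i) s) \<le> sqrt (u k i)" if "Re s \<ge> 1 / 2 ^ Suc k" "i \<noteq> 0" for k i s
    using real_le_rsqrt[OF u[OF that(1), of i]] unfolding A1[OF that(2)] F_def sum_negf norm_minus_cancel .
  have F0: "cmod (\<Sum>j<Suc k. F j s) \<le> sqrt (u k 0)" if "Re s \<ge> 1 / 2 ^ Suc k" for k s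
    using real_le_rsqrt[OF u[OF that(1), of 0]] unfolding A0 F_def sumL sum_negf norm_minus_cancel .
  \<comment> \<open>For n \<le> k the subtraction n - k truncates to 0 and the majorant says nothing
    about the block; hence the eventual form of the Weierstrass test.\<close>
  have unif: "uniform_limit {s. Re s \<ge> 1 / 2 ^ Suc k} (\<lambda>n s. \<Sum>j<n. F j s) (\<lambda>s. \<Sum>j. F j s) sequentially" for k
  proof (rule Weierstrass_m_test_ev)
    show "\<forall>\<^sub>F n in sequentially. \<forall>x\<in>{s. 1 / 2 ^ Suc k \<le> Re s}. cmod (F n x) \<le> sqrt (u k (n - k))"
      using eventually_gt_at_top[of k]
    proof eventually_elim
      case (elim n)
      then show ?case using Fb[of k _ "n - k"] by auto
    qed
    show "summable (\<lambda>n. sqrt (u k (n - k)))"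
      using summable_iff_shift[of "\<lambda>n. sqrt (u k (n - k))" k] sq[of k] by simp
  qed
  \<comment> \<open>Bounded coefficients give absolute convergence for Re s \<ge> 2. This region
    supplies the base point for integrating the derivative series, the bound on f far to the right,
    and the representation in the natural order of terms.\<close>
  have Bc0: "Bc \<ge> 0" using c[OF N(2)] norm_ge_zero order_trans by blast
  have s2: "summable (\<lambda>n. 1 / real n ^ 2)" using inverse_power_summable[of 2, where ?'a = real] by (simp add: field_simps)
  define Z where "Z = (\<Sum>n. 1 / real n ^ 2)"
  have pw: "cmod (c n * of_nat n powr (- s)) \<le> Bc * (1 / real n ^ 2)" if "n \<in> N" "Re s \<ge> 2" for n s
  proof -
    have n: "n \<ge> 1" using that N by (cases "n = 0") auto
    have "cmod (of_nat n powr (- s)) = real n powr (- Re s)" using norm_powr_real_powr[of "of_nat n" "- s"] by simp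
    also have "\<dots> \<le> real n powr (- 2)" using n that by (intro powr_mono) auto
    also have "\<dots> = 1 / real n ^ 2" using n by (simp add: powr_minus field_simps powr_numeral)
    finally show ?thesis unfolding norm_mult using c[OF that(1)] Bc0 by (intro mult_mono) auto
  qed
  have Zb: "(\<Sum>n\<in>X. Bc * (1 / real n ^ 2)) \<le> Bc * Z" if "finite X" for X
    unfolding sum_distrib_left[symmetric] Z_def using Bc0 that by (intro mult_left_mono sum_le_suminf s2) auto
  have Bs: "summable (\<lambda>j. norm (Bl j s))" and Bsum: "(\<Sum>j. norm (Bl j s)) \<le> Bc * Z" if s: "Re s \<ge> 2" for s
  proof -
    have bnd: "(\<Sum>j<Suc k. norm (Bl j s)) \<le> Bc * Z" for k
    proof -
      have "(\<Sum>j<Suc k. norm (Bl j s)) \<le> (\<Sum>j<Suc k. \<Sum>n\<in>blk j. Bc * (1 / real n ^ 2))"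
        unfolding Bl_def by (intro sum_mono sum_norm_le pw s) (auto simp: blk_def)
      also have "\<dots> = (\<Sum>n\<in>L k. Bc * (1 / real n ^ 2))" by (rule sumL)
      also have "\<dots> \<le> Bc * Z" by (rule Zb[OF finL])
      finally show ?thesis .
    qed
    show sB: "summable (\<lambda>j. norm (Bl j s))"
    proof (rule bounded_imp_summable)
      show "(\<Sum>j\<le>n. norm (Bl j s)) \<le> Bc * Z" for n using bnd[of n] by (simp only: lessThan_Suc_atMost)
    qed simp
    have "(\<Sum>j<k. norm (Bl j s)) \<le> Bc * Z" for k
      using bnd[of k] order_trans[OF sum_mono2[of "{..<Suc k}" "{..<k}" "\<lambda>j. norm (Bl j s)"]] by auto
    then show "(\<Sum>j. norm (Bl j s)) \<le> Bc * Z" by (rule suminf_le_const[OF sB])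
  qed
  define f where "f s = c 1 + (\<Sum>j. Bl j s)" for s
  \<comment> \<open>Only the derivative blocks are controlled near the boundary. Their uniform
    convergence, together with convergence of the original blocks at the single point 2, gives both
    convergence and termwise differentiation.\<close>
  have main: "summable (\<lambda>j. Bl j s)" "(f has_field_derivative (\<Sum>j. F j s)) (at s)" if s: "Re s > 1 / 2 ^ Suc k" for s k
  proof -
    let ?S = "{s. Re s \<ge> 1 / 2 ^ Suc k}"
    have i: "s \<in> interior ?S"
    proof (rule interiorI)
      show "open {s. Re s > 1 / 2 ^ Suc k}" by (rule open_halfspace_Re_gt)
    qed (use s in auto)
    have uc: "uniformly_convergent_on ?S (\<lambda>n s. \<Sum>j<n. F j s)" using unif uniformly_convergent_on_def by blast
    have "(1::real) / 2 ^ Suc k \<le> 1 / 1" by (intro divide_left_mono) (auto simp: one_le_power simp del: power_Suc)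
    then have "(1::real) / 2 ^ Suc k \<le> 2" by linarith
    then have x0: "(2::complex) \<in> ?S" by (simp del: power_Suc)
    have cv: "convex ?S" by (rule convex_halfspace_Re_ge)
    have s0: "summable (\<lambda>j. Bl j 2)" using summable_norm_cancel[OF Bs[of 2]] by simp
    note ser = has_field_derivative_series'[OF cv dB uc x0 s0 i]
    show "summable (\<lambda>j. Bl j s)" by (rule ser(1))
    have "((\<lambda>s. c 1 + (\<Sum>j. Bl j s)) has_field_derivative 0 + (\<Sum>j. F j s)) (at s)"
      by (intro DERIV_add DERIV_const ser(2))
    then show "(f has_field_derivative (\<Sum>j. F j s)) (at s)" unfolding f_def[abs_def] by simp
  qed
  have ex: "\<exists>k. 1 / 2 ^ Suc k < Re s" if s: "Re s > 0" for s :: complex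
  proof -
    obtain n where n: "(1/2::real) ^ n < Re s" using real_arch_pow_inv[of "Re s" "1/2"] s by auto
    have "(1/2::real) ^ Suc n \<le> (1/2) ^ n" by (rule power_decreasing) auto
    then show ?thesis using n by (intro exI[of _ n]) (simp add: power_one_over)
  qed
  have hol: "f holomorphic_on {s. Re s > 0}"
  proof (rule holomorphic_onI)
    fix s assume "s \<in> {s. Re s > 0}"
    then show "f field_differentiable at s within {s. Re s > 0}"
      using ex[of s] main(2) by (auto simp: field_differentiable_def intro: has_field_derivative_at_within)
  qed
  \<comment> \<open>The derivative formula holds in the interior of a closed half-plane; the line Re
    s = 2^(-k-1) itself is reached by using the next larger half-plane.\<close>
  have half: "1 / 2 ^ Suc (Suc k) < (1 / 2 ^ Suc k :: real)" for k by (simp add: field_simps)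
  have dm: "cmod (deriv f s) \<le> m k" if s: "Re s \<ge> 1 / 2 ^ Suc k" for k s
  proof -
    have "deriv f s = (\<Sum>j. F j s)"
      using main(2)[of "Suc k" s] half[of k] s by (intro DERIV_imp_deriv) auto
    also have "\<dots> = (\<Sum>i. F (i + Suc k) s) + (\<Sum>j<Suc k. F j s)"
    proof (rule suminf_split_initial_segment)
      show "summable (\<lambda>j. F j s)"
        using tendsto_uniform_limitI[OF unif[of k], of s] s by (auto simp: summable_def sums_def)
    qed
    also have "cmod \<dots> \<le> (\<Sum>i. sqrt (u k (Suc i))) + sqrt (u k 0)"
    proof (rule norm_triangle_mono[OF _ F0[OF s]])
      have sh: "summable (\<lambda>i. sqrt (u k (Suc i)))" using sq[of k] by (subst summable_Suc_iff)
      have le: "cmod (F (i + Suc k) s) \<le> sqrt (u k (Suc i))" for i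
        using Fb[OF s, of "Suc i"] by (simp add: add.commute)
      show "cmod (\<Sum>i. F (i + Suc k) s) \<le> (\<Sum>i. sqrt (u k (Suc i)))"
        by (rule norm_suminf_le[OF le sh])
    qed
    also have "\<dots> = m k" unfolding m_def using suminf_split_head[OF sq[of k]] by simp
    finally show ?thesis .
  qed
  have f2: "cmod (f s) \<le> Bc + Bc * Z" if s: "Re s \<ge> 2" for s
  proof -
    have "cmod (f s) \<le> cmod (c 1) + cmod (\<Sum>j. Bl j s)" unfolding f_def by (rule norm_triangle_ineq)
    also have "cmod (\<Sum>j. Bl j s) \<le> Bc * Z" using summable_norm[OF Bs[OF s]] Bsum[OF s] by simp
    finally show ?thesis using c[OF N(2)] by simp
  qed
  \<comment> \<open>The bound for Re s \<ge> 2 is moved one unit to the left, at the cost of the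
    derivative bound m 0.\<close>
  have f1: "cmod (f s) \<le> m 0 + (Bc + Bc * Z)" if s: "Re s \<ge> 1" for s
  proof -
    have "cmod (f s - f (s + 1)) \<le> m 0 * cmod (s - (s + 1))"
    proof (rule field_differentiable_bound[where S = "{s. Re s \<ge> 1}" and f' = "deriv f"])
      show "convex {s. Re s \<ge> 1}" by (rule convex_halfspace_Re_ge)
      fix z assume z: "z \<in> {s. Re s \<ge> 1}"
      then have "(f has_field_derivative deriv f z) (at z)"
        by (intro holomorphic_derivI[OF hol open_halfspace_Re_gt]) auto
      then show "(f has_field_derivative deriv f z) (at z within {s. Re s \<ge> 1})"
        by (rule has_field_derivative_at_within)
      show "cmod (deriv f z) \<le> m 0" using z by (intro dm) auto
    qed (use s in auto)
    then have "cmod (f s - f (s + 1)) \<le> m 0" by simp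
    moreover have "cmod (f (s + 1)) \<le> Bc + Bc * Z" using s by (intro f2) simp
    ultimately show ?thesis using norm_triangle_sub[of "f s" "f (s + 1)"] by linarith
  qed
  have lim: "(\<lambda>K. \<Sum>n | n \<in> N \<and> n \<ge> 2 \<and> log_scale n \<le> K. c n * of_nat n powr (- s)) \<longlonglongrightarrow> f s - c 1" if s: "Re s > 0" for s
  proof -
    obtain k where "1 / 2 ^ Suc k < Re s" using ex[OF s] by blast
    from main(1)[OF this] have "(\<lambda>K. \<Sum>j<K. Bl j s) \<longlonglongrightarrow> f s - c 1"
      unfolding f_def using summable_LIMSEQ by simp
    then have "(\<lambda>K. \<Sum>j<Suc K. Bl j s) \<longlonglongrightarrow> f s - c 1" by (rule LIMSEQ_Suc)
    then show ?thesis unfolding Bl_def sumL L_def .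
  qed
  have dr: "dirichlet_represents (\<lambda>n. if n \<in> N then c n else 0) f"
    unfolding dirichlet_represents_def
  proof (intro exI[of _ 2] allI impI)
    fix s :: complex assume s: "Re s > 2"
    define h where "h n = (if n \<in> N then c n else 0) * of_nat n powr (- s)" for n
    have "summable (\<lambda>n. norm (h n))"
    proof (rule summable_comparison_test')
      show "summable (\<lambda>n. Bc * (1 / real n ^ 2))" by (rule summable_mult[OF s2])
      show "norm (norm (h n)) \<le> Bc * (1 / real n ^ 2)" for n
        using pw[of n s] s Bc0 by (auto simp: h_def)
    qed
    then have hs: "(h has_sum suminf h) UNIV" "h sums suminf h"
      by (auto intro: norm_summable_imp_has_sum summable_sums summable_norm_cancel)
    \<comment> \<open>Partial sums by scale need not follow the order of the series. Under absolute
      convergence any exhaustion by finite sets gives the same sum.\<close>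
    have "filterlim (\<lambda>K. {n. log_scale n \<le> K}) (finite_subsets_at_top UNIV) sequentially"
      unfolding filterlim_finite_subsets_at_top
    proof (intro allI impI)
      fix X :: "nat set" assume X: "finite X \<and> X \<subseteq> UNIV"
      show "\<forall>\<^sub>F y in sequentially. finite {n. log_scale n \<le> y} \<and> X \<subseteq> {n. log_scale n \<le> y} \<and> {n. log_scale n \<le> y} \<subseteq> UNIV"
        using eventually_ge_at_top[of "Max (insert 0 (log_scale ` X))"]
      proof eventually_elim
        case (elim y)
        then have "log_scale x \<le> y" if "x \<in> X" for x
          using that X by (intro order_trans[OF Max_ge elim]) auto
        then show ?case using finite_scale_le by auto
      qed
    qed
    from filterlim_compose[OF hs(1)[unfolded has_sum_def] this]
    have l1: "(\<lambda>K. sum h {n. log_scale n \<le> K}) \<longlonglongrightarrow> suminf h" .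
    have "sum h {n. log_scale n \<le> K} = c 1 + (\<Sum>n | n \<in> N \<and> n \<ge> 2 \<and> log_scale n \<le> K. c n * of_nat n powr (- s))" for K
    proof -
      have "log_scale 1 \<le> K" by (simp only: scale_le_iff) simp
      then have "sum h {n. log_scale n \<le> K} = h 1 + sum h ({n. log_scale n \<le> K} - {1})"
        by (intro sum.remove finite_scale_le) simp
      also have "h 1 = c 1" using N by (simp add: h_def)
      also have "sum h ({n. log_scale n \<le> K} - {1}) = sum h {n. n \<in> N \<and> n \<ge> 2 \<and> log_scale n \<le> K}"
      proof (rule sum.mono_neutral_right)
        show "finite ({n. log_scale n \<le> K} - {1})" using finite_scale_le by simp
        show "\<forall>i\<in>{n. log_scale n \<le> K} - {1} - {n \<in> N. 2 \<le> n \<and> log_scale n \<le> K}. h i = 0"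
        proof
          fix i assume i: "i \<in> {n. log_scale n \<le> K} - {1} - {n \<in> N. 2 \<le> n \<and> log_scale n \<le> K}"
          then have "i = 0 \<or> i \<notin> N" by (cases i) auto
          then show "h i = 0" using N by (auto simp: h_def)
        qed
      qed auto
      also have "\<dots> = (\<Sum>n | n \<in> N \<and> n \<ge> 2 \<and> log_scale n \<le> K. c n * of_nat n powr (- s))"
        by (intro sum.cong) (auto simp: h_def)
      finally show ?thesis .
    qed
    with l1 have "(\<lambda>K. c 1 + (\<Sum>n | n \<in> N \<and> n \<ge> 2 \<and> log_scale n \<le> K. c n * of_nat n powr (- s))) \<longlonglongrightarrow> suminf h" by simp
    moreover have "(\<lambda>K. c 1 + (\<Sum>n | n \<in> N \<and> n \<ge> 2 \<and> log_scale n \<le> K. c n * of_nat n powr (- s))) \<longlonglongrightarrow> c 1 + (f s - c 1)"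
      using s by (intro tendsto_add tendsto_const lim) simp
    ultimately have "suminf h = f s" using LIMSEQ_unique by fastforce
    moreover have "(\<lambda>n. h (Suc n)) sums (suminf h - h 0)"
      using hs(2) sums_Suc_iff[of h] by simp
    moreover have "h 0 = 0" by (simp add: h_def)
    ultimately show "(\<lambda>n. (if Suc n \<in> N then c (Suc n) else 0) * of_nat (Suc n) powr - s) sums f s"
      by (simp add: h_def)
  qed
  show thesis by (rule that[OF hol dm sm f1 dr lim])
qed

text \<open>With \<phi> j = f(2^(-j) + it) the indices 2^k are the heights 2^(-2^k). The second
  condition gives absolute convergence along them. Inside a block 2^k \<le> i < n < 2^(k+1),
  Cauchy-Schwarz costs the number of terms n - 2^k, which is at most i + 1 and is covered by the
  first condition.\<close>

lemma convergent_of_dyadic_increments: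
  fixes \<phi> :: "nat \<Rightarrow> complex"
  assumes s1: "summable (\<lambda>j. real (j + 1) * (cmod (\<phi> j - \<phi> (Suc j)))\<^sup>2)"
    and s2: "summable (\<lambda>k. 2 ^ k * (cmod (\<phi> (2 ^ k) - \<phi> (2 ^ Suc k)))\<^sup>2)"
  shows "convergent \<phi>"
proof -
  define x where "x j = real (j + 1) * (cmod (\<phi> j - \<phi> (Suc j)))\<^sup>2" for j
  have sx: "summable x" using s1 by (simp add: x_def[abs_def])
  have x0: "x j \<ge> 0" for j by (simp add: x_def)
  have "summable (\<lambda>k. cmod (\<phi> (2 ^ Suc k) - \<phi> (2 ^ k)))"
    using sqrt_sum_weighted(1)[OF _ s2] by (simp add: norm_minus_commute)
  then have "summable (\<lambda>k. \<phi> (2 ^ Suc k) - \<phi> (2 ^ k))" by (rule summable_norm_cancel)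
  from summable_LIMSEQ[OF this]
  have "(\<lambda>K. \<phi> (2 ^ K) - \<phi> (2 ^ 0)) \<longlonglongrightarrow> (\<Sum>k. \<phi> (2 ^ Suc k) - \<phi> (2 ^ k))"
    by (simp only: sum_lessThan_telescope[of "\<lambda>k. \<phi> (2 ^ k)"])
  from tendsto_add[OF this tendsto_const[of "\<phi> (2 ^ 0)"]]
  obtain l where l: "(\<lambda>k. \<phi> (2 ^ k)) \<longlonglongrightarrow> l" by auto
  have "\<phi> \<longlonglongrightarrow> l"
  proof (rule LIMSEQ_I)
    fix e :: real assume e: "e > 0"
    obtain K1 where K1: "\<And>k. k \<ge> K1 \<Longrightarrow> cmod (\<phi> (2 ^ k) - l) < e / 2"
      using LIMSEQ_D[OF l, of "e / 2"] e by auto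
    obtain K2 where K2: "\<And>a b. a \<ge> K2 \<Longrightarrow> norm (\<Sum>i\<in>{a..<b}. x i) < (e / 2)\<^sup>2"
      using sx e unfolding summable_Cauchy by (meson half_gt_zero zero_less_power)
    show "\<exists>no. \<forall>n\<ge>no. cmod (\<phi> n - l) < e"
    proof (intro exI[of _ "max (2 ^ K1) (max K2 1 * 2)"] allI impI)
      fix n :: nat assume n: "n \<ge> max (2 ^ K1) (max K2 1 * 2)"
      then have "(2::nat) ^ K1 \<le> n" by simp
      moreover have "0 < (2::nat) ^ K1" by simp
      ultimately have n1: "n \<ge> 1" by linarith
      obtain k where k: "2 ^ k \<le> n" "n < 2 ^ Suc k"
        using ex_power_ivl1[of 2 n] n1 by auto
      have "2 ^ K1 < (2::nat) ^ Suc k" using n k by simp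
      then have "K1 \<le> k" by (metis less_Suc_eq_le nat_power_less_imp_less pos2)
      have "K2 \<le> 2 ^ k"
      proof -
        have "K2 * 2 \<le> n" using n by auto
        then show ?thesis using k by simp
      qed
      have "\<phi> (2 ^ k) - \<phi> n = (\<Sum>i\<in>{2 ^ k..<n}. \<phi> i - \<phi> (Suc i))"
        using sum_Suc_diff'[of "2 ^ k" n "\<lambda>i. - \<phi> i"] k by simp
      then have "cmod (\<phi> (2 ^ k) - \<phi> n) \<le> (\<Sum>i\<in>{2 ^ k..<n}. cmod (\<phi> i - \<phi> (Suc i)))"
        by (simp only: norm_sum)
      then have "(cmod (\<phi> (2 ^ k) - \<phi> n))\<^sup>2 \<le> (\<Sum>i\<in>{2 ^ k..<n}. 1 * cmod (\<phi> i - \<phi> (Suc i)))\<^sup>2"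
        by (intro power_mono) auto
      also have "\<dots> \<le> (\<Sum>i\<in>{2 ^ k..<n}. 1\<^sup>2) * (\<Sum>i\<in>{2 ^ k..<n}. (cmod (\<phi> i - \<phi> (Suc i)))\<^sup>2)"
        by (rule Cauchy_Schwarz_ineq_sum)
      also have "\<dots> = (\<Sum>i\<in>{2 ^ k..<n}. real (n - 2 ^ k) * (cmod (\<phi> i - \<phi> (Suc i)))\<^sup>2)"
        by (simp add: sum_distrib_left)
      also have "\<dots> \<le> (\<Sum>i\<in>{2 ^ k..<n}. x i)"
      proof (intro sum_mono)
        fix i assume i: "i \<in> {2 ^ k..<n}"
        then have "n - 2 ^ k \<le> i + 1" using k by auto
        then have "real (n - 2 ^ k) \<le> real (i + 1)" by (simp only: of_nat_le_iff)
        then show "real (n - 2 ^ k) * (cmod (\<phi> i - \<phi> (Suc i)))\<^sup>2 \<le> x i"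
          unfolding x_def by (intro mult_right_mono) auto
      qed
      also have "\<dots> < (e / 2)\<^sup>2" using K2[OF \<open>K2 \<le> 2 ^ k\<close>, of n] by simp
      finally have "cmod (\<phi> (2 ^ k) - \<phi> n) < e / 2" by (rule power_less_imp_less_base) (use e in simp)
      moreover have "cmod (\<phi> (2 ^ k) - l) < e / 2" using K1 \<open>K1 \<le> k\<close> by simp
      ultimately show "cmod (\<phi> n - l) < e"
        using norm_triangle_sub[of "\<phi> n - l" "\<phi> (2 ^ k) - l"] by (simp add: norm_minus_commute)
    qed
  qed
  then show ?thesis by (auto simp: convergent_def)
qed

subsection \<open>Summation over the scales\<close>

lemma ennreal_suminf_swap:
  fixes f :: "nat \<Rightarrow> nat \<Rightarrow> ennreal"
  shows "(\<Sum>k. \<Sum>n. f k n) = (\<Sum>n. \<Sum>k. f k n)"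
proof -
  have "(\<Sum>k. \<Sum>n. f k n) = (\<Sum>k. \<integral>\<^sup>+n. f k n \<partial>count_space UNIV)"
    by (simp add: nn_integral_count_space_nat)
  also have "\<dots> = (\<integral>\<^sup>+n. (\<Sum>k. f k n) \<partial>count_space UNIV)"
    by (rule nn_integral_suminf[symmetric]) simp
  also have "\<dots> = (\<Sum>n. \<Sum>k. f k n)" by (simp add: nn_integral_count_space_nat)
  finally show ?thesis .
qed

lemma sum_eq_suminf_if:
  fixes g :: "nat \<Rightarrow> ennreal"
  assumes "finite A" shows "(\<Sum>n\<in>A. g n) = (\<Sum>n. if n \<in> A then g n else 0)"
  using suminf_finite[OF assms, of "\<lambda>n. if n \<in> A then g n else 0"] by simp

text \<open>(1/2)^|j - K|; the case distinction replaces the absolute value, as subtraction on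
  \<open>nat\<close> truncates.\<close>

definition decay :: "nat \<Rightarrow> nat \<Rightarrow> real" where
  "decay K j = (1/2) ^ (if j < K then K - j else j - K)"

lemma decay_sum: "summable (decay K)" "(\<Sum>j. decay K j) \<le> 4"
proof -
  have sh: "(\<lambda>j. decay K (j + K)) = (\<lambda>j. (1/2) ^ j)" by (auto simp: decay_def)
  have sg: "summable (\<lambda>j. (1/2 :: real) ^ j)" by (rule summable_geometric) simp
  show s: "summable (decay K)" using summable_iff_shift[of "decay K" K] sg unfolding sh by blast
  have geo: "(\<Sum>i<n. (1/2) ^ i) \<le> (2::real)" for n
    using sum_le_suminf[OF sg, of "{..<n}"] suminf_geometric[of "1/2 :: real"] by simp
  have "(\<Sum>j<K. decay K j) \<le> (\<Sum>j<K. (1/2) ^ (K - Suc j))"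
    unfolding decay_def by (intro sum_mono) (auto intro: power_decreasing)
  also have "\<dots> = (\<Sum>i<K. (1/2) ^ i)" by (rule sum.nat_diff_reindex)
  also have "\<dots> \<le> 2" by (rule geo)
  finally have "(\<Sum>j<K. decay K j) \<le> 2" .
  moreover have "(\<Sum>j. decay K j) = (\<Sum>j. decay K (j + K)) + (\<Sum>j<K. decay K j)" by (rule suminf_split_initial_segment[OF s])
  moreover have "(\<Sum>j. decay K (j + K)) = 2" unfolding sh using suminf_geometric[of "1/2 :: real"] by simp
  ultimately show "(\<Sum>j. decay K j) \<le> 4" by simp
qed

lemma suminf_decay_le:
  fixes x :: real assumes "x \<ge> 0"
  shows "(\<Sum>j. ennreal (x * decay K j)) \<le> ennreal (4 * x)"
proof -
  have "(\<Sum>j. ennreal (x * decay K j)) =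
      ennreal (\<Sum>j. x * decay K j)"
    using assms by (intro suminf_ennreal2 summable_mult decay_sum) (auto simp: decay_def)
  also have "(\<Sum>j. x * decay K j) = x * (\<Sum>j. decay K j)"
    by (rule suminf_mult[OF decay_sum(1)])
  also have "\<dots> \<le> x * 4" by (intro mult_left_mono decay_sum assms)
  finally show ?thesis by (simp add: mult.commute ennreal_leI)
qed

section \<open>Increments of n^(-\<sigma>) between dyadic heights\<close>

lemma exp_diff_bounds:
  fixes x :: real assumes "x > 0"
  shows "0 \<le> exp (- x) - exp (- 2 * x)" "exp (- x) - exp (- 2 * x) \<le> x" "exp (- x) - exp (- 2 * x) \<le> 1 / x"
proof -
  show "0 \<le> exp (- x) - exp (- 2 * x)" using assms by simp
  have "exp (- x) - exp (- 2 * x) = exp (- x) * (1 - exp (- x))" by (simp add: algebra_simps exp_add[symmetric])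
  also have "\<dots> \<le> 1 * x" using assms exp_ge_add_one_self[of "- x"] by (intro mult_mono) auto
  finally show "exp (- x) - exp (- 2 * x) \<le> x" by simp
  have "exp (- x) = 1 / exp x" by (simp add: exp_minus inverse_eq_divide)
  also have "\<dots> \<le> 1 / x"
  proof (intro divide_left_mono)
    show "x \<le> exp x" using exp_ge_add_one_self[of x] by linarith
  qed (use assms in auto)
  finally show "exp (- x) - exp (- 2 * x) \<le> 1 / x" using exp_gt_zero[of "- 2 * x"] by linarith
qed

text \<open>The increment is exp (-x) - exp (-2x) with x = ln n / 2^(j+1), at most min x (1/x), so
  it matters only for j near J = \<open>log_scale n\<close>. With i = |j - J| its square is at most
  16 / 4^i, while j + 1 \<le> (J + 1) 2^i; half of the decay survives.\<close>

lemma dyadic_increment_bound: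
  assumes n: "n \<ge> 2"
  shows "real (j + 1) * (real n powr (- (1 / 2 ^ j)) - real n powr (- (1 / 2 ^ Suc j)))\<^sup>2
     \<le> 16 * (real (log_scale n) + 1) * decay (log_scale n) j"
proof -
  define J where "J = log_scale n"
  define x where "x = ln (real n) / 2 ^ Suc j"
  have ln0: "ln (real n) > 0" using n by simp
  have x0: "x > 0" using ln0 by (simp add: x_def)
  have e: "real n powr (- (1 / 2 ^ Suc j)) = exp (- x)" "real n powr (- (1 / 2 ^ j)) = exp (- 2 * x)"
    using n by (simp_all add: powr_def x_def)
  have sq: "(real n powr (- (1 / 2 ^ j)) - real n powr (- (1 / 2 ^ Suc j)))\<^sup>2 = (exp (- x) - exp (- 2 * x))\<^sup>2"
    unfolding e by (rule power2_commute)
  define i where "i = (if j < J then J - j else j - J)"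
  have "(exp (- x) - exp (- 2 * x))\<^sup>2 \<le> 16 * (1/4) ^ i"
  proof (cases "j < J")
    case True
    have J: "J = j + i" using True by (simp add: i_def)
    have "2 ^ i \<le> 4 * x"
      using scale_le_ln[OF n] unfolding x_def J_def[symmetric] J by (simp add: power_add field_simps)
    then have "1 / x \<le> 4 / 2 ^ i" using x0 by (simp add: field_simps)
    then have "(exp (- x) - exp (- 2 * x))\<^sup>2 \<le> (4 / 2 ^ i)\<^sup>2"
      using exp_diff_bounds[OF x0] by (intro power_mono) auto
    also have "\<dots> = 16 * (1/4) ^ i"
      by (simp add: power2_eq_square power_one_over flip: power_mult_distrib)
    finally show ?thesis .
  next
    case False
    have j: "j = J + i" using False by (simp add: i_def)
    have "ln (real n) \<le> 2 * 2 ^ log_scale n" using ln_le_scale[of n] zero_le_power[of "2::real" "log_scale n"] by linarith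
    then have "x \<le> 1 / 2 ^ i"
      unfolding x_def J_def[symmetric] j by (simp add: power_add field_simps)
    then have "(exp (- x) - exp (- 2 * x))\<^sup>2 \<le> (1 / 2 ^ i)\<^sup>2"
      using exp_diff_bounds[OF x0] by (intro power_mono) auto
    also have "\<dots> = (1/4) ^ i"
      by (simp add: power2_eq_square power_one_over flip: power_mult_distrib)
    also have "\<dots> \<le> 16 * (1/4) ^ i" by simp
    finally show ?thesis .
  qed
  moreover have "real (j + 1) \<le> (real J + 1) * 2 ^ i"
  proof -
    have "j + 1 \<le> (J + 1) * (i + 1)"
    proof (cases "j < J")
      case True
      then have "j + 1 \<le> (J + 1) * 1" by simp
      also have "\<dots> \<le> (J + 1) * (i + 1)" by (intro mult_left_mono) auto
      finally show ?thesis .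
    next
      case False
      then have "j = J + i" by (simp add: i_def)
      then show ?thesis by simp
    qed
    then have "real (j + 1) \<le> real ((J + 1) * (i + 1))" by (simp only: of_nat_le_iff)
    also have "\<dots> = (real J + 1) * (real i + 1)" by (simp only: of_nat_mult of_nat_add of_nat_1)
    also have "real i + 1 \<le> 2 ^ i" by (induction i) auto
    finally show ?thesis by (simp add: mult_left_mono)
  qed
  ultimately have "real (j + 1) * (exp (- x) - exp (- 2 * x))\<^sup>2 \<le> ((real J + 1) * 2 ^ i) * (16 * (1/4) ^ i)"
    by (intro mult_mono) auto
  also have "\<dots> = 16 * (real J + 1) * (2 ^ i * (1/4) ^ i)" by simp
  also have "2 ^ i * (1/4) ^ i = (1/2 :: real) ^ i" by (simp flip: power_mult_distrib)
  finally show ?thesis unfolding sq J_def i_def decay_def .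
qed

text \<open>The critical index K is the least one with J < 2^K, where J =
  \<open>log_scale n\<close>. Below K the trivial bound 1 for the increment leaves 2^j = 2^K /
  2^(K-j). From K on, 2^j \<ge> J + (j - K) makes the increment at most 2^(K-j). Minimality of K
  gives 2^K \<le> 2 (J + 1).\<close>

lemma superdyadic_increment_bound:
  assumes n: "n \<ge> 2"
  shows "\<exists>K. \<forall>j. 2 ^ j * (real n powr (- (1 / 2 ^ (2 ^ j))) - real n powr (- (1 / 2 ^ (2 ^ Suc j))))\<^sup>2
     \<le> 2 * (real (log_scale n) + 1) * decay K j"
proof -
  define J where "J = log_scale n"
  define K where "K = (LEAST K. J < 2 ^ K)"
  have ex: "J < 2 ^ J" by (rule less_exp)
  have K: "J < 2 ^ K" unfolding K_def by (rule LeastI[where P = "\<lambda>K. J < 2 ^ K", OF ex])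
  have K2: "(2::real) ^ K \<le> 2 * (real J + 1)"
  proof (cases K)
    case (Suc K')
    then have "\<not> J < 2 ^ K'" using not_less_Least[of K' "\<lambda>K. J < 2 ^ K"] by (simp add: K_def)
    then have "real (2 ^ K') \<le> real J" by (simp only: of_nat_le_iff not_less)
    then have "(2::real) ^ K' \<le> real J" by (simp only: of_nat_power of_nat_numeral)
    then have "(2::real) ^ K' \<le> real J + 1" by (rule order_trans) simp
    then show ?thesis unfolding Suc power_Suc by (rule mult_left_mono) simp
  qed simp
  have ln0: "ln (real n) > 0" using n by simp
  have "2 ^ j * (real n powr (- (1 / 2 ^ (2 ^ j))) - real n powr (- (1 / 2 ^ (2 ^ Suc j))))\<^sup>2
     \<le> 2 ^ K * decay K j" for j
  proof -
    define y where "y = ln (real n) / 2 ^ (2 ^ j)"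
    define z where "z = ln (real n) / 2 ^ (2 ^ Suc j)"
    have e: "real n powr (- (1 / 2 ^ (2 ^ j))) = exp (- y)" "real n powr (- (1 / 2 ^ (2 ^ Suc j))) = exp (- z)"
      using n by (simp_all add: powr_def y_def z_def)
    have y0: "y \<ge> 0" and z0: "z \<ge> 0" using ln0 by (simp_all add: y_def z_def)
    have d: "\<bar>exp (- y) - exp (- z)\<bar> \<le> min 1 y"
    proof -
      have "(2::real) ^ (2 ^ j) \<le> 2 ^ (2 ^ Suc j)" by (intro power_increasing) auto
      then have "z \<le> y" unfolding y_def z_def using ln0 by (intro divide_left_mono) auto
      then have "\<bar>exp (- y) - exp (- z)\<bar> = exp (- z) - exp (- y)" by simp
      moreover have "exp (- z) \<le> 1" using z0 by simp
      then have "exp (- z) - exp (- y) \<le> 1" using exp_gt_zero[of "- y"] by linarith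
      moreover have "1 - y \<le> exp (- y)" using exp_ge_add_one_self[of "- y"] by simp
      then have "exp (- z) - exp (- y) \<le> y" using \<open>exp (- z) \<le> 1\<close> by linarith
      ultimately show ?thesis by (simp only: min.bounded_iff)
    qed
    show ?thesis
    proof (cases "j < K")
      case True
      have "(exp (- y) - exp (- z))\<^sup>2 \<le> 1\<^sup>2"
        using d by (intro power2_le_iff_abs_le[THEN iffD2]) auto
      then have "2 ^ j * (exp (- y) - exp (- z))\<^sup>2 \<le> 2 ^ j * 1" by (intro mult_left_mono) auto
      also have "\<dots> = 2 ^ K * (1/2) ^ (K - j)"
      proof -
        have "(2::real) ^ K = 2 ^ j * 2 ^ (K - j)" using True by (simp flip: power_add)
        then show ?thesis by (simp add: power_one_over)
      qed
      finally show ?thesis using True unfolding e decay_def by simp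
    next
      case False
      define i where "i = j - K"
      have j: "j = K + i" using False by (simp add: i_def)
      have "(2::nat) ^ j \<ge> J + i"
      proof -
        have "J + i \<le> 2 ^ K + i" using K by simp
        also have "\<dots> \<le> 2 ^ K + 2 ^ K * i" by simp
        also have "\<dots> = 2 ^ K * (i + 1)" by simp
        also have "\<dots> \<le> 2 ^ K * 2 ^ i" by (intro mult_left_mono) (auto simp: Suc_le_eq)
        finally show ?thesis by (simp add: j power_add)
      qed
      then have "(2::real) ^ (J + i) \<le> 2 ^ (2 ^ j)" by (intro power_increasing) auto
      then have "y \<le> 2 ^ J / 2 ^ (J + i)"
        unfolding y_def using ln_le_scale[of n] ln0 by (intro frac_le) (auto simp: J_def)
      also have "\<dots> = (1/2) ^ i" by (simp add: power_add power_one_over)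
      finally have "\<bar>exp (- y) - exp (- z)\<bar> \<le> (1/2) ^ i" using d by simp
      then have "(exp (- y) - exp (- z))\<^sup>2 \<le> ((1/2) ^ i)\<^sup>2"
        by (intro power2_le_iff_abs_le[THEN iffD2]) auto
      then have "2 ^ j * (exp (- y) - exp (- z))\<^sup>2 \<le> 2 ^ j * ((1/2) ^ i)\<^sup>2" by (intro mult_left_mono) auto
      also have "\<dots> = 2 ^ K * (1/2) ^ i"
        by (simp add: j power_add power2_eq_square power_one_over)
      finally show ?thesis using False unfolding e i_def decay_def by simp
    qed
  qed
  moreover have "2 ^ K * decay K j \<le>
      2 * (real (log_scale n) + 1) * decay K j" for j
    using K2 unfolding J_def by (intro mult_right_mono) (auto simp: decay_def)
  ultimately show ?thesis by (meson order_trans)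
qed

text \<open>The two-sided geometric decay sums to at most 4 in both cases, and 4 * 16 + 4 * 2 =
  72.\<close>

lemma increments_suminf_bound:
  assumes n: "n \<ge> 2"
  shows "(\<Sum>j. ennreal (real (j + 1)) * ennreal ((real n powr (- (1 / 2 ^ j)) - real n powr (- (1 / 2 ^ Suc j)))\<^sup>2)
      + ennreal (2 ^ j) * ennreal ((real n powr (- (1 / 2 ^ (2 ^ j))) - real n powr (- (1 / 2 ^ (2 ^ Suc j))))\<^sup>2))
    \<le> ennreal (72 * (real (log_scale n) + 1))"
proof -
  obtain K where K: "\<And>j. 2 ^ j * (real n powr (- (1 / 2 ^ (2 ^ j))) - real n powr (- (1 / 2 ^ (2 ^ Suc j))))\<^sup>2
     \<le> 2 * (real (log_scale n) + 1) * decay K j"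
    using superdyadic_increment_bound[OF n] by blast
  have "(\<Sum>j. ennreal (real (j + 1)) * ennreal ((real n powr (- (1 / 2 ^ j)) - real n powr (- (1 / 2 ^ Suc j)))\<^sup>2)
      + ennreal (2 ^ j) * ennreal ((real n powr (- (1 / 2 ^ (2 ^ j))) - real n powr (- (1 / 2 ^ (2 ^ Suc j))))\<^sup>2))
    \<le> (\<Sum>j. ennreal (16 * (real (log_scale n) + 1) * decay (log_scale n) j)
      + ennreal (2 * (real (log_scale n) + 1) * decay K j))"
  proof (intro suminf_le add_mono summableI)
    fix j
    show "ennreal (real (j + 1)) * ennreal ((real n powr (- (1 / 2 ^ j)) - real n powr (- (1 / 2 ^ Suc j)))\<^sup>2)
      \<le> ennreal (16 * (real (log_scale n) + 1) * decay (log_scale n) j)"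
      unfolding ennreal_mult'[symmetric, OF of_nat_0_le_iff] by (intro ennreal_leI dyadic_increment_bound n)
    show "ennreal (2 ^ j) * ennreal ((real n powr (- (1 / 2 ^ (2 ^ j))) - real n powr (- (1 / 2 ^ (2 ^ Suc j))))\<^sup>2)
      \<le> ennreal (2 * (real (log_scale n) + 1) * decay K j)"
      by (subst ennreal_mult'[symmetric]) (simp, intro ennreal_leI K)
  qed
  also have "\<dots> = (\<Sum>j. ennreal (16 * (real (log_scale n) + 1) * decay (log_scale n) j))
      + (\<Sum>j. ennreal (2 * (real (log_scale n) + 1) * decay K j))"
    by (intro suminf_add[symmetric] summableI)
  also have "\<dots> \<le> ennreal (4 * (16 * (real (log_scale n) + 1))) + ennreal (4 * (2 * (real (log_scale n) + 1)))"
    by (intro add_mono suminf_decay_le) auto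
  also have "\<dots> = ennreal (72 * (real (log_scale n) + 1))"
    by (subst ennreal_plus[symmetric]) (auto simp: algebra_simps)
  finally show ?thesis .
qed

text \<open>The contribution of one n over all half-planes. Let J = \<open>log_scale n\<close> and W
  the tail on the right. For k \<ge> J, n lies in the joint piece and costs the k-th scale weight,
  in total W. For k < J it lies in piece i = J - k, where n^(-2^(-k-1)) \<le> 64 / 4^i; its square
  beats the factor 2^i 4^i = 8^i and leaves 4096 W / 2^i, in total at most 16384 W.\<close>

lemma scale_weight_suminf_bound:
  fixes P :: "nat set"
  assumes ut: "ultra_thin P" and n: "n \<ge> 2"
  shows "(\<Sum>k. \<Sum>i. if (if i = 0 then log_scale n \<le> k else log_scale n = k + i)
       then ennreal (2 ^ i / 4 ^ k * (real (k + i + 1) * real (scale_count P (k + i))) * (real n powr (- (1 / 2 ^ Suc k)))\<^sup>2) else 0)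
     \<le> ennreal (16385 * (\<Sum>k. scale_weight P (k + log_scale n)))"
proof -
  define J where "J = log_scale n"
  let ?w = "scale_weight P"
  have sw: "summable ?w" by (rule summable_scale_weight[OF ut])
  define W where "W = (\<Sum>k. ?w (k + J))"
  have shs: "summable (\<lambda>k. ?w (k + J))" by (rule summable_ignore_initial_segment[OF sw])
  have wJ: "?w J \<le> W"
    using sum_le_suminf[OF shs, of "{0}"] scale_weight_nonneg by (simp add: W_def)
  have W0: "W \<ge> 0" unfolding W_def by (intro suminf_nonneg shs scale_weight_nonneg)
  let ?t = "\<lambda>k i. 2 ^ i / 4 ^ k * (real (k + i + 1) * real (scale_count P (k + i))) * (real n powr (- (1 / 2 ^ Suc k)))\<^sup>2"
  have t0: "?t k 0 \<le> ?w k" for k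
  proof -
    have "real n powr (- (1 / 2 ^ Suc k)) \<le> real n powr 0" using n by (intro powr_mono) auto
    then have "(real n powr (- (1 / 2 ^ Suc k)))\<^sup>2 \<le> 1" using n by (intro power_le_one) auto
    then have "?w k * (real n powr (- (1 / 2 ^ Suc k)))\<^sup>2 \<le> ?w k * 1"
      by (intro mult_left_mono scale_weight_nonneg)
    then show ?thesis by (simp add: scale_weight_def)
  qed
  have t1: "?t k i \<le> 4096 * W * (1/2) ^ i" if J: "J = k + i" and i: "i \<noteq> 0" for k i
  proof -
    obtain i' where i': "i = Suc i'" using i not0_implies_Suc by blast
    define x where "x = ln (real n) / 2 ^ Suc k"
    have x: "2 ^ i / 4 \<le> x"
      using scale_le_ln[OF n] unfolding x_def J_def[symmetric] J by (simp add: power_add field_simps)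
    have x0: "x > 0" using x by (rule order.strict_trans2[rotated]) simp
    have "real n powr (- (1 / 2 ^ Suc k)) = exp (- x)" using n by (simp add: powr_def x_def)
    also have "exp (- x) \<le> (4 / x\<^sup>2)"
    proof -
      have "(x / 2)\<^sup>2 \<le> (exp (x / 2))\<^sup>2" using x0 exp_ge_add_one_self[of "x / 2"] by (intro power_mono) linarith+
      also have "\<dots> = exp x" by (simp add: power2_eq_square exp_add[symmetric])
      finally have "x\<^sup>2 / 4 \<le> exp x" by (simp add: power_divide)
      then have "1 / exp x \<le> 1 / (x\<^sup>2 / 4)" using x0 by (intro divide_left_mono) auto
      then show ?thesis by (simp add: exp_minus inverse_eq_divide)
    qed
    also have "\<dots> \<le> 4 / (2 ^ i / 4)\<^sup>2"
    proof (intro divide_left_mono power_mono x)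
      show "0 < x\<^sup>2 * (2 ^ i / 4)\<^sup>2" using x0 by (intro mult_pos_pos) auto
    qed auto
    also have "\<dots> = 64 * (1/4) ^ i"
      by (simp add: power_divide power2_eq_square power_one_over flip: power_mult_distrib)
    finally have "(real n powr (- (1 / 2 ^ Suc k)))\<^sup>2 \<le> (64 * (1/4) ^ i)\<^sup>2" by (intro power_mono) auto
    also have "\<dots> = 4096 * (1/16) ^ i" by (simp add: power_mult_distrib power2_eq_square flip: power_mult_distrib)
    finally have p: "(real n powr (- (1 / 2 ^ Suc k)))\<^sup>2 \<le> 4096 * (1/16) ^ i" .
    have "2 ^ i / 4 ^ k * (real (k + i + 1) * real (scale_count P (k + i))) = 8 ^ i * ?w J"
    proof -
      have "(8::real) ^ i = 2 ^ i * 4 ^ i" by (simp flip: power_mult_distrib)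
      then show ?thesis unfolding scale_weight_def J power_add by simp
    qed
    then have "?t k i = 8 ^ i * ?w J * (real n powr (- (1 / 2 ^ Suc k)))\<^sup>2" by simp
    also have "\<dots> \<le> 8 ^ i * W * (4096 * (1/16) ^ i)"
      using wJ W0 p scale_weight_nonneg by (intro mult_mono) auto
    also have "\<dots> = 4096 * W * (8 ^ i * (1/16) ^ i)" by simp
    also have "8 ^ i * (1/16) ^ i = (1/2 :: real) ^ i" by (simp flip: power_mult_distrib)
    finally show ?thesis .
  qed
  have inner: "(\<Sum>i. if (if i = 0 then J \<le> k else J = k + i) then ennreal (?t k i) else 0)
     \<le> (if J \<le> k then ennreal (?w k) else 0) + ennreal (4096 * W * decay J k)" for k
  proof (cases "J \<le> k")
    case True
    have "(\<Sum>i. if (if i = 0 then J \<le> k else J = k + i) then ennreal (?t k i) else 0) =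
       (\<Sum>i\<in>{0}. if (if i = 0 then J \<le> k else J = k + i) then ennreal (?t k i) else 0)"
      using True by (intro suminf_finite) auto
    also have "\<dots> = ennreal (?t k 0)" using True by simp
    also have "\<dots> \<le> ennreal (?w k)" by (intro ennreal_leI t0)
    finally show ?thesis using True by (intro add_increasing2) auto
  next
    case False
    have "(\<Sum>i. if (if i = 0 then J \<le> k else J = k + i) then ennreal (?t k i) else 0) =
       (\<Sum>i\<in>{J - k}. if (if i = 0 then J \<le> k else J = k + i) then ennreal (?t k i) else 0)"
      using False by (intro suminf_finite) (auto split: if_splits)
    also have "\<dots> = ennreal (?t k (J - k))" using False by simp
    also have "\<dots> \<le> ennreal (4096 * W * (1/2) ^ (J - k))" using False by (intro ennreal_leI t1) auto
    finally show ?thesis using False by (simp add: decay_def)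
  qed
  have "(\<Sum>k. \<Sum>i. if (if i = 0 then J \<le> k else J = k + i) then ennreal (?t k i) else 0)
    \<le> (\<Sum>k. (if J \<le> k then ennreal (?w k) else 0) + ennreal (4096 * W * decay J k))"
    by (intro suminf_le inner summableI)
  also have "\<dots> = (\<Sum>k. if J \<le> k then ennreal (?w k) else 0) + (\<Sum>k. ennreal (4096 * W * decay J k))"
    by (intro suminf_add[symmetric] summableI)
  also have "\<dots> \<le> ennreal W + ennreal (4 * (4096 * W))"
  proof (rule add_mono)
    define v where "v k = (if J \<le> k then ?w k else 0)" for k
    have v: "(\<lambda>k. v (k + J)) = (\<lambda>k. ?w (k + J))" by (auto simp: v_def)
    have sv: "summable v" using summable_iff_shift[of v J] shs unfolding v by blast
    have "(\<Sum>k. if J \<le> k then ennreal (?w k) else 0) = (\<Sum>k. ennreal (v k))"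
      by (intro suminf_cong) (auto simp: v_def)
    also have "\<dots> = ennreal (suminf v)"
      by (rule suminf_ennreal2[OF _ sv]) (simp add: v_def scale_weight_nonneg)
    also have "suminf v = W"
      using suminf_split_initial_segment[OF sv, of J] unfolding v W_def by (simp add: v_def)
    finally show "(\<Sum>k. if J \<le> k then ennreal (?w k) else 0) \<le> ennreal W" by simp
    have "(\<Sum>k. ennreal ((4096 * W) * decay J k)) \<le> ennreal (4 * (4096 * W))"
      by (rule suminf_decay_le) (use W0 in simp)
    then show "(\<Sum>k. ennreal (4096 * W * decay J k)) \<le> ennreal (4 * (4096 * W))" .
  qed
  also have "\<dots> = ennreal (16385 * W)" using W0 by (subst ennreal_plus[symmetric]) auto
  finally show ?thesis unfolding J_def W_def .
qed

subsection \<open>Random Dirichlet series\<close>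

text \<open>The hypothesis in the two forms used later: the first for suprema of the derivative, the
  second for second moments at a fixed point, where the factor J + 1 of the scale remains for the
  radial limits.\<close>

lemma weighted_sums_finite:
  fixes a :: "nat \<Rightarrow> complex"
  assumes ut: "ultra_thin P"
    and sum: "(\<lambda>n. (cmod (a n))\<^sup>2 * weight_seq P n * (ln (real n))\<^sup>2) summable_on smooth_numbers P"
  shows "(\<Sum>n. if n \<in> smooth_numbers P \<and> n \<ge> 2
      then ennreal ((cmod (a n) * ln (real n))\<^sup>2 * (\<Sum>k. scale_weight P (k + log_scale n))) else 0) < \<infinity>" (is ?th1)
    and "(\<Sum>n. if n \<in> smooth_numbers P \<and> n \<ge> 2
      then ennreal ((cmod (a n))\<^sup>2 * (real (log_scale n) + 1)) else 0) < \<infinity>" (is ?th2)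
proof -
  let ?N = "smooth_numbers P"
  define C where "C = 8 + (\<Sum>k. scale_weight P k)"
  have C0: "C \<ge> 0" unfolding C_def
    by (intro add_nonneg_nonneg suminf_nonneg summable_scale_weight[OF ut] scale_weight_nonneg) simp
  define W where "W n = (\<Sum>k. scale_weight P (k + log_scale n))" for n
  define h where "h n = (if n \<in> ?N then (cmod (a n))\<^sup>2 * weight_seq P n * (ln (real n))\<^sup>2 else 0)" for n
  have h0: "h n \<ge> 0" for n using weight_seq_nonneg[OF ut] by (simp add: h_def)
  have "h summable_on UNIV"
    using sum by (rule summable_on_cong_neutral[THEN iffD1, rotated -1]) (auto simp: h_def)
  then have "summable h" using summable_on_UNIV_nonneg_real_iff[of h] h0 by blast
  then have "(\<Sum>n. ennreal (h n)) = ennreal (suminf h)" using h0 by (intro suminf_ennreal2)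
  then have fin: "ennreal C * (\<Sum>n. ennreal (h n)) < \<infinity>" by (simp add: ennreal_mult_less_top)
  have W: "W n \<le> C * weight_seq P n" if "n \<ge> 2" for n
    unfolding W_def C_def by (rule tail_scale_weight_le[OF ut that])
  have "(\<Sum>n. if n \<in> ?N \<and> n \<ge> 2 then ennreal ((cmod (a n) * ln (real n))\<^sup>2 * W n) else 0)
      \<le> (\<Sum>n. ennreal C * ennreal (h n))"
  proof (intro suminf_le summableI)
    fix n
    have "(cmod (a n) * ln (real n))\<^sup>2 * W n \<le> C * h n" if "n \<in> ?N" "n \<ge> 2"
    proof -
      have "(cmod (a n) * ln (real n))\<^sup>2 * W n \<le> (cmod (a n) * ln (real n))\<^sup>2 * (C * weight_seq P n)"
        by (intro mult_left_mono W that) simp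
      also have "\<dots> = C * h n" using that by (simp add: h_def power_mult_distrib)
      finally show ?thesis .
    qed
    then show "(if n \<in> ?N \<and> n \<ge> 2 then ennreal ((cmod (a n) * ln (real n))\<^sup>2 * W n) else 0) \<le> ennreal C * ennreal (h n)"
      using C0 by (auto simp: ennreal_mult'[symmetric] intro: ennreal_leI)
  qed
  also have "\<dots> = ennreal C * (\<Sum>n. ennreal (h n))" by (rule ennreal_suminf_cmult)
  finally show th1: ?th1 using fin unfolding W_def by (rule order.strict_trans1)
  have "(\<Sum>n. if n \<in> ?N \<and> n \<ge> 2 then ennreal ((cmod (a n))\<^sup>2 * (real (log_scale n) + 1)) else 0)
      \<le> (\<Sum>n. 4 * (if n \<in> ?N \<and> n \<ge> 2 then ennreal ((cmod (a n) * ln (real n))\<^sup>2 * W n) else 0))"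
  proof (intro suminf_le summableI)
    fix n
    have *: "(cmod (a n))\<^sup>2 * (real (log_scale n) + 1) \<le> 4 * ((cmod (a n) * ln (real n))\<^sup>2 * W n)" if n: "n \<in> ?N" "n \<ge> 2"
    proof -
      \<comment> \<open>A smooth n \<ge> 2 has a prime factor in P up to its own scale, so the count
        at that scale is at least 1 and W n \<ge> (J + 1) / 4^J. This is compensated by 4^J \<le> 4
        ln^2 n.\<close>
      obtain p where "p \<in> prime_factors n"
        using prime_factor_nat[of n] n by (auto simp: prime_factors_dvd)
      then have "p \<in> {p \<in> P. real p \<le> exp (2 ^ log_scale n)}"
        using smooth_prime_factors_le[OF n(1) ln_le_scale] by blast
      then have "card {p \<in> P. real p \<le> exp (2 ^ log_scale n)} > 0"
        using finite_primes_le card_gt_0_iff by blast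
      then have "scale_count P (log_scale n) \<ge> 1" by (simp add: scale_count_def prime_count_in_def)
      then have "(real (log_scale n) + 1) * 1 / 4 ^ log_scale n \<le> scale_weight P (log_scale n)"
        unfolding scale_weight_def by (intro divide_right_mono mult_mono) auto
      also have "\<dots> \<le> W n"
        using sum_le_suminf[OF summable_ignore_initial_segment[OF summable_scale_weight[OF ut]], of "{0}" "log_scale n"]
          scale_weight_nonneg by (simp add: W_def)
      finally have w: "(real (log_scale n) + 1) / 4 ^ log_scale n \<le> W n" by simp
      have "4 ^ log_scale n = ((2::real) ^ log_scale n)\<^sup>2" by (simp add: power2_eq_square flip: power_mult_distrib)
      also have "\<dots> \<le> (2 * ln (real n))\<^sup>2" using scale_le_ln[OF n(2)] by (intro power_mono) auto
      finally have l: "4 ^ log_scale n \<le> 4 * (ln (real n))\<^sup>2" by (simp add: power_mult_distrib)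
      have "real (log_scale n) + 1 = 4 ^ log_scale n * ((real (log_scale n) + 1) / 4 ^ log_scale n)" by simp
      also have "\<dots> \<le> (4 * (ln (real n))\<^sup>2) * W n" using w l by (intro mult_mono) auto
      finally have "(cmod (a n))\<^sup>2 * (real (log_scale n) + 1) \<le> (cmod (a n))\<^sup>2 * ((4 * (ln (real n))\<^sup>2) * W n)"
        by (intro mult_left_mono) auto
      then show ?thesis by (simp add: power_mult_distrib mult_ac)
    qed
    show "(if n \<in> ?N \<and> n \<ge> 2 then ennreal ((cmod (a n))\<^sup>2 * (real (log_scale n) + 1)) else 0)
      \<le> 4 * (if n \<in> ?N \<and> n \<ge> 2 then ennreal ((cmod (a n) * ln (real n))\<^sup>2 * W n) else 0)"
    proof (cases "n \<in> ?N \<and> n \<ge> 2")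
      case True
      have "ennreal ((cmod (a n))\<^sup>2 * (real (log_scale n) + 1)) \<le> ennreal (4 * ((cmod (a n) * ln (real n))\<^sup>2 * W n))"
        using True by (intro ennreal_leI *) auto
      also have "\<dots> = 4 * ennreal ((cmod (a n) * ln (real n))\<^sup>2 * W n)"
        by (subst ennreal_mult') auto
      finally show ?thesis using True by simp
    qed auto
  qed
  also have "\<dots> = 4 * (\<Sum>n. if n \<in> ?N \<and> n \<ge> 2 then ennreal ((cmod (a n) * ln (real n))\<^sup>2 * W n) else 0)"
    by (rule ennreal_suminf_cmult)
  also have "\<dots> < \<infinity>"
    using th1 unfolding W_def[symmetric] by (simp add: ennreal_mult_less_top)
  finally show ?th2 .
qed

context prob_space
begin

context
  fixes P :: "nat set" and a :: "nat \<Rightarrow> complex" and \<epsilon> :: "nat \<Rightarrow> 'a \<Rightarrow> real"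
  assumes P: "\<forall>p\<in>P. prime p" and ut: "ultra_thin P"
    and rad: "rademacher_family M (smooth_numbers P) \<epsilon>"
    and sum: "(\<lambda>n. (cmod (a n))\<^sup>2 * weight_seq P n * (ln (real n))\<^sup>2) summable_on smooth_numbers P"
begin

text \<open>One random majorant for each half-plane k and piece i, from the supremum bound at scale
  k + i and abscissa 2^(-k-1). The double sum is finite almost surely because its expectation
  is.\<close>

lemma random_block_bounds:
  defines "A \<equiv> \<lambda>k i. if i = 0 then {n \<in> smooth_numbers P. n \<ge> 2 \<and> log_scale n \<le> k}
      else {n \<in> smooth_numbers P. n \<ge> 2 \<and> log_scale n = k + i}"
  obtains U :: "nat \<Rightarrow> nat \<Rightarrow> 'a \<Rightarrow> real" where
    "\<And>k i \<omega>. U k i \<omega> \<ge> 0"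
    "\<And>k i \<omega> s. Re s \<ge> 1 / 2 ^ Suc k \<Longrightarrow>
      (cmod (\<Sum>n\<in>A k i. of_real (\<epsilon> n \<omega>) * a n * of_real (ln (real n)) * of_nat n powr (- s)))\<^sup>2 \<le> U k i \<omega>"
    "AE \<omega> in M. (\<Sum>k. \<Sum>i. ennreal (2 ^ i / 4 ^ k * U k i \<omega>)) < \<infinity>"
proof -
  let ?N = "smooth_numbers P"
  have memA: "n \<in> A k i \<longleftrightarrow> n \<in> ?N \<and> n \<ge> 2 \<and> (if i = 0 then log_scale n \<le> k else log_scale n = k + i)" for n k i
    by (simp add: A_def)
  have finA: "finite (A k i)" for k i
    by (rule finite_subset[OF _ finite_scale_le[of "k + i"]]) (auto simp: memA split: if_splits)
  have A: "A k i \<subseteq> {n \<in> ?N. n \<ge> 2 \<and> ln (real n) \<le> 2 ^ (k + i)}" for k i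
    by (auto simp: memA scale_le_iff[symmetric] split: if_splits)
  obtain C where C: "C \<ge> 0"
    "\<And>j A b \<sigma>. finite A \<Longrightarrow> A \<subseteq> {n \<in> smooth_numbers P. n \<ge> 2 \<and> ln (real n) \<le> 2 ^ j} \<Longrightarrow>
      \<exists>U. U \<in> borel_measurable M \<and> (\<forall>\<omega>. 0 \<le> U \<omega>) \<and>
        (\<forall>\<omega> s. Re s \<ge> \<sigma> \<longrightarrow> (cmod (\<Sum>n\<in>A. of_real (\<epsilon> n \<omega>) * b n * of_nat n powr (- s)))\<^sup>2 \<le> U \<omega>) \<and>
        (\<integral>\<^sup>+\<omega>. ennreal (U \<omega>) \<partial>M) \<le>
          ennreal (C * (real (j + 1) * real (scale_count P j)) * (\<Sum>n\<in>A. (cmod (b n) * real n powr (- \<sigma>))\<^sup>2))"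
    using random_dirichlet_poly_sup[OF rad P ut] by blast
  \<comment> \<open>The factor ln n appears because it is the derivative of the series that is
    bounded.\<close>
  define b where "b n = a n * of_real (ln (real n))" for n
  define E where "E k i = C * (real (k + i + 1) * real (scale_count P (k + i))) * (\<Sum>n\<in>A k i. (cmod (b n) * real n powr (- (1 / 2 ^ Suc k)))\<^sup>2)" for k i
  define Q where "Q k i U \<longleftrightarrow> U \<in> borel_measurable M \<and> (\<forall>\<omega>. 0 \<le> U \<omega>) \<and>
        (\<forall>\<omega> s. Re s \<ge> 1 / 2 ^ Suc k \<longrightarrow> (cmod (\<Sum>n\<in>A k i. of_real (\<epsilon> n \<omega>) * b n * of_nat n powr (- s)))\<^sup>2 \<le> U \<omega>) \<and>
        (\<integral>\<^sup>+\<omega>. ennreal (U \<omega>) \<partial>M) \<le> ennreal (E k i)" for k i and U :: "'a \<Rightarrow> real"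
  have "\<exists>U. Q k i U" for k i
    unfolding Q_def E_def by (rule C(2)[OF finA A])
  then obtain U where QU: "\<And>k i. Q k i (U k i)" by metis
  have U: "\<And>k i. U k i \<in> borel_measurable M" "\<And>k i \<omega>. 0 \<le> U k i \<omega>"
    "\<And>k i \<omega> s. Re s \<ge> 1 / 2 ^ Suc k \<Longrightarrow> (cmod (\<Sum>n\<in>A k i. of_real (\<epsilon> n \<omega>) * b n * of_nat n powr (- s)))\<^sup>2 \<le> U k i \<omega>"
    "\<And>k i. (\<integral>\<^sup>+\<omega>. ennreal (U k i \<omega>) \<partial>M) \<le> ennreal (E k i)"
    using QU unfolding Q_def by blast+
  note [measurable] = U(1)
  have "(\<integral>\<^sup>+\<omega>. (\<Sum>k. \<Sum>i. ennreal (2 ^ i / 4 ^ k * U k i \<omega>)) \<partial>M) < \<infinity>"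
  proof -
    define q where "q n = (cmod (a n) * ln (real n))\<^sup>2" for n
    define t where "t k i n = 2 ^ i / 4 ^ k * (real (k + i + 1) * real (scale_count P (k + i))) * (real n powr (- (1 / 2 ^ Suc k)))\<^sup>2" for k i n
    have t0: "t k i n \<ge> 0" for k i n by (simp add: t_def)
    have q0: "q n \<ge> 0" for n by (simp add: q_def)
    have "(\<integral>\<^sup>+\<omega>. (\<Sum>k. \<Sum>i. ennreal (2 ^ i / 4 ^ k * U k i \<omega>)) \<partial>M) =
        (\<Sum>k. \<Sum>i. \<integral>\<^sup>+\<omega>. ennreal (2 ^ i / 4 ^ k * U k i \<omega>) \<partial>M)"
      by (simp add: nn_integral_suminf)
    also have "\<dots> \<le> (\<Sum>k. \<Sum>i. \<Sum>n. if n \<in> A k i then ennreal (C * q n * t k i n) else 0)"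
    proof (intro suminf_le summableI)
      fix k i
      have "(\<integral>\<^sup>+\<omega>. ennreal (2 ^ i / 4 ^ k * U k i \<omega>) \<partial>M) = ennreal (2 ^ i / 4 ^ k) * (\<integral>\<^sup>+\<omega>. ennreal (U k i \<omega>) \<partial>M)"
      proof -
        have "ennreal (2 ^ i / 4 ^ k * U k i \<omega>) = ennreal (2 ^ i / 4 ^ k) * ennreal (U k i \<omega>)" for \<omega>
          by (rule ennreal_mult') simp
        then show ?thesis by (simp only:) (rule nn_integral_cmult, measurable)
      qed
      also have "\<dots> \<le> ennreal (2 ^ i / 4 ^ k) * ennreal (E k i)" by (intro mult_left_mono U(4)) simp
      also have "\<dots> = ennreal (2 ^ i / 4 ^ k * E k i)" by (rule ennreal_mult'[symmetric]) simp
      also have "2 ^ i / 4 ^ k * E k i = (\<Sum>n\<in>A k i. C * q n * t k i n)"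
      proof -
        have "C * q n * t k i n = 2 ^ i / 4 ^ k * (C * (real (k + i + 1) * real (scale_count P (k + i)))) *
           (cmod (b n) * real n powr (- (1 / 2 ^ Suc k)))\<^sup>2" for n
          unfolding q_def t_def b_def norm_mult norm_of_real power_mult_distrib power2_abs
          by (simp only: mult_ac)
        then show ?thesis unfolding E_def sum_distrib_left by (simp only: mult.assoc)
      qed
      also have "ennreal (\<Sum>n\<in>A k i. C * q n * t k i n) = (\<Sum>n\<in>A k i. ennreal (C * q n * t k i n))"
        using C(1) q0 t0 by (intro sum_ennreal[symmetric]) simp
      also have "\<dots> = (\<Sum>n. if n \<in> A k i then ennreal (C * q n * t k i n) else 0)"
        by (rule sum_eq_suminf_if[OF finA])
      finally show "(\<integral>\<^sup>+\<omega>. ennreal (2 ^ i / 4 ^ k * U k i \<omega>) \<partial>M) \<le> (\<Sum>n. if n \<in> A k i then ennreal (C * q n * t k i n) else 0)" .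
    qed
    \<comment> \<open>All terms being nonnegative, the sum over n is moved outside, so that each
      coefficient can be weighed over all k and i at once.\<close>
    also have "\<dots> = (\<Sum>k. \<Sum>n. \<Sum>i. if n \<in> A k i then ennreal (C * q n * t k i n) else 0)"
      by (intro suminf_cong ennreal_suminf_swap)
    also have "\<dots> = (\<Sum>n. \<Sum>k. \<Sum>i. if n \<in> A k i then ennreal (C * q n * t k i n) else 0)"
      by (rule ennreal_suminf_swap)
    also have "\<dots> \<le> (\<Sum>n. ennreal (16385 * C) * (if n \<in> ?N \<and> n \<ge> 2
      then ennreal (q n * (\<Sum>k. scale_weight P (k + log_scale n))) else 0))"
    proof (intro suminf_le summableI)
      fix n
      show "(\<Sum>k. \<Sum>i. if n \<in> A k i then ennreal (C * q n * t k i n) else 0) \<le>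
         ennreal (16385 * C) * (if n \<in> ?N \<and> n \<ge> 2 then ennreal (q n * (\<Sum>k. scale_weight P (k + log_scale n))) else 0)"
      proof (cases "n \<in> ?N \<and> n \<ge> 2")
        case True
        let ?W = "\<Sum>k. scale_weight P (k + log_scale n)"
        have "(\<Sum>k. \<Sum>i. if n \<in> A k i then ennreal (C * q n * t k i n) else 0) =
          (\<Sum>k. \<Sum>i. ennreal (C * q n) * (if (if i = 0 then log_scale n \<le> k else log_scale n = k + i) then ennreal (t k i n) else 0))"
          using True C(1) q0 by (intro suminf_cong) (simp add: memA ennreal_mult')
        also have "\<dots> = ennreal (C * q n) * (\<Sum>k. \<Sum>i. if (if i = 0 then log_scale n \<le> k else log_scale n = k + i) then ennreal (t k i n) else 0)"
          by simp
        also have "\<dots> \<le> ennreal (C * q n) * ennreal (16385 * ?W)"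
          unfolding t_def using scale_weight_suminf_bound[OF ut, of n] True by (intro mult_left_mono) auto
        also have "\<dots> = ennreal ((C * q n) * (16385 * ?W))" by (rule ennreal_mult'[symmetric]) (use C(1) q0 in simp)
        also have "(C * q n) * (16385 * ?W) = (16385 * C) * (q n * ?W)" by simp
        also have "ennreal \<dots> = ennreal (16385 * C) * ennreal (q n * ?W)" by (rule ennreal_mult') (use C(1) in simp)
        finally show ?thesis using True by simp
      next
        case False
        then have "n \<notin> A k i" for k i by (auto simp: memA)
        then show ?thesis by simp
      qed
    qed
    also have "\<dots> = ennreal (16385 * C) * (\<Sum>n. if n \<in> ?N \<and> n \<ge> 2
      then ennreal (q n * (\<Sum>k. scale_weight P (k + log_scale n))) else 0)" by (rule ennreal_suminf_cmult)
    also have "\<dots> < \<infinity>"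
      using weighted_sums_finite(1)[OF ut sum] unfolding q_def by (simp add: ennreal_mult_less_top)
    finally show ?thesis .
  qed
  then have "AE \<omega> in M. (\<Sum>k. \<Sum>i. ennreal (2 ^ i / 4 ^ k * U k i \<omega>)) \<noteq> \<infinity>"
    by (intro nn_integral_noteq_infinite) (auto simp: less_top)
  then have fin: "AE \<omega> in M. (\<Sum>k. \<Sum>i. ennreal (2 ^ i / 4 ^ k * U k i \<omega>)) < \<infinity>"
    by (simp add: less_top)
  show thesis
    by (rule that[OF U(2) _ fin]) (use U(3) in \<open>simp add: b_def mult.assoc\<close>)
qed

text \<open>Written with a liminf of partial sums because it is measurable jointly in \<omega> and t
  before any limit function is available, and Fatou's lemma bounds its expectation by the second
  moments.\<close>

lemma random_increments:
  defines "X \<equiv> \<lambda>K \<sigma> t \<omega>. \<Sum>n | n \<in> smooth_numbers P \<and> n \<ge> 2 \<and> log_scale n \<le> K.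
      of_real (\<epsilon> n \<omega>) * a n * of_nat n powr (- Complex \<sigma> t)"
  defines "d \<equiv> \<lambda>\<sigma> \<sigma>' t \<omega>. liminf (\<lambda>K. ennreal ((cmod (X K \<sigma> t \<omega> - X K \<sigma>' t \<omega>))\<^sup>2))"
  shows "AE \<omega> in M. AE t in lborel.
    (\<Sum>j. ennreal (real (j + 1)) * d (1 / 2 ^ j) (1 / 2 ^ Suc j) t \<omega>
       + ennreal (2 ^ j) * d (1 / 2 ^ (2 ^ j)) (1 / 2 ^ (2 ^ Suc j)) t \<omega>) < \<infinity>"
proof -
  let ?N = "smooth_numbers P"
  define L where "L K = {n \<in> ?N. n \<ge> 2 \<and> log_scale n \<le> K}" for K
  have finL: "finite (L K)" for K
    unfolding L_def by (rule finite_subset[OF _ finite_scale_le[of K]]) auto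
  have Xdef: "X K \<sigma> t \<omega> = (\<Sum>n\<in>L K. of_real (\<epsilon> n \<omega>) * a n * of_nat n powr (- Complex \<sigma> t))" for K \<sigma> t \<omega>
    by (simp add: X_def L_def)
  have pm: "(\<lambda>t. of_nat n powr (- Complex \<sigma> t) :: complex) \<in> borel_measurable borel" if "n > 0" for n \<sigma>
  proof (rule borel_measurable_continuous_onI)
    have "continuous_on UNIV (\<lambda>t. exp (- Complex \<sigma> t * Ln (of_nat n)))"
      unfolding Complex_eq by (intro continuous_intros)
    then show "continuous_on UNIV (\<lambda>t. of_nat n powr (- Complex \<sigma> t) :: complex)"
      using that by (simp add: powr_def)
  qed
  have Xm[measurable]: "(\<lambda>p. X K \<sigma> (snd p) (fst p)) \<in> borel_measurable (M \<Otimes>\<^sub>M lborel)" for K \<sigma>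
    unfolding Xdef
  proof (intro borel_measurable_sum borel_measurable_times)
    fix n assume n: "n \<in> L K"
    then have "\<epsilon> n \<in> borel_measurable M" by (intro rademacher_measurable[OF rad]) (simp add: L_def)
    then have "(\<lambda>\<omega>. complex_of_real (\<epsilon> n \<omega>)) \<in> borel_measurable M" by measurable
    from measurable_compose[OF measurable_fst this]
    show "(\<lambda>p. complex_of_real (\<epsilon> n (fst p))) \<in> borel_measurable (M \<Otimes>\<^sub>M lborel)" .
    have "(\<lambda>t. of_nat n powr (- Complex \<sigma> t) :: complex) \<in> borel_measurable lborel"
      using pm[of n \<sigma>] n by (simp add: L_def)
    from measurable_compose[OF measurable_snd this]
    show "(\<lambda>p. of_nat n powr (- Complex \<sigma> (snd p)) :: complex) \<in> borel_measurable (M \<Otimes>\<^sub>M lborel)" .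
  qed simp
  have dm[measurable]: "(\<lambda>p. d \<sigma> \<sigma>' (snd p) (fst p)) \<in> borel_measurable (M \<Otimes>\<^sub>M lborel)" for \<sigma> \<sigma>'
    unfolding d_def by measurable
  have dt[measurable]: "(\<lambda>\<omega>. d \<sigma> \<sigma>' t \<omega>) \<in> borel_measurable M" for \<sigma> \<sigma>' t
    using measurable_compose[OF measurable_Pair2'[of t lborel M] dm[of \<sigma> \<sigma>']] by simp
  have Xt[measurable]: "(\<lambda>\<omega>. X K \<sigma> t \<omega>) \<in> borel_measurable M" for K \<sigma> t
    using measurable_compose[OF measurable_Pair2'[of t lborel M] Xm[of K \<sigma>]] by simp
  define Y where "Y t \<omega> = (\<Sum>j. ennreal (real (j + 1)) * d (1 / 2 ^ j) (1 / 2 ^ Suc j) t \<omega>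
       + ennreal (2 ^ j) * d (1 / 2 ^ (2 ^ j)) (1 / 2 ^ (2 ^ Suc j)) t \<omega>)" for t \<omega>
  have Ym[measurable]: "(\<lambda>p. Y (snd p) (fst p)) \<in> borel_measurable (M \<Otimes>\<^sub>M lborel)"
    unfolding Y_def by measurable
  have Yt[measurable]: "(\<lambda>\<omega>. Y t \<omega>) \<in> borel_measurable M" for t
    unfolding Y_def by measurable
  define V where "V \<sigma> \<sigma>' n = (if n \<in> ?N \<and> n \<ge> 2 then ennreal ((cmod (a n))\<^sup>2) * ennreal ((real n powr (- \<sigma>) - real n powr (- \<sigma>'))\<^sup>2) else 0)" for \<sigma> \<sigma>' n
  have Ed: "(\<integral>\<^sup>+\<omega>. d \<sigma> \<sigma>' t \<omega> \<partial>M) \<le> 20 * (\<Sum>n. V \<sigma> \<sigma>' n)" for \<sigma> \<sigma>' t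
  proof -
    have "(\<integral>\<^sup>+\<omega>. d \<sigma> \<sigma>' t \<omega> \<partial>M) \<le> liminf (\<lambda>K. \<integral>\<^sup>+\<omega>. ennreal ((cmod (X K \<sigma> t \<omega> - X K \<sigma>' t \<omega>))\<^sup>2) \<partial>M)"
      unfolding d_def by (rule nn_integral_liminf) measurable
    also have "\<dots> \<le> limsup (\<lambda>K. \<integral>\<^sup>+\<omega>. ennreal ((cmod (X K \<sigma> t \<omega> - X K \<sigma>' t \<omega>))\<^sup>2) \<partial>M)"
      by (rule Liminf_le_Limsup) simp
    also have "\<dots> \<le> 20 * (\<Sum>n. V \<sigma> \<sigma>' n)"
    proof (intro Limsup_bounded always_eventually allI)
      fix K
      define c where "c n = a n * (of_nat n powr (- Complex \<sigma> t) - of_nat n powr (- Complex \<sigma>' t))" for n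
      have "X K \<sigma> t \<omega> - X K \<sigma>' t \<omega> = (\<Sum>n\<in>L K. c n * of_real (\<epsilon> n \<omega>))" for \<omega>
        unfolding Xdef c_def sum_subtractf[symmetric] by (intro sum.cong refl) (simp add: algebra_simps)
      then have "(\<integral>\<^sup>+\<omega>. ennreal ((cmod (X K \<sigma> t \<omega> - X K \<sigma>' t \<omega>))\<^sup>2) \<partial>M) =
         (\<integral>\<^sup>+\<omega>. ennreal ((cmod (\<Sum>n\<in>L K. c n * of_real (\<epsilon> n \<omega>)))\<^sup>2) \<partial>M)" by simp
      also have "\<dots> \<le> ennreal (20 * (\<Sum>n\<in>L K. (cmod (c n))\<^sup>2))"
        by (rule rademacher_second_moment[OF rad finL]) (auto simp: L_def)
      also have "\<dots> = 20 * (\<Sum>n\<in>L K. ennreal ((cmod (c n))\<^sup>2))"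
        by (simp add: ennreal_mult' sum_ennreal)
      also have "(\<Sum>n\<in>L K. ennreal ((cmod (c n))\<^sup>2)) = (\<Sum>n\<in>L K. V \<sigma> \<sigma>' n)"
      proof (intro sum.cong refl)
        fix n assume n: "n \<in> L K"
        \<comment> \<open>Splitting off the unimodular factor n^(-it) shows that the moment bound
          does not depend on t.\<close>
        have sp: "of_nat n powr (- Complex x t) = of_real (real n powr (- x)) * (of_nat n powr (- Complex 0 t) :: complex)" for x
        proof -
          have "of_real (real n powr (- x)) = (of_nat n powr (- of_real x) :: complex)"
            using powr_of_real[of "real n" "- x"] by simp
          moreover have "- Complex x t = - of_real x + - Complex 0 t" by (simp add: complex_eq_iff)
          ultimately show ?thesis by (simp only: powr_add)
        qed
        have "cmod (of_nat n powr (- Complex 0 t)) = 1"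
          using norm_nat_powr[of n "- Complex 0 t"] n by (simp add: L_def)
        then have "cmod (c n) = cmod (a n) * \<bar>real n powr (- \<sigma>) - real n powr (- \<sigma>')\<bar>"
          unfolding c_def sp[of \<sigma>] sp[of \<sigma>'] left_diff_distrib[symmetric] norm_mult of_real_diff[symmetric] norm_of_real
          by simp
        then show "ennreal ((cmod (c n))\<^sup>2) = V \<sigma> \<sigma>' n"
          using n by (simp add: V_def L_def power_mult_distrib ennreal_mult')
      qed
      also have "\<dots> \<le> (\<Sum>n. V \<sigma> \<sigma>' n)" by (intro sum_le_suminf summableI finL) auto
      finally show "(\<integral>\<^sup>+\<omega>. ennreal ((cmod (X K \<sigma> t \<omega> - X K \<sigma>' t \<omega>))\<^sup>2) \<partial>M) \<le> 20 * (\<Sum>n. V \<sigma> \<sigma>' n)"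
        by (simp add: mult_left_mono)
    qed
    finally show ?thesis .
  qed
  have EY: "(\<integral>\<^sup>+\<omega>. Y t \<omega> \<partial>M) < \<infinity>" for t
  proof -
    let ?p = "\<lambda>j. real (j + 1)"
    let ?V1 = "\<lambda>j n. V (1 / 2 ^ j) (1 / 2 ^ Suc j) n"
    let ?V2 = "\<lambda>j n. V (1 / 2 ^ (2 ^ j)) (1 / 2 ^ (2 ^ Suc j)) n"
    have "(\<integral>\<^sup>+\<omega>. Y t \<omega> \<partial>M) = (\<Sum>j. ennreal (?p j) * (\<integral>\<^sup>+\<omega>. d (1 / 2 ^ j) (1 / 2 ^ Suc j) t \<omega> \<partial>M)
       + ennreal (2 ^ j) * (\<integral>\<^sup>+\<omega>. d (1 / 2 ^ (2 ^ j)) (1 / 2 ^ (2 ^ Suc j)) t \<omega> \<partial>M))"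
      unfolding Y_def by (simp add: nn_integral_suminf nn_integral_add nn_integral_cmult)
    also have "\<dots> \<le> (\<Sum>j. ennreal (?p j) * (20 * (\<Sum>n. ?V1 j n))
       + ennreal (2 ^ j) * (20 * (\<Sum>n. ?V2 j n)))"
      by (intro suminf_le summableI add_mono mult_left_mono Ed) auto
    also have "\<dots> = (\<Sum>j. \<Sum>n. 20 * (ennreal (?p j) * ?V1 j n
       + ennreal (2 ^ j) * ?V2 j n))"
    proof (intro suminf_cong)
      fix j
      have "ennreal (?p j) * (20 * (\<Sum>n. ?V1 j n))
         + ennreal (2 ^ j) * (20 * (\<Sum>n. ?V2 j n))
       = 20 * (ennreal (?p j) * (\<Sum>n. ?V1 j n)
         + ennreal (2 ^ j) * (\<Sum>n. ?V2 j n))"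
        by (simp only: distrib_left mult_ac)
      also have "\<dots> = (\<Sum>n. 20 * (ennreal (?p j) * ?V1 j n
       + ennreal (2 ^ j) * ?V2 j n))"
        by (simp only: ennreal_suminf_cmult suminf_add[OF summableI summableI, symmetric])
      finally show "ennreal (?p j) * (20 * (\<Sum>n. ?V1 j n))
         + ennreal (2 ^ j) * (20 * (\<Sum>n. ?V2 j n)) =
        (\<Sum>n. 20 * (ennreal (?p j) * ?V1 j n
       + ennreal (2 ^ j) * ?V2 j n))" .
    qed
    also have "\<dots> = (\<Sum>n. \<Sum>j. 20 * (ennreal (?p j) * ?V1 j n
       + ennreal (2 ^ j) * ?V2 j n))" by (rule ennreal_suminf_swap)
    also have "\<dots> \<le> (\<Sum>n. ennreal 1440 * (if n \<in> ?N \<and> n \<ge> 2 then ennreal ((cmod (a n))\<^sup>2 * (real (log_scale n) + 1)) else 0))"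
    proof (intro suminf_le summableI)
      fix n
      show "(\<Sum>j. 20 * (ennreal (?p j) * ?V1 j n
         + ennreal (2 ^ j) * ?V2 j n))
        \<le> ennreal 1440 * (if n \<in> ?N \<and> n \<ge> 2 then ennreal ((cmod (a n))\<^sup>2 * (real (log_scale n) + 1)) else 0)"
      proof (cases "n \<in> ?N \<and> n \<ge> 2")
        case True
        have "(\<Sum>j. 20 * (ennreal (?p j) * ?V1 j n
           + ennreal (2 ^ j) * ?V2 j n)) =
          (\<Sum>j. (20 * ennreal ((cmod (a n))\<^sup>2)) * (ennreal (?p j) * ennreal ((real n powr (- (1 / 2 ^ j)) - real n powr (- (1 / 2 ^ Suc j)))\<^sup>2)
      + ennreal (2 ^ j) * ennreal ((real n powr (- (1 / 2 ^ (2 ^ j))) - real n powr (- (1 / 2 ^ (2 ^ Suc j))))\<^sup>2)))"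
          unfolding V_def if_P[OF True] by (simp only: distrib_left mult_ac)
        also have "\<dots> = (20 * ennreal ((cmod (a n))\<^sup>2)) * (\<Sum>j. ennreal (?p j) * ennreal ((real n powr (- (1 / 2 ^ j)) - real n powr (- (1 / 2 ^ Suc j)))\<^sup>2)
      + ennreal (2 ^ j) * ennreal ((real n powr (- (1 / 2 ^ (2 ^ j))) - real n powr (- (1 / 2 ^ (2 ^ Suc j))))\<^sup>2))"
          by (rule ennreal_suminf_cmult)
        also have "\<dots> \<le> (20 * ennreal ((cmod (a n))\<^sup>2)) * ennreal (72 * (real (log_scale n) + 1))"
          using True by (intro mult_left_mono increments_suminf_bound) auto
        also have "\<dots> = ennreal ((20 * (cmod (a n))\<^sup>2) * (72 * (real (log_scale n) + 1)))"
          by (simp add: ennreal_mult')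
        also have "(20 * (cmod (a n))\<^sup>2) * (72 * (real (log_scale n) + 1)) = 1440 * ((cmod (a n))\<^sup>2 * (real (log_scale n) + 1))"
          by simp
        also have "ennreal \<dots> = ennreal 1440 * ennreal ((cmod (a n))\<^sup>2 * (real (log_scale n) + 1))"
          by (rule ennreal_mult') simp
        finally show ?thesis using True by simp
      next
        case False
        then have "V \<sigma> \<sigma>' n = 0" for \<sigma> \<sigma>' unfolding V_def by (rule if_not_P)
        then show ?thesis by simp
      qed
    qed
    also have "\<dots> = ennreal 1440 * (\<Sum>n. if n \<in> ?N \<and> n \<ge> 2 then ennreal ((cmod (a n))\<^sup>2 * (real (log_scale n) + 1)) else 0)"
      by (rule ennreal_suminf_cmult)
    also have "\<dots> < \<infinity>"
      using weighted_sums_finite(2)[OF ut sum] by (simp add: ennreal_mult_less_top)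
    finally show ?thesis .
  qed
  \<comment> \<open>The statement holds almost surely at every fixed t; joint measurability allows
    the two almost-everywhere quantifiers to be exchanged, after which \<omega> is chosen
    first.\<close>
  have "AE t in lborel. AE \<omega> in M. Y t \<omega> < \<infinity>"
  proof (rule AE_I2)
    fix t
    have "AE \<omega> in M. Y t \<omega> \<noteq> \<infinity>"
      by (intro nn_integral_noteq_infinite) (use EY[of t] in \<open>auto simp: less_top\<close>)
    then show "AE \<omega> in M. Y t \<omega> < \<infinity>" by (simp add: less_top)
  qed
  moreover interpret pair_sigma_finite M lborel
    by (intro pair_sigma_finite.intro sigma_finite_measure_axioms lborel.sigma_finite_measure_axioms)
  have "{p \<in> space (M \<Otimes>\<^sub>M lborel). Y (snd p) (fst p) < \<infinity>} \<in> sets (M \<Otimes>\<^sub>M lborel)" by measurable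
  ultimately show ?thesis
    using AE_commute[of "\<lambda>\<omega> t. Y t \<omega> < \<infinity>"] unfolding Y_def by simp
qed

text \<open>Three almost sure events carry all the randomness: finite block majorants, signs of
  modulus 1, and finite increment sums for almost every t. The rest is deterministic for fixed
  \<omega>.\<close>

lemma random_series_in_BMOA:
  "AE \<omega> in M. \<exists>f \<in> BMOA. dirichlet_represents (random_coeff (smooth_numbers P) a \<epsilon> \<omega>) f"
proof -
  let ?N = "smooth_numbers P"
  have N: "0 \<notin> ?N" "1 \<in> ?N" by (auto simp: smooth_numbers_def)
  obtain U :: "nat \<Rightarrow> nat \<Rightarrow> 'a \<Rightarrow> real" where U0: "\<And>k i \<omega>. U k i \<omega> \<ge> 0"
    and U: "\<And>k i \<omega> s. Re s \<ge> 1 / 2 ^ Suc k \<Longrightarrow>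
      (cmod (\<Sum>n\<in>(if i = 0 then {n \<in> ?N. n \<ge> 2 \<and> log_scale n \<le> k} else {n \<in> ?N. n \<ge> 2 \<and> log_scale n = k + i}).
        of_real (\<epsilon> n \<omega>) * a n * of_real (ln (real n)) * of_nat n powr (- s)))\<^sup>2 \<le> U k i \<omega>"
    and Ufin: "AE \<omega> in M. (\<Sum>k. \<Sum>i. ennreal (2 ^ i / 4 ^ k * U k i \<omega>)) < \<infinity>"
    using random_block_bounds by blast
  \<comment> \<open>The hypothesis says nothing about a 1, since ln 1 = 0; hence the maximum with
    its modulus.\<close>
  obtain Ba where Ba: "\<And>n. n \<in> ?N \<Longrightarrow> cmod (a n) \<le> Ba"
  proof -
    define h where "h n = (if n \<in> ?N \<and> n \<ge> 2 then ennreal ((cmod (a n))\<^sup>2 * (real (log_scale n) + 1)) else 0)" for n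
    have "suminf h < \<infinity>" using weighted_sums_finite(2)[OF ut sum] by (simp add: h_def[abs_def])
    then obtain B where B: "suminf h = ennreal B" "B \<ge> 0" by (cases "suminf h") auto
    have "cmod (a n) \<le> max (cmod (a 1)) (sqrt B)" if n: "n \<in> ?N" for n
    proof (cases "n \<ge> 2")
      case True
      have "h n \<le> suminf h" using sum_le_suminf[of h "{n}"] by simp
      then have "(cmod (a n))\<^sup>2 * (real (log_scale n) + 1) \<le> B"
        using True n B by (simp add: h_def)
      moreover have "(cmod (a n))\<^sup>2 * 1 \<le> (cmod (a n))\<^sup>2 * (real (log_scale n) + 1)" by (intro mult_left_mono) auto
      ultimately have "(cmod (a n))\<^sup>2 \<le> B" by linarith
      then show ?thesis using real_le_rsqrt by (simp add: le_max_iff_disj)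
    next
      case False
      then have "n = 1" using n N by (cases n) auto
      then show ?thesis by simp
    qed
    then show thesis by (rule that)
  qed
  have signs: "AE \<omega> in M. \<forall>n\<in>?N. \<bar>\<epsilon> n \<omega>\<bar> = 1"
  proof -
    have "AE \<omega> in M. \<bar>\<epsilon> n \<omega>\<bar> = 1" if "n \<in> ?N" for n
      using rademacher_AE[OF rad that] by eventually_elim auto
    then have "AE \<omega> in M. n \<in> ?N \<longrightarrow> \<bar>\<epsilon> n \<omega>\<bar> = 1" for n by (cases "n \<in> ?N") auto
    then have "AE \<omega> in M. \<forall>n. n \<in> ?N \<longrightarrow> \<bar>\<epsilon> n \<omega>\<bar> = 1" unfolding AE_all_countable ..
    then show ?thesis by eventually_elim blast
  qed
  show ?thesis
    using Ufin signs random_increments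
  proof eventually_elim
    case (elim \<omega>)
    define c where "c n = of_real (\<epsilon> n \<omega>) * a n" for n
    have cb: "cmod (c n) \<le> Ba" if "n \<in> ?N" for n
      using elim(2) Ba[OF that] that by (simp add: c_def norm_mult)
    define S where "S K s = (\<Sum>n | n \<in> ?N \<and> n \<ge> 2 \<and> log_scale n \<le> K. c n * of_nat n powr (- s))" for K s
    have Uc: "(cmod (\<Sum>n\<in>(if i = 0 then {n \<in> ?N. n \<ge> 2 \<and> log_scale n \<le> k} else {n \<in> ?N. n \<ge> 2 \<and> log_scale n = k + i}).
        c n * of_real (ln (real n)) * of_nat n powr (- s)))\<^sup>2 \<le> U k i \<omega>" if "Re s \<ge> 1 / 2 ^ Suc k" for k i s
      unfolding c_def by (rule U[OF that])
    obtain f m B where f: "f holomorphic_on {s. Re s > 0}"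
      "\<And>k s. Re s \<ge> 1 / 2 ^ Suc k \<Longrightarrow> cmod (deriv f s) \<le> m k" "summable (\<lambda>k. (m k)\<^sup>2 / 4 ^ k)"
      "\<And>s. Re s \<ge> 1 \<Longrightarrow> cmod (f s) \<le> B"
      "dirichlet_represents (\<lambda>n. if n \<in> ?N then c n else 0) f"
      "\<And>s. Re s > 0 \<Longrightarrow> (\<lambda>K. S K s) \<longlonglongrightarrow> f s - c 1"
    proof (rule dirichlet_series_from_blocks[OF N U0 Uc elim(1) cb])
      fix f m B
      assume h: "f holomorphic_on {s. Re s > 0}"
        "\<And>k s. Re s \<ge> 1 / 2 ^ Suc k \<Longrightarrow> cmod (deriv f s) \<le> m k" "summable (\<lambda>k. (m k)\<^sup>2 / 4 ^ k)"
        "\<And>s. Re s \<ge> 1 \<Longrightarrow> cmod (f s) \<le> B"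
        "dirichlet_represents (\<lambda>n. if n \<in> ?N then c n else 0) f"
        "\<And>s. Re s > 0 \<Longrightarrow> (\<lambda>K. \<Sum>n | n \<in> ?N \<and> n \<ge> 2 \<and> log_scale n \<le> K. c n * of_nat n powr (- s)) \<longlonglongrightarrow> f s - c 1"
      show thesis by (rule that[OF h(1-5)]) (use h(6) in \<open>simp_all add: S_def\<close>)
    qed
    define d where "d \<sigma> \<sigma>' t = liminf (\<lambda>K. ennreal ((cmod (S K (Complex \<sigma> t) - S K (Complex \<sigma>' t)))\<^sup>2))" for \<sigma> \<sigma>' t
    have inc: "AE t in lborel. (\<Sum>j. ennreal (real (j + 1)) * d (1 / 2 ^ j) (1 / 2 ^ Suc j) t
       + ennreal (2 ^ j) * d (1 / 2 ^ (2 ^ j)) (1 / 2 ^ (2 ^ Suc j)) t) < \<infinity>"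
      using elim(3) unfolding d_def S_def c_def .
    have lim: "AE t in lborel. \<exists>l. ((\<lambda>\<sigma>. f (Complex \<sigma> t)) \<longlongrightarrow> l) (at_right 0)"
      using inc
    proof eventually_elim
      case (elim t)
      \<comment> \<open>The partial sums by scale now converge to f minus its constant term, so the
        liminf is the actual increment of f; the constant cancels.\<close>
      have d: "d \<sigma> \<sigma>' t = ennreal ((cmod (f (Complex \<sigma> t) - f (Complex \<sigma>' t)))\<^sup>2)" if "\<sigma> > 0" "\<sigma>' > 0" for \<sigma> \<sigma>'
      proof -
        have "(\<lambda>K. S K (Complex \<sigma> t) - S K (Complex \<sigma>' t)) \<longlonglongrightarrow>
          (f (Complex \<sigma> t) - c 1) - (f (Complex \<sigma>' t) - c 1)"
          using that by (intro tendsto_diff f(6)) auto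
        then have "(\<lambda>K. S K (Complex \<sigma> t) - S K (Complex \<sigma>' t)) \<longlonglongrightarrow> f (Complex \<sigma> t) - f (Complex \<sigma>' t)"
          by simp
        then have "(\<lambda>K. ennreal ((cmod (S K (Complex \<sigma> t) - S K (Complex \<sigma>' t)))\<^sup>2)) \<longlonglongrightarrow>
            ennreal ((cmod (f (Complex \<sigma> t) - f (Complex \<sigma>' t)))\<^sup>2)"
          by (intro tendsto_ennrealI tendsto_power tendsto_norm)
        then show ?thesis unfolding d_def by (simp add: lim_imp_Liminf)
      qed
      define \<phi> where "\<phi> j = f (Complex (1 / 2 ^ j) t)" for j
      define x where "x j = real (j + 1) * (cmod (\<phi> j - \<phi> (Suc j)))\<^sup>2" for j
      define y where "y j = 2 ^ j * (cmod (\<phi> (2 ^ j) - \<phi> (2 ^ Suc j)))\<^sup>2" for j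
      have x0: "x j \<ge> 0" and y0: "y j \<ge> 0" for j by (simp_all add: x_def y_def)
      have xy: "ennreal (real (j + 1)) * d (1 / 2 ^ j) (1 / 2 ^ Suc j) t
       + ennreal (2 ^ j) * d (1 / 2 ^ (2 ^ j)) (1 / 2 ^ (2 ^ Suc j)) t = ennreal (x j) + ennreal (y j)" for j
      proof -
        have "d (1 / 2 ^ j) (1 / 2 ^ Suc j) t = ennreal ((cmod (\<phi> j - \<phi> (Suc j)))\<^sup>2)"
          unfolding \<phi>_def by (rule d) simp_all
        moreover have "d (1 / 2 ^ (2 ^ j)) (1 / 2 ^ (2 ^ Suc j)) t = ennreal ((cmod (\<phi> (2 ^ j) - \<phi> (2 ^ Suc j)))\<^sup>2)"
          unfolding \<phi>_def by (rule d) simp_all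
        moreover have "ennreal (x j) = ennreal (real (j + 1)) * ennreal ((cmod (\<phi> j - \<phi> (Suc j)))\<^sup>2)"
          unfolding x_def by (rule ennreal_mult') simp
        moreover have "ennreal (y j) = ennreal (2 ^ j) * ennreal ((cmod (\<phi> (2 ^ j) - \<phi> (2 ^ Suc j)))\<^sup>2)"
          unfolding y_def by (rule ennreal_mult') simp
        ultimately show ?thesis by (simp only:)
      qed
      have xyfin: "(\<Sum>j. ennreal (x j) + ennreal (y j)) < \<infinity>" using elim unfolding xy .
      have "(\<Sum>j. ennreal (x j)) \<le> (\<Sum>j. ennreal (x j) + ennreal (y j))"
        by (intro suminf_le summableI) simp
      then have "(\<Sum>j. ennreal (x j)) < \<infinity>" using xyfin by (rule order.strict_trans1)
      then have sx: "summable x" by (intro summable_suminf_not_top x0) simp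
      have "(\<Sum>j. ennreal (y j)) \<le> (\<Sum>j. ennreal (x j) + ennreal (y j))"
        by (intro suminf_le summableI) simp
      then have "(\<Sum>j. ennreal (y j)) < \<infinity>" using xyfin by (rule order.strict_trans1)
      then have sy: "summable y" by (intro summable_suminf_not_top y0) simp
      from sx sy have "convergent \<phi>"
        unfolding x_def[abs_def] y_def[abs_def] by (rule convergent_of_dyadic_increments)
      then obtain l where l: "\<phi> \<longlonglongrightarrow> l" by (auto simp: convergent_def)
      \<comment> \<open>This quantity bounds the variation of f between \<sigma> and 2^(-k) for
        2^(-k-1) < \<sigma> \<le> 2^(-k), so convergence along the heights 2^(-k) implies
        convergence of the full radial limit.\<close>
      have mk: "(\<lambda>k. m k / 2 ^ k) \<longlonglongrightarrow> 0"
      proof -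
        have "(\<lambda>k. (m k / 2 ^ k)\<^sup>2) \<longlonglongrightarrow> 0"
        proof -
          have "(m k / 2 ^ k)\<^sup>2 = (m k)\<^sup>2 / 4 ^ k" for k
          proof -
            have "(4::real) ^ k = (2 ^ k)\<^sup>2" by (simp add: power2_eq_square flip: power_mult_distrib)
            then show ?thesis by (simp add: power_divide)
          qed
          then show ?thesis using summable_LIMSEQ_zero[OF f(3)] by simp
        qed
        from tendsto_real_sqrt[OF this] have "(\<lambda>k. \<bar>m k / 2 ^ k\<bar>) \<longlonglongrightarrow> 0" by simp
        then show ?thesis by (rule tendsto_rabs_zero_cancel)
      qed
      have "((\<lambda>\<sigma>. f (Complex \<sigma> t)) \<longlongrightarrow> l) (at_right 0)"
      proof (rule tendstoI)
        fix e :: real assume e: "e > 0"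
        have "eventually (\<lambda>k. dist (\<phi> k) l < e / 2 \<and> \<bar>m k / 2 ^ k\<bar> < e / 2) sequentially"
          using tendstoD[OF l, of "e / 2"] tendstoD[OF mk, of "e / 2"] e by (intro eventually_conj) auto
        then obtain k0 where k0: "\<And>k. k \<ge> k0 \<Longrightarrow> dist (\<phi> k) l < e / 2 \<and> \<bar>m k / 2 ^ k\<bar> < e / 2"
          by (auto simp: eventually_sequentially)
        have "dist (f (Complex \<sigma> t)) l < e" if s: "0 < \<sigma>" "\<sigma> < 1 / 2 ^ k0" for \<sigma>
        proof -
          have "(1::real) / 2 ^ k0 \<le> 1 / 1" by (intro divide_left_mono) auto
          then have "\<sigma> \<le> 1" using s by linarith
          then obtain k where k: "1 / 2 ^ Suc k < \<sigma>" "\<sigma> \<le> 1 / 2 ^ k" using dyadic_scale s by blast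
          have "k \<ge> k0"
          proof (rule ccontr)
            assume "\<not> k \<ge> k0"
            then have "(2::real) ^ Suc k \<le> 2 ^ k0" by (intro power_increasing) auto
            then have "(1::real) / 2 ^ k0 \<le> 1 / 2 ^ Suc k" by (intro divide_left_mono) auto
            then show False using k s by linarith
          qed
          have "cmod (f (Complex \<sigma> t) - \<phi> k) \<le> m k * cmod (Complex \<sigma> t - Complex (1 / 2 ^ k) t)"
            unfolding \<phi>_def
          proof (rule field_differentiable_bound[where S = "{s. Re s \<ge> 1 / 2 ^ Suc k}" and f' = "deriv f"])
            show "convex {s. Re s \<ge> 1 / 2 ^ Suc k}" by (rule convex_halfspace_Re_ge)
            fix z :: complex assume z: "z \<in> {s. Re s \<ge> 1 / 2 ^ Suc k}"
            have "(0::real) < 1 / 2 ^ Suc k" by simp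
            moreover have "1 / 2 ^ Suc k \<le> Re z" using z by (simp only: mem_Collect_eq)
            ultimately have "Re z > 0" by (rule order.strict_trans2)
            then have "(f has_field_derivative deriv f z) (at z)"
              by (intro holomorphic_derivI[OF f(1) open_halfspace_Re_gt]) auto
            then show "(f has_field_derivative deriv f z) (at z within {s. Re s \<ge> 1 / 2 ^ Suc k})"
              by (rule has_field_derivative_at_within)
            show "cmod (deriv f z) \<le> m k" using z by (intro f(2)) simp
          next
            show "Complex \<sigma> t \<in> {s. Re s \<ge> 1 / 2 ^ Suc k}" using k by simp
            show "Complex (1 / 2 ^ k) t \<in> {s. Re s \<ge> 1 / 2 ^ Suc k}" by (simp add: field_simps)
          qed
          also have "cmod (Complex \<sigma> t - Complex (1 / 2 ^ k) t) = 1 / 2 ^ k - \<sigma>"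
          proof -
            have "Complex \<sigma> t - Complex (1 / 2 ^ k) t = of_real (\<sigma> - 1 / 2 ^ k)" by (simp add: complex_eq_iff)
            then show ?thesis using k by (simp only: norm_of_real)
          qed
          also have "m k * (1 / 2 ^ k - \<sigma>) \<le> m k * (1 / 2 ^ k)"
            using s deriv_bound_nonneg[of f m k, OF f(1,2,3)] by (intro mult_left_mono) auto
          also have "\<dots> = m k / 2 ^ k" by simp
          also have "\<dots> \<le> \<bar>m k / 2 ^ k\<bar>" by (rule abs_ge_self)
          also have "\<dots> < e / 2" using k0[OF \<open>k \<ge> k0\<close>] by (rule conjunct2)
          finally have "dist (f (Complex \<sigma> t)) (\<phi> k) < e / 2" by (simp add: dist_norm)
          moreover have "dist (\<phi> k) l < e / 2" using k0[OF \<open>k \<ge> k0\<close>] by simp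
          ultimately show ?thesis using dist_triangle[of "f (Complex \<sigma> t)" l "\<phi> k"] by linarith
        qed
        then show "\<forall>\<^sub>F \<sigma> in at_right 0. dist (f (Complex \<sigma> t)) l < e"
          unfolding eventually_at_right_field by (intro exI[of _ "1 / 2 ^ k0"]) auto
      qed
      then show ?case by blast
    qed
    have "f \<in> BMOA" by (rule BMOA_criterion[OF f(1,2,3,4) lim])
    moreover have "random_coeff ?N a \<epsilon> \<omega> = (\<lambda>n. if n \<in> ?N then c n else 0)"
      by (simp add: random_coeff_def c_def fun_eq_iff)
    ultimately show ?case using f(5) by metis
  qed
qed

end

end

theorem theorem3p8:
  fixes M :: "'a measure" and P :: "nat set" and a :: "nat \<Rightarrow> complex"
    and \<epsilon> :: "nat \<Rightarrow> 'a \<Rightarrow> real"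
  assumes "prob_space M"
    and "\<forall>p\<in>P. prime p"
    and "ultra_thin P"
    and "rademacher_family M (smooth_numbers P) \<epsilon>"
    and "(\<lambda>n. (cmod (a n))\<^sup>2 * weight_seq P n * (ln (real n))\<^sup>2) summable_on smooth_numbers P"
  shows "AE \<omega> in M. \<exists>f \<in> BMOA \<inter> Dirichlet_class.
           dirichlet_represents (random_coeff (smooth_numbers P) a \<epsilon> \<omega>) f"
proof -
  interpret prob_space M by (rule assms(1))
  show ?thesis
    using random_series_in_BMOA[OF assms(2-5)]
    by eventually_elim (auto simp: Dirichlet_class_def)
qed

end
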